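(* Let $Z\subseteq\mathbb{P}^2_{\mathbb{C}}$ be a finite set of points and suppose that $Z$ admits an unexpected curve in degree $d\geq1$. Then $|Z|\leq 3d-3$.
   Context: Let $R=\mathbb{C}[X_0,X_1,X_2]$ be the coordinate ring of $\mathbb{P}^2_{\mathbb{C}}$, and let $[M]_d$ be the degree $d$ part of a graded module $M$. A finite set of (reduced) points $Z\subseteq\mathbb{P}^2$ admits unexpected curves in degree $d$ if, for a general point $Q\in\mathbb{P}^2$, $$\dim[I(Z)\cap I(Q)^{d-1}]_d>\max\{0,\ \dim[I(Z)]_d-\dim[R/I(Q)^{d-1}]_d\}.$$ *)

theory Defs
  imports "HOL-Analysis.Analysis" "HOL-Library.Poly_Mapping"
begin

section \<open>The coordinate ring of the projective plane\<close>

text \<open>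
  A monomial is its exponent vector, indexed by the three-element type \<^typ>\<open>3\<close>; a polynomial maps
  each monomial to its coefficient. The library's product of such maps is the convolution product,
  so this type is the ring \<open>R = \<complex>[X\<^sub>0, X\<^sub>1, X\<^sub>2]\<close>.
\<close>

type_synonym monom3 = "3 \<Rightarrow>\<^sub>0 nat"
type_synonym poly3 = "monom3 \<Rightarrow>\<^sub>0 complex"

definition eval3 :: "poly3 \<Rightarrow> complex ^ 3 \<Rightarrow> complex" where
  "eval3 f v = (\<Sum>m\<in>Poly_Mapping.keys f. Poly_Mapping.lookup f m * (\<Prod>i\<in>UNIV. (v $ i) ^ Poly_Mapping.lookup m i))"

definition monom_degree :: "monom3 \<Rightarrow> nat" where
  "monom_degree m = (\<Sum>i\<in>UNIV. Poly_Mapping.lookup m i)"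

text \<open>The degree \<open>d\<close> part of \<open>R\<close>; it contains the zero polynomial.\<close>

definition forms :: "nat \<Rightarrow> poly3 set" where
  "forms d = {f. \<forall>m\<in>Poly_Mapping.keys f. monom_degree m = d}"

definition const_scale :: "complex \<Rightarrow> poly3 \<Rightarrow> poly3" where
  "const_scale c f = Poly_Mapping.single 0 c * f"

interpretation poly3_vs: vector_space const_scale
  by unfold_locales
    (simp_all add: const_scale_def algebra_simps single_add mult_single
      flip: mult.assoc single_one)

text \<open>\<open>R\<close> as a module over itself: its submodules are the ideals of \<open>R\<close>, and its span is the
  generated ideal.\<close>

interpretation poly3_ideal: module "(*) :: poly3 \<Rightarrow> poly3 \<Rightarrow> poly3"
  by unfold_locales (simp_all add: algebra_simps)

definition ideal_prod :: "poly3 set \<Rightarrow> poly3 set \<Rightarrow> poly3 set" where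
  "ideal_prod I J = poly3_ideal.span {f * g | f g. f \<in> I \<and> g \<in> J}"

primrec ideal_power :: "poly3 set \<Rightarrow> nat \<Rightarrow> poly3 set" where
  "ideal_power I 0 = UNIV"
| "ideal_power I (Suc n) = ideal_prod I (ideal_power I n)"


section \<open>Dimensions of graded pieces\<close>

definition graded_dim :: "poly3 set \<Rightarrow> nat \<Rightarrow> nat" where
  "graded_dim I d = poly3_vs.dim (I \<inter> forms d)"

definition residue_class :: "poly3 set \<Rightarrow> poly3 \<Rightarrow> poly3 set" where
  "residue_class I f = {g. g - f \<in> I}"

text \<open>
  The degree \<open>d\<close> part of \<open>R/I\<close> consists of the residue classes of the forms of degree \<open>d\<close>.
  The predicate says that the classes of \<open>b 0, \<dots>, b (n - 1)\<close> form a basis of it: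
  every class is a linear combination of them, with unique coefficients. The coefficients are
  normalised to be zero outside \<open>{..<n}\<close>, so that they are determined as a function.
\<close>

definition quotient_basis :: "poly3 set \<Rightarrow> nat \<Rightarrow> nat \<Rightarrow> (nat \<Rightarrow> poly3) \<Rightarrow> bool" where
  "quotient_basis I d n b \<longleftrightarrow>
     (\<forall>i<n. b i \<in> forms d) \<and>
     (\<forall>f\<in>forms d. \<exists>!c. (\<forall>i\<ge>n. c i = 0) \<and>
        residue_class I f = residue_class I (\<Sum>i<n. const_scale (c i) (b i)))"

definition quotient_graded_dim :: "poly3 set \<Rightarrow> nat \<Rightarrow> nat" where
  "quotient_graded_dim I d = (THE n. \<exists>b. quotient_basis I d n b)"


section \<open>The projective plane\<close>

typedef proj_plane = "{L :: (complex ^ 3) set. vec.subspace L \<and> vec.dim L = 1}"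
  morphisms line_of Abs_proj_plane
proof -
  have "vec.dim (vec.span {axis 1 1 :: complex ^ 3}) = 1"
    by (simp add: vec.dim_span_eq_card_independent vec.independent_insert axis_eq_0_iff)
  then show ?thesis
    using vec.subspace_span by blast
qed

definition vanishes_at :: "poly3 \<Rightarrow> proj_plane \<Rightarrow> bool" where
  "vanishes_at f P \<longleftrightarrow> (\<forall>v\<in>line_of P - {0}. eval3 f v = 0)"

text \<open>
  Vanishing is required at all homogeneous coordinate vectors of each point, so that (the field
  being infinite) the homogeneous components of a member are members: this is the homogeneous ideal
  generated by the forms vanishing on \<open>Z\<close>.
\<close>

definition vanishing_ideal :: "proj_plane set \<Rightarrow> poly3 set" where
  "vanishing_ideal Z = {f. \<forall>P\<in>Z. vanishes_at f P}"

definition zariski_closed :: "proj_plane set \<Rightarrow> bool" where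
  "zariski_closed C \<longleftrightarrow> (\<exists>F \<subseteq> (\<Union>d. forms d). C = {P. \<forall>f\<in>F. vanishes_at f P})"

definition for_general_point :: "(proj_plane \<Rightarrow> bool) \<Rightarrow> bool" where
  "for_general_point \<phi> \<longleftrightarrow> (\<exists>U. zariski_closed (- U) \<and> U \<noteq> {} \<and> (\<forall>Q\<in>U. \<phi> Q))"


section \<open>Unexpected curves\<close>

text \<open>The expected dimension is compared in \<^typ>\<open>int\<close>, where the difference may be negative.\<close>

definition admits_unexpected_curve :: "proj_plane set \<Rightarrow> nat \<Rightarrow> bool" where
  "admits_unexpected_curve Z d \<longleftrightarrow>
     for_general_point (\<lambda>Q.
       int (graded_dim (vanishing_ideal Z \<inter> ideal_power (vanishing_ideal {Q}) (d - 1)) d)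
       > max 0 (int (graded_dim (vanishing_ideal Z) d)
                - int (quotient_graded_dim (ideal_power (vanishing_ideal {Q}) (d - 1)) d)))"

end

theory Submission
  imports Defs "HOL-Complex_Analysis.Great_Picard"
    "HOL-Computational_Algebra.Fundamental_Theorem_Algebra"
    "HOL-Computational_Algebra.Polynomial_Factorial" "HOL-Computational_Algebra.Field_as_Ring"
begin

text \<open>
  Write \<open>A = [I(Z)]\<^sub>d\<close> and \<open>B = [I(Q)\<^bsup>d-1\<^esup>]\<^sub>d\<close>. The curve is unexpected iff \<open>A \<inter> B \<noteq> 0\<close> and
  \<open>A + B \<noteq> R\<^sub>d\<close>. With linear coordinates \<open>u, v\<close> vanishing at \<open>Q\<close>, an element of \<open>B\<close> is
  \<open>z T(u,v) + S(u,v)\<close> for binary forms of degrees \<open>d - 1\<close> and \<open>d\<close>. Split off lines through \<open>Q\<close>,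
  each of which contains at most one point of \<open>Z\<close>, until \<open>T\<close> and \<open>S\<close> are coprime, of degrees
  \<open>k - 1\<close> and \<open>k\<close>; at least \<open>|Z| - (d - k)\<close> points remain on the curve. For \<open>k = 1\<close> this is a line
  with at most \<open>d - 1\<close> points of \<open>Z\<close> off it, and then \<open>A + B = R\<^sub>d\<close>.

  For \<open>k \<ge> 2\<close> let \<open>Q\<close> move in a direction \<open>w\<close>. The derivative of the equation of the curve, up
  to sign \<open>z\<^sup>2 T\<^sub>w - z (T' - S\<^sub>w) - S'\<close> where \<open>T', S'\<close> are the variations of \<open>T, S\<close>, again
  vanishes at the remaining points. Substituting
  \<open>z = -S/T\<close> gives a binary form of degree \<open>3k - 2\<close> which vanishes in the directions of these
  points. If \<open>w\<close> is a zero of \<open>T\<close>, it also vanishes at \<open>w\<close>, which is not one of these directions;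
  this leaves at most \<open>3k - 3\<close> points. Only when \<open>T\<close> is a power of a linear form can the form be
  zero; then another \<open>w\<close> yields a form divisible by the \<open>(k-2)\<close>-nd power of that linear form, and at
  most \<open>2k\<close> points. Both contradict \<open>|Z| \<ge> 3d - 2\<close> for \<open>d \<ge> 3\<close>. The cases \<open>d \<le> 2\<close> are immediate.
\<close>


section \<open>Contact polynomials\<close>

text \<open>
  The result of eliminating \<open>c\<close> from \<open>c T + S = 0\<close> and from the derivative of this equation as the
  vertex moves, where \<open>T'\<close> and \<open>S'\<close> are the first-order variations of \<open>T\<close> and \<open>S\<close>.
\<close>

definition contact_poly :: "complex poly \<Rightarrow> complex poly \<Rightarrow> complex poly \<Rightarrow> complex poly \<Rightarrow> complex poly" where
  "contact_poly T S T' S' = T\<^sup>2 * S' - S * T * T' + S * T * pderiv S - S\<^sup>2 * pderiv T"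

text \<open>Where \<open>S = - c * T\<close>, the contact polynomial equals \<open>T^2\<close> times
  the left side of the second equation. Nothing is divided by \<open>T\<close>.\<close>

lemma contact_poly_root:
  assumes "c * poly T s + poly S s = 0"
    and "c * poly T' s + poly S' s - c\<^sup>2 * poly (pderiv T) s - c * poly (pderiv S) s = 0"
  shows "poly (contact_poly T S T' S') s = 0"
proof -
  have 1: "poly S s = - (c * poly T s)"
    using assms(1) by (metis add_eq_0_iff)
  have 2: "poly S' s = c\<^sup>2 * poly (pderiv T) s + c * poly (pderiv S) s - c * poly T' s"
    using assms(2) by (simp add: algebra_simps)
  show ?thesis
    unfolding contact_poly_def by (simp add: 1 2) (simp add: algebra_simps power2_eq_square)
qed

lemma coprime_poly_no_common_root:
  fixes p q :: "complex poly"
  assumes "\<And>s. poly p s = 0 \<Longrightarrow> poly q s \<noteq> 0" "p \<noteq> 0"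
  shows "coprime p q"
proof (rule coprimeI)
  fix r assume r: "r dvd p" "r dvd q"
  have "r \<noteq> 0" using r assms(2) by auto
  have "constant (poly r)"
    using fundamental_theorem_of_algebra[of r] assms(1) r
    by (metis dvd_trans poly_eq_0_iff_dvd)
  then have "degree r = 0"
    using constant_degree by blast
  then show "is_unit r"
    using \<open>r \<noteq> 0\<close> is_unit_iff_degree by blast
qed

text \<open>The bound \<open>k - 2\<close> for \<open>T\<close> reflects motion of the vertex in the
  direction of a zero of \<open>T\<close>; it brings the degree of the contact polynomial from
  \<open>3 * k - 2\<close> down to \<open>3 * k - 3\<close>. If that polynomial were zero,
  \<open>T\<close>, being coprime to \<open>S\<close>, would divide its own nonzero
  derivative.\<close>

lemma card_contact_le:
  fixes T S T' S' :: "complex poly" and X :: "complex set"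
  assumes deg: "degree T \<le> k - 2" "degree S \<le> k" "degree T' \<le> k - 1" "degree S' \<le> k"
    and T: "pderiv T \<noteq> 0"
    and coprime: "\<And>s. poly T s = 0 \<Longrightarrow> poly S s \<noteq> 0"
    and X: "\<And>s. s \<in> X \<Longrightarrow> poly (contact_poly T S T' S') s = 0"
  shows "card X \<le> 3 * k - 3"
proof -
  let ?N = "contact_poly T S T' S'"
  have "T \<noteq> 0" "degree T \<noteq> 0"
    using T by (auto simp: pderiv_eq_0_iff)
  then have k: "k \<ge> 3" using deg by linarith
  have "?N \<noteq> 0"
  proof
    assume "?N = 0"
    then have "S\<^sup>2 * pderiv T = T * (T * S' - S * T' + S * pderiv S)"
      unfolding contact_poly_def by (simp add: algebra_simps power2_eq_square)
    then have "T dvd S\<^sup>2 * pderiv T" by simp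
    moreover have "coprime T (S\<^sup>2)"
      by (rule coprime_poly_no_common_root) (use coprime \<open>T \<noteq> 0\<close> in auto)
    ultimately have "T dvd pderiv T"
      using coprime_dvd_mult_right_iff[of T "S\<^sup>2" "pderiv T"] by blast
    then have "degree T \<le> degree (pderiv T)"
      using T by (rule dvd_imp_degree_le)
    then show False
      using \<open>degree T \<noteq> 0\<close> by (simp add: degree_pderiv)
  qed
  moreover have "degree ?N \<le> 3 * k - 3"
  proof -
    have dS: "degree (pderiv S) \<le> k - 1" "degree (pderiv T) \<le> k - 3"
      using deg by (simp_all add: degree_pderiv)
    have "degree (T\<^sup>2 * S') \<le> 3 * k - 3"
      using degree_mult_le[of "T\<^sup>2" S'] degree_power_le[of T 2] deg k by linarith
    moreover have "degree (S * T * T') \<le> 3 * k - 3"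
      using degree_mult_le[of "S * T" T'] degree_mult_le[of S T] deg k by linarith
    moreover have "degree (S * T * pderiv S) \<le> 3 * k - 3"
      using degree_mult_le[of "S * T" "pderiv S"] degree_mult_le[of S T] deg k dS by linarith
    moreover have "degree (S\<^sup>2 * pderiv T) \<le> 3 * k - 3"
      using degree_mult_le[of "S\<^sup>2" "pderiv T"] degree_power_le[of S 2] deg k dS by linarith
    ultimately show ?thesis
      unfolding contact_poly_def by (intro degree_diff_le degree_add_le) auto
  qed
  moreover have "card X \<le> card {s. poly ?N s = 0}"
    using X \<open>?N \<noteq> 0\<close> by (intro card_mono poly_roots_finite) auto
  ultimately show ?thesis
    using card_poly_roots_bound[of ?N] by linarith
qed

text \<open>For \<open>T = c s^(k-1)\<close> every term of the contact polynomial is divisible by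
  \<open>s^(k-2)\<close>. As \<open>s\<close> is nonzero on \<open>X\<close>, only the roots of the
  quotient count.\<close>

lemma card_contact_power_le:
  fixes S T' S' :: "complex poly" and X :: "complex set"
  assumes deg: "degree S \<le> k" "degree T' \<le> k - 1" "degree S' \<le> k"
    and k: "k \<ge> 2" and c: "c \<noteq> 0" and S0: "poly S 0 \<noteq> 0"
    and X: "\<And>s. s \<in> X \<Longrightarrow> s \<noteq> 0 \<and> poly (contact_poly (monom c (k - 1)) S T' S') s = 0"
  shows "card X \<le> 2 * k"
proof -
  \<comment> \<open>The quotient by \<open>s^(k-2)\<close>. Its value at 0 is
    \<open>- c (k-1) S(0)^2\<close>, which is nonzero because \<open>k\<close> is at least
    2.\<close>
  define N where "N = smult c (monom c k * S' - monom 1 1 * S * T' + monom 1 1 * S * pderiv S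
                               - smult (of_nat (k - 1)) (S\<^sup>2))"
  have eq: "contact_poly (monom c (k - 1)) S T' S' = monom 1 (k - 2) * N"
  proof (rule poly_ext)
    fix s
    obtain j where j: "k = Suc (Suc j)" using k by (metis add_2_eq_Suc le_Suc_ex)
    show "poly (contact_poly (monom c (k - 1)) S T' S') s = poly (monom 1 (k - 2) * N) s"
      unfolding contact_poly_def N_def j
      by (simp add: poly_monom pderiv_monom power2_eq_square algebra_simps power_add)
  qed
  have "poly N 0 \<noteq> 0"
    using S0 c k by (simp add: N_def poly_monom zero_power of_nat_diff)
  then have "N \<noteq> 0" by auto
  moreover have "degree N \<le> 2 * k"
  proof -
    have dS: "degree (pderiv S) \<le> k - 1"
      using deg by (simp add: degree_pderiv)
    have d1: "degree (monom (1::complex) 1) \<le> 1" "degree (monom c k) \<le> k"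
      by (auto intro: degree_monom_le)
    have "degree (monom c k * S') \<le> 2 * k"
      using degree_mult_le[of "monom c k" S'] deg d1 by linarith
    moreover have "degree (monom 1 1 * S * T') \<le> 2 * k"
      using degree_mult_le[of "monom 1 1 * S" T'] degree_mult_le[of "monom 1 1" S] deg d1 k by linarith
    moreover have "degree (monom 1 1 * S * pderiv S) \<le> 2 * k"
      using degree_mult_le[of "monom 1 1 * S" "pderiv S"] degree_mult_le[of "monom 1 1" S] deg d1 k dS
      by linarith
    moreover have "degree (smult (of_nat (k - 1)) (S\<^sup>2)) \<le> 2 * k"
      using degree_smult_le[of "of_nat (k - 1)" "S\<^sup>2"] degree_power_le[of S 2] deg by linarith
    ultimately have "degree (monom c k * S' - monom 1 1 * S * T' + monom 1 1 * S * pderiv S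
                               - smult (of_nat (k - 1)) (S\<^sup>2)) \<le> 2 * k"
      by (intro degree_diff_le degree_add_le)
    then show ?thesis
      unfolding N_def using degree_smult_le le_trans by blast
  qed
  moreover have "card X \<le> card {s. poly N s = 0}"
  proof (intro card_mono poly_roots_finite \<open>N \<noteq> 0\<close> subsetI CollectI)
    fix s assume "s \<in> X"
    with X[of s] have "s \<noteq> 0" "poly (monom 1 (k - 2) * N) s = 0" unfolding eq by auto
    then show "poly N s = 0" by (simp add: poly_monom)
  qed
  ultimately show ?thesis
    using card_poly_roots_bound[of N] by linarith
qed

section \<open>Binary forms\<close>

text \<open>Forms are functions of two complex variables. The splitting \<open>u f + v g\<close> is
  not unique, but it supports induction on the degree.\<close>

primrec binary_forms :: "nat \<Rightarrow> (complex \<Rightarrow> complex \<Rightarrow> complex) set" where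
  "binary_forms 0 = range (\<lambda>c u v. c)"
| "binary_forms (Suc n) = {\<lambda>u v. u * f u v + v * g u v | f g. f \<in> binary_forms n \<and> g \<in> binary_forms n}"

lemma binary_forms_SucI:
  assumes "f \<in> binary_forms n" "g \<in> binary_forms n" "\<And>u v. h u v = u * f u v + v * g u v"
  shows "h \<in> binary_forms (Suc n)"
proof -
  have "h = (\<lambda>u v. u * f u v + v * g u v)" using assms(3) by auto
  then show ?thesis using assms(1,2) by auto
qed

lemma binary_forms_SucE:
  assumes "h \<in> binary_forms (Suc n)"
  obtains f g where "f \<in> binary_forms n" "g \<in> binary_forms n" "\<And>u v. h u v = u * f u v + v * g u v"
  using assms by auto

lemma binary_forms_scale: "f \<in> binary_forms n \<Longrightarrow> (\<lambda>u v. c * f u v) \<in> binary_forms n"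
proof (induction n arbitrary: f)
  case (Suc n)
  obtain g h where "g \<in> binary_forms n" "h \<in> binary_forms n" "\<And>u v. f u v = u * g u v + v * h u v"
    by (rule binary_forms_SucE[OF Suc.prems]) (rule that)
  then show ?case
    by (intro binary_forms_SucI[OF Suc.IH Suc.IH]) (auto simp: algebra_simps)
qed auto

lemma binary_forms_add:
  "f \<in> binary_forms n \<Longrightarrow> g \<in> binary_forms n \<Longrightarrow> (\<lambda>u v. f u v + g u v) \<in> binary_forms n"
proof (induction n arbitrary: f g)
  case (Suc n)
  obtain f1 f2 where f: "f1 \<in> binary_forms n" "f2 \<in> binary_forms n" "\<And>u v. f u v = u * f1 u v + v * f2 u v"
    by (rule binary_forms_SucE[OF Suc.prems(1)]) (rule that)
  obtain g1 g2 where g: "g1 \<in> binary_forms n" "g2 \<in> binary_forms n" "\<And>u v. g u v = u * g1 u v + v * g2 u v"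
    by (rule binary_forms_SucE[OF Suc.prems(2)]) (rule that)
  show ?case
    by (rule binary_forms_SucI[OF Suc.IH[OF f(1) g(1)] Suc.IH[OF f(2) g(2)]])
       (auto simp: f g algebra_simps)
qed auto

lemma binary_forms_zero: "(\<lambda>u v. 0) \<in> binary_forms n"
proof (induction n)
  case (Suc n)
  then show ?case by (intro binary_forms_SucI[OF Suc Suc]) auto
qed auto

lemma binary_forms_sum:
  "(\<And>i. i \<in> A \<Longrightarrow> f i \<in> binary_forms n) \<Longrightarrow> (\<lambda>u v. \<Sum>i\<in>A. f i u v) \<in> binary_forms n"
  by (induction A rule: infinite_finite_induct) (auto intro: binary_forms_zero binary_forms_add)

lemma binary_forms_linear_mult:
  assumes "f \<in> binary_forms n"
  shows "(\<lambda>u v. (c1 * u + c2 * v) * f u v) \<in> binary_forms (Suc n)"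
  by (rule binary_forms_SucI[OF binary_forms_scale[OF assms, of c1] binary_forms_scale[OF assms, of c2]])
     (auto simp: algebra_simps)

lemma binary_forms_linear_power: "(\<lambda>u v. (c1 * u + c2 * v) ^ n) \<in> binary_forms n"
proof (induction n)
  case (Suc n)
  then show ?case using binary_forms_linear_mult[OF Suc, of c1 c2] by simp
qed auto

lemma binary_forms_monomial:
  assumes "i \<le> n" shows "(\<lambda>u v. u ^ i * v ^ (n - i)) \<in> binary_forms n"
  using assms
proof (induction n arbitrary: i)
  case (Suc n)
  show ?case
  proof (cases "i = Suc n")
    case True
    then show ?thesis using binary_forms_linear_power[of 1 0 "Suc n"] by simp
  next
    case False
    then have "i \<le> n" using Suc.prems by simp
    then show ?thesis
      using binary_forms_linear_mult[OF Suc.IH[of i], of 0 1]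
      by (simp add: Suc_diff_le mult_ac)
  qed
qed auto

lemma binary_forms_coeffs:
  "f \<in> binary_forms n \<Longrightarrow> \<exists>c. \<forall>u v. f u v = (\<Sum>i\<le>n. c i * u ^ i * v ^ (n - i))"
proof (induction n arbitrary: f)
  case (Suc n)
  obtain f1 f2 where f: "f1 \<in> binary_forms n" "f2 \<in> binary_forms n" "\<And>u v. f u v = u * f1 u v + v * f2 u v"
    by (rule binary_forms_SucE[OF Suc.prems]) (rule that)
  obtain c1 c2 where c: "\<And>u v. f1 u v = (\<Sum>i\<le>n. c1 i * u ^ i * v ^ (n - i))"
    "\<And>u v. f2 u v = (\<Sum>i\<le>n. c2 i * u ^ i * v ^ (n - i))"
    using Suc.IH[OF f(1)] Suc.IH[OF f(2)] by metis
  let ?c = "\<lambda>i. (case i of 0 \<Rightarrow> 0 | Suc j \<Rightarrow> c1 j) + (if i \<le> n then c2 i else 0)"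
  have "f u v = (\<Sum>i\<le>Suc n. ?c i * u ^ i * v ^ (Suc n - i))" for u v
  proof -
    have "u * f1 u v = (\<Sum>i\<le>Suc n. (case i of 0 \<Rightarrow> 0 | Suc j \<Rightarrow> c1 j) * u ^ i * v ^ (Suc n - i))"
      unfolding c sum.atMost_Suc_shift by (simp add: sum_distrib_left mult_ac)
    moreover have "v * f2 u v = (\<Sum>i\<le>Suc n. (if i \<le> n then c2 i else 0) * u ^ i * v ^ (Suc n - i))"
      unfolding c by (auto simp: sum_distrib_left mult_ac Suc_diff_le intro!: sum.cong)
    ultimately show ?thesis
      unfolding f(3) by (simp only: sum.distrib[symmetric] distrib_right)
  qed
  then show ?case by (intro exI[of _ ?c]) blast
qed auto

lemma binary_forms_of_coeffs: "(\<lambda>u v. \<Sum>i\<le>n. c i * u ^ i * v ^ (n - i)) \<in> binary_forms n"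
  unfolding mult.assoc
  by (intro binary_forms_sum binary_forms_scale binary_forms_monomial) simp

lemma binary_forms_homogeneous:
  "f \<in> binary_forms n \<Longrightarrow> f (t * u) (t * v) = t ^ n * f u v"
proof (induction n arbitrary: f)
  case (Suc n)
  obtain f1 f2 where f: "f1 \<in> binary_forms n" "f2 \<in> binary_forms n" "\<And>u v. f u v = u * f1 u v + v * f2 u v"
    by (rule binary_forms_SucE[OF Suc.prems]) (rule that)
  show ?case by (simp add: f Suc.IH algebra_simps)
qed auto

text \<open>The coefficient at \<open>n\<close> is the value at the direction of the line, its point
  at infinity. Moving along a zero of \<open>f\<close> therefore lowers the degree of the
  restriction.\<close>

lemma binary_forms_on_line:
  assumes "f \<in> binary_forms n"
  obtains p where "degree p \<le> n" "coeff p n = f a1 a2"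
    "\<And>s. poly p s = f (s * a1 + b1) (s * a2 + b2)"
proof -
  have "\<exists>p. degree p \<le> n \<and> coeff p n = f a1 a2 \<and> (\<forall>s. poly p s = f (s * a1 + b1) (s * a2 + b2))"
    using assms
  proof (induction n arbitrary: f)
    case 0
    then obtain c where "f = (\<lambda>u v. c)" by auto
    then show ?case by (intro exI[of _ "[:c:]"]) auto
  next
    case (Suc n)
    obtain f1 f2 where f: "f1 \<in> binary_forms n" "f2 \<in> binary_forms n" "\<And>u v. f u v = u * f1 u v + v * f2 u v"
      by (rule binary_forms_SucE[OF Suc.prems]) (rule that)
    obtain p1 p2 where p: "degree p1 \<le> n" "coeff p1 n = f1 a1 a2"
        "\<forall>s. poly p1 s = f1 (s * a1 + b1) (s * a2 + b2)"
       "degree p2 \<le> n" "coeff p2 n = f2 a1 a2" "\<forall>s. poly p2 s = f2 (s * a1 + b1) (s * a2 + b2)"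
      using Suc.IH[OF f(1)] Suc.IH[OF f(2)] by metis
    let ?p = "[:b1, a1:] * p1 + [:b2, a2:] * p2"
    have "degree ([:b1, a1:] * p1) \<le> Suc n" "degree ([:b2, a2:] * p2) \<le> Suc n"
      using p(1,4) by (auto intro!: degree_add_le degree_smult_le order_trans[OF degree_smult_le] degree_pCons_le order_trans[OF degree_pCons_le] simp: mult_pCons_left)
    then have "degree ?p \<le> Suc n" by (rule degree_add_le)
    moreover have "coeff ?p (Suc n) = f a1 a2"
      using p by (simp add: f coeff_eq_0)
    moreover have "\<forall>s. poly ?p s = f (s * a1 + b1) (s * a2 + b2)"
      using p by (simp add: f algebra_simps)
    ultimately show ?case by blast
  qed
  with that show thesis by blast
qed

lemma linear_form_eq_multiple:
  fixes a1 a2 :: complex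
  assumes "a1 \<noteq> 0 \<or> a2 \<noteq> 0" "c1 * a1 + c2 * a2 = 0"
  obtains e where "\<And>u v. c1 * u + c2 * v = e * (a2 * u - a1 * v)"
proof (cases "a2 = 0")
  case True
  with assms have "a1 \<noteq> 0" "c1 = 0" by auto
  then show ?thesis using True by (intro that[of "- c2 / a1"]) (auto simp: field_simps)
next
  case False
  then have "c2 = - (c1 * a1 / a2)" using assms by (simp add: field_simps add_eq_0_iff)
  then show ?thesis using False by (intro that[of "c1 / a2"]) (auto simp: field_simps)
qed

text \<open>Division by the linear form vanishing at \<open>(a1, a2)\<close>. The remainder is a
  multiple of a power of a linear form with value 1 there, so that the multiple is
  \<open>f a1 a2\<close>.\<close>

lemma binary_forms_remainder:
  assumes a: "l1 * a1 + l2 * a2 = 1" and f: "f \<in> binary_forms (Suc n)"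
  shows "\<exists>g\<in>binary_forms n. \<forall>u v. f u v = f a1 a2 * (l1 * u + l2 * v) ^ Suc n + (a2 * u - a1 * v) * g u v"
  using f
proof (induction n arbitrary: f)
  have a0: "a1 \<noteq> 0 \<or> a2 \<noteq> 0" using a by auto
  \<comment> \<open>Degree one: subtracting the right multiple of \<open>l1 * u + l2 * v\<close>
    leaves a linear form that vanishes at \<open>(a1, a2)\<close>.\<close>
  have lin: "\<exists>e. \<forall>u v. c1 * u + c2 * v = (c1 * a1 + c2 * a2) * (l1 * u + l2 * v) + e * (a2 * u - a1 * v)" for c1 c2
  proof -
    let ?m = "c1 * a1 + c2 * a2"
    have "(c1 - ?m * l1) * a1 + (c2 - ?m * l2) * a2 = ?m - ?m * (l1 * a1 + l2 * a2)"
      by (simp add: algebra_simps)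
    also have "\<dots> = 0" unfolding a by simp
    finally obtain e where "\<And>u v. (c1 - ?m * l1) * u + (c2 - ?m * l2) * v = e * (a2 * u - a1 * v)"
      using linear_form_eq_multiple[OF a0] by blast
    then show ?thesis by (intro exI[of _ e]) (auto simp: algebra_simps)
  qed
  {
    case 0
    obtain f1 f2 where f: "f1 \<in> binary_forms 0" "f2 \<in> binary_forms 0" "\<And>u v. f u v = u * f1 u v + v * f2 u v"
      by (rule binary_forms_SucE[OF 0]) (rule that)
    then obtain c1 c2 where "f1 = (\<lambda>u v. c1)" "f2 = (\<lambda>u v. c2)" by auto
    with f have f': "\<And>u v. f u v = c1 * u + c2 * v" by simp
    obtain e where e: "\<And>u v. c1 * u + c2 * v = (c1 * a1 + c2 * a2) * (l1 * u + l2 * v) + e * (a2 * u - a1 * v)"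
      using lin[of c1 c2] by blast
    have *: "f u v = f a1 a2 * (l1 * u + l2 * v) ^ Suc 0 + (a2 * u - a1 * v) * e" for u v
      using e[of u v] unfolding f' by (simp add: mult_ac)
    show ?case by (intro bexI[of _ "\<lambda>u v. e"] allI *) simp
  next
    case (Suc n)
    obtain f1 f2 where f: "f1 \<in> binary_forms (Suc n)" "f2 \<in> binary_forms (Suc n)"
      "\<And>u v. f u v = u * f1 u v + v * f2 u v"
      by (rule binary_forms_SucE[OF Suc.prems]) (rule that)
    obtain g1 where g1: "g1 \<in> binary_forms n"
      "\<forall>u v. f1 u v = f1 a1 a2 * (l1 * u + l2 * v) ^ Suc n + (a2 * u - a1 * v) * g1 u v"
      by (rule bexE[OF Suc.IH[OF f(1)]]) (rule that)
    obtain g2 where g2: "g2 \<in> binary_forms n"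
      "\<forall>u v. f2 u v = f2 a1 a2 * (l1 * u + l2 * v) ^ Suc n + (a2 * u - a1 * v) * g2 u v"
      by (rule bexE[OF Suc.IH[OF f(2)]]) (rule that)
    obtain e where e: "\<And>u v. f1 a1 a2 * u + f2 a1 a2 * v
        = (f1 a1 a2 * a1 + f2 a1 a2 * a2) * (l1 * u + l2 * v) + e * (a2 * u - a1 * v)"
      using lin[of "f1 a1 a2" "f2 a1 a2"] by blast
    let ?g = "\<lambda>u v. e * (l1 * u + l2 * v) ^ Suc n + (u * g1 u v + v * g2 u v)"
    have g: "?g \<in> binary_forms (Suc n)"
      by (intro binary_forms_add binary_forms_scale binary_forms_linear_power binary_forms_SucI[OF g1(1) g2(1)]) auto
    have eq: "f u v = f a1 a2 * (l1 * u + l2 * v) ^ Suc (Suc n) + (a2 * u - a1 * v) * ?g u v" for u v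
    proof -
      let ?P = "(l1 * u + l2 * v) ^ Suc n"
      \<comment> \<open>The remainders of \<open>f1\<close> and \<open>f2\<close> combine to a
        linear form times the power; \<open>lin\<close> then divides this linear form.\<close>
      have "f u v = (f1 a1 a2 * u + f2 a1 a2 * v) * ?P + (a2 * u - a1 * v) * (u * g1 u v + v * g2 u v)"
        by (subst f(3), subst g1(2)[rule_format], subst g2(2)[rule_format]) (simp only: algebra_simps)
      also have "\<dots> = f a1 a2 * ((l1 * u + l2 * v) * ?P) + (a2 * u - a1 * v) * ?g u v"
        unfolding e[of u v] f(3)[of a1 a2] by (simp only: algebra_simps)
      finally show ?thesis by simp
    qed
    show ?case by (intro bexI[of _ ?g] allI eq g)
  }
qed

lemma ex_linear_form_eq_1:
  fixes a1 a2 :: complex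
  assumes "a1 \<noteq> 0 \<or> a2 \<noteq> 0"
  obtains l1 l2 where "l1 * a1 + l2 * a2 = 1"
proof (cases "a1 = 0")
  case True then show ?thesis using assms by (intro that[of 0 "1 / a2"]) auto
next
  case False then show ?thesis by (intro that[of "1 / a1" 0]) auto
qed

lemma binary_forms_divide:
  assumes "a1 \<noteq> 0 \<or> a2 \<noteq> 0" "f \<in> binary_forms (Suc n)" "f a1 a2 = 0"
  obtains g where "g \<in> binary_forms n" "\<And>u v. f u v = (a2 * u - a1 * v) * g u v"
proof -
  obtain l1 l2 where "l1 * a1 + l2 * a2 = 1"
    using ex_linear_form_eq_1[OF assms(1)] .
  then obtain g where "g \<in> binary_forms n"
    "\<forall>u v. f u v = f a1 a2 * (l1 * u + l2 * v) ^ Suc n + (a2 * u - a1 * v) * g u v"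
    by (rule bexE[OF binary_forms_remainder[OF _ assms(2)]]) (rule that)
  then show thesis unfolding assms(3) by (intro that[of g]) simp_all
qed

text \<open>If \<open>(1, 0)\<close> is no zero, the restriction to \<open>v = 1\<close> has leading
  coefficient \<open>f 1 0\<close> in positive degree, hence a root.\<close>

lemma binary_forms_has_zero:
  assumes "f \<in> binary_forms (Suc n)"
  obtains a1 a2 where "a1 \<noteq> 0 \<or> a2 \<noteq> 0" "f a1 a2 = 0"
proof (cases "f 1 0 = 0")
  case True
  then show ?thesis by (intro that[of 1 0]) auto
next
  case False
  obtain p where p: "degree p \<le> Suc n" "coeff p (Suc n) = f 1 0" "\<And>s. poly p s = f (s * 1 + 0) (s * 0 + 1)"
    by (rule binary_forms_on_line[OF assms, where ?a1.0 = 1 and ?a2.0 = 0 and ?b1.0 = 0 and ?b2.0 = 1]) (rule that)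
  have "coeff p (Suc n) \<noteq> 0" using False unfolding p(2) .
  then have "Suc n \<le> degree p" by (rule le_degree)
  then have "\<not> constant (poly p)" unfolding constant_degree by linarith
  then obtain s where "poly p s = 0" by (rule fundamental_theorem_of_algebra[THEN exE])
  then show ?thesis using p(3)[of s] that[of s 1] by simp
qed


section \<open>Kernels of nearby matrices\<close>

text \<open>Compactness of the unit sphere for the norm \<open>\<Sum>i<N. norm (x i)\<close>; the
  limit has norm 1 and so is not zero.\<close>

lemma normalized_limit:
  fixes x :: "nat \<Rightarrow> nat \<Rightarrow> complex"
  assumes "\<And>n. \<exists>j<N. x n j \<noteq> 0"
  obtains r l where "strict_mono r" "\<And>j. j < N \<Longrightarrow> (\<lambda>n. x (r n) j / complex_of_real (\<Sum>i<N. norm (x (r n) i))) \<longlonglongrightarrow> l j"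
    "(\<Sum>j<N. norm (l j)) = 1"
proof -
  define \<mu> where "\<mu> n = (\<Sum>i<N. norm (x n i))" for n
  define y where "y n j = x n j / \<mu> n" for n j
  have pos: "\<mu> n > 0" for n
  proof -
    obtain j where "j < N" "x n j \<noteq> 0" using assms by blast
    then show ?thesis unfolding \<mu>_def by (intro sum_pos2[of _ j]) auto
  qed
  have le: "norm (y n j) \<le> 1" if "j \<in> {..<N}" for n j
  proof -
    have "norm (x n j) \<le> \<mu> n"
      unfolding \<mu>_def using that by (intro member_le_sum) auto
    then show ?thesis using pos[of n] by (simp add: y_def norm_divide)
  qed
  obtain r where r: "strict_mono r" "\<And>j. j \<in> {..<N} \<Longrightarrow> \<exists>l. (\<lambda>n. y (r n) j) \<longlonglongrightarrow> l"
    using function_convergent_subsequence[of "{..<N}" y 1] le by (metis countable_finite finite_lessThan)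
  then obtain l where l: "\<And>j. j < N \<Longrightarrow> (\<lambda>n. y (r n) j) \<longlonglongrightarrow> l j"
    by (metis lessThan_iff)
  have one: "(\<Sum>j<N. norm (y n j)) = 1" for n
  proof -
    have "(\<Sum>j<N. norm (y n j)) = (\<Sum>j<N. norm (x n j) / \<mu> n)"
      using pos[of n] by (simp add: y_def norm_divide)
    also have "\<dots> = 1"
      using pos[of n] by (simp add: \<mu>_def flip: sum_divide_distrib)
    finally show ?thesis .
  qed
  have "(\<lambda>n. \<Sum>j<N. norm (y (r n) j)) \<longlonglongrightarrow> (\<Sum>j<N. norm (l j))"
    by (intro tendsto_sum tendsto_norm l) auto
  then have "(\<Sum>j<N. norm (l j)) = 1"
    unfolding one using LIMSEQ_unique tendsto_const by blast
  with r l show thesis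
    by (intro that) (auto simp: y_def \<mu>_def)
qed

text \<open>Normalised kernel vectors accumulate at a nonzero vector, which lies in the kernel of
  the limit matrix by continuity.\<close>

lemma kernel_limit:
  fixes m :: "nat \<Rightarrow> 'p \<Rightarrow> nat \<Rightarrow> complex"
  assumes lim: "\<And>p j. p \<in> P \<Longrightarrow> j < N \<Longrightarrow> (\<lambda>n. m n p j) \<longlonglongrightarrow> m0 p j"
    and ker: "\<And>n. \<exists>c. (\<exists>j<N. c j \<noteq> 0) \<and> (\<forall>p\<in>P. (\<Sum>j<N. c j * m n p j) = 0)"
  shows "\<exists>c. (\<exists>j<N. c j \<noteq> 0) \<and> (\<forall>p\<in>P. (\<Sum>j<N. c j * m0 p j) = 0)"
proof -
  obtain c where nz: "\<And>n. \<exists>j<N. c n j \<noteq> 0" and c: "\<And>n p. p \<in> P \<Longrightarrow> (\<Sum>j<N. c n j * m n p j) = 0"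
    using ker by metis
  obtain r l where r: "strict_mono r"
    and l: "\<And>j. j < N \<Longrightarrow> (\<lambda>n. c (r n) j / complex_of_real (\<Sum>i<N. norm (c (r n) i))) \<longlonglongrightarrow> l j"
    and l1: "(\<Sum>j<N. norm (l j)) = 1"
    by (rule normalized_limit[OF nz]) (rule that)
  define \<mu> where "\<mu> n = complex_of_real (\<Sum>i<N. norm (c (r n) i))" for n
  have l: "(\<lambda>n. c (r n) j / \<mu> n) \<longlonglongrightarrow> l j" if "j < N" for j
    using l[OF that] by (simp only: \<mu>_def)
  have "(\<Sum>j<N. l j * m0 p j) = 0" if p: "p \<in> P" for p
  proof -
    have "(\<lambda>n. \<Sum>j<N. c (r n) j / \<mu> n * m (r n) p j) \<longlonglongrightarrow> (\<Sum>j<N. l j * m0 p j)"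
      using LIMSEQ_subseq_LIMSEQ[OF lim[OF p] r] l
      by (intro tendsto_sum tendsto_mult) (auto simp: o_def)
    moreover have "(\<Sum>j<N. c (r n) j / \<mu> n * m (r n) p j) = 0" for n
    proof -
      have "(\<Sum>j<N. c (r n) j / \<mu> n * m (r n) p j) = (\<Sum>j<N. c (r n) j * m (r n) p j) / \<mu> n"
        by (simp add: sum_divide_distrib)
      then show ?thesis unfolding c[OF p] by simp
    qed
    ultimately show ?thesis
      by (simp add: LIMSEQ_const_iff)
  qed
  moreover have "\<exists>j<N. l j \<noteq> 0"
  proof (rule ccontr)
    assume "\<not> (\<exists>j<N. l j \<noteq> 0)"
    then have "(\<Sum>j<N. norm (l j)) = 0" by simp
    with l1 show False by simp
  qed
  ultimately show ?thesis by blast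
qed

text \<open>
  A one-dimensional kernel that persists along a curve of matrices can be followed to first order:
  the part of a nearby kernel vector transversal to \<open>v\<close> is \<open>O(t)\<close>, as otherwise it would
  normalise to a second kernel vector of the limit matrix.
\<close>

lemma kernel_first_order:
  fixes m :: "nat \<Rightarrow> 'p \<Rightarrow> nat \<Rightarrow> complex"
  assumes lim: "\<And>p j. p \<in> P \<Longrightarrow> j < N \<Longrightarrow> (\<lambda>n. m n p j) \<longlonglongrightarrow> m0 p j"
    and ker: "\<And>n. \<exists>c. (\<exists>j<N. c j \<noteq> 0) \<and> (\<forall>p\<in>P. (\<Sum>j<N. c j * m n p j) = 0)"
    and t: "\<And>n. t n \<noteq> 0"
    and v: "j0 < N" "v j0 \<noteq> 0"
    and unique: "\<And>c. (\<And>p. p \<in> P \<Longrightarrow> (\<Sum>j<N. c j * m0 p j) = 0) \<Longrightarrow> \<exists>e. \<forall>j<N. c j = e * v j"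
    and deriv: "\<And>p. p \<in> P \<Longrightarrow> (\<lambda>n. (\<Sum>j<N. v j * m n p j) / t n) \<longlonglongrightarrow> \<delta> p"
  shows "\<exists>w. \<forall>p\<in>P. (\<Sum>j<N. w j * m0 p j) + \<delta> p = 0"
proof -
  obtain c where nz: "\<And>n. \<exists>j<N. c n j \<noteq> 0" and c: "\<And>n p. p \<in> P \<Longrightarrow> (\<Sum>j<N. c n j * m n p j) = 0"
    using ker by metis
  define a where "a n = c n j0 / v j0" for n
  \<comment> \<open>\<open>a n\<close> is chosen so that \<open>c n - a n * v\<close> vanishes at
    \<open>j0\<close>. The extra coordinate \<open>a n * t n\<close> is normalised with it; its
    coefficient in the row relation is the difference quotient that tends to
    \<open>\<delta> p\<close>.\<close>
  define x where "x n j = (if j < N then c n j - a n * v j else a n * t n)" for n j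
  have x0: "x n j0 = 0" for n using v by (simp add: x_def a_def)
  have x_nz: "\<exists>j<Suc N. x n j \<noteq> 0" for n
  proof (rule ccontr)
    assume "\<not> (\<exists>j<Suc N. x n j \<noteq> 0)"
    then have 0: "x n j = 0" if "j < Suc N" for j using that by blast
    have "a n = 0" using 0[of N] t[of n] by (simp add: x_def)
    then have "c n j = 0" if "j < N" for j using 0[of j] that by (simp add: x_def)
    with nz[of n] show False by blast
  qed
  obtain r l where r: "strict_mono r"
    and l: "\<And>j. j < Suc N \<Longrightarrow> (\<lambda>n. x (r n) j / complex_of_real (\<Sum>i<Suc N. norm (x (r n) i))) \<longlonglongrightarrow> l j"
    and l1: "(\<Sum>j<Suc N. norm (l j)) = 1"
    by (rule normalized_limit[OF x_nz]) (rule that)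
  define \<mu> where "\<mu> n = complex_of_real (\<Sum>i<Suc N. norm (x (r n) i))" for n
  have l: "(\<lambda>n. x (r n) j / \<mu> n) \<longlonglongrightarrow> l j" if "j < Suc N" for j
    using l[OF that] by (simp only: \<mu>_def)
  have lim0: "(\<Sum>j<N. l j * m0 p j) + l N * \<delta> p = 0" if p: "p \<in> P" for p
  proof -
    have "(\<lambda>n. (\<Sum>j<N. x (r n) j / \<mu> n * m (r n) p j)
              + x (r n) N / \<mu> n * ((\<Sum>j<N. v j * m (r n) p j) / t (r n)))
            \<longlonglongrightarrow> (\<Sum>j<N. l j * m0 p j) + l N * \<delta> p"
      using LIMSEQ_subseq_LIMSEQ[OF lim[OF p] r] l LIMSEQ_subseq_LIMSEQ[OF deriv[OF p] r]
      by (intro tendsto_add tendsto_sum tendsto_mult) (auto simp: o_def)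
    moreover have "(\<Sum>j<N. x (r n) j / \<mu> n * m (r n) p j)
              + x (r n) N / \<mu> n * ((\<Sum>j<N. v j * m (r n) p j) / t (r n)) = 0" for n
    proof -
      have "(\<Sum>j<N. x (r n) j * m (r n) p j)
          = (\<Sum>j<N. c (r n) j * m (r n) p j) - a (r n) * (\<Sum>j<N. v j * m (r n) p j)"
        by (simp add: x_def algebra_simps sum_subtractf sum_distrib_left)
      then have e1: "(\<Sum>j<N. x (r n) j * m (r n) p j) = - a (r n) * (\<Sum>j<N. v j * m (r n) p j)"
        unfolding c[OF p] by simp
      have e2: "(\<Sum>j<N. x (r n) j / \<mu> n * m (r n) p j) = (\<Sum>j<N. x (r n) j * m (r n) p j) / \<mu> n"
        by (simp add: sum_divide_distrib)
      have e3: "x (r n) N / \<mu> n * (\<Sigma> / t (r n)) = a (r n) * \<Sigma> / \<mu> n" for \<Sigma>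
        using t[of "r n"] by (simp add: x_def)
      show ?thesis unfolding e2 e1 e3 by simp
    qed
    ultimately show ?thesis
      by (simp add: LIMSEQ_const_iff)
  qed
  \<comment> \<open>Otherwise \<open>l\<close> is in the kernel of \<open>m0\<close>, hence a
    multiple of \<open>v\<close>; its coordinate at \<open>j0\<close> is zero, so it is zero,
    against norm 1.\<close>
  have "l N \<noteq> 0"
  proof
    assume lN: "l N = 0"
    then obtain e where e: "\<And>j. j < N \<Longrightarrow> l j = e * v j"
      using unique[of l] lim0 by auto
    have "l j0 = 0"
      using l[of j0] v(1) unfolding x0 by (simp add: LIMSEQ_const_iff)
    then have "e = 0" using e v by auto
    then have "(\<Sum>j<Suc N. norm (l j)) = 0" using e lN by simp
    with l1 show False by simp
  qed
  have "(\<Sum>j<N. l j / l N * m0 p j) + \<delta> p = 0" if "p \<in> P" for p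
  proof -
    have "(\<Sum>j<N. l j / l N * m0 p j) + \<delta> p = ((\<Sum>j<N. l j * m0 p j) + l N * \<delta> p) / l N"
      using \<open>l N \<noteq> 0\<close> by (simp add: sum_divide_distrib add_divide_distrib)
    then show ?thesis unfolding lim0[OF that] by simp
  qed
  then show ?thesis by (intro exI[of _ "\<lambda>j. l j / l N"] ballI)
qed

section \<open>Curves with a vertex\<close>

lemma sum_lessThan_add:
  fixes f :: "nat \<Rightarrow> 'a::comm_monoid_add"
  shows "(\<Sum>j<m + n. f j) = (\<Sum>j<m. f j) + (\<Sum>j<n. f (m + j))"
  by (induction n) (simp_all add: add.assoc)

text \<open>
  The vertex is \<open>(fst q : snd q : 1)\<close>, and \<open>proj_u q\<close>, \<open>proj_v q\<close> are linear coordinates vanishing there.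
  A curve of degree \<open>k\<close> with a point of multiplicity \<open>k - 1\<close> at the vertex has an equation
  \<open>z T(u,v) + S(u,v)\<close> with \<open>T\<close>, \<open>S\<close> homogeneous of degrees \<open>k - 1\<close> and \<open>k\<close>.
\<close>

definition proj_u :: "complex \<times> complex \<Rightarrow> complex ^ 3 \<Rightarrow> complex" where
  "proj_u q p = p $ 1 - fst q * p $ 3"

definition proj_v :: "complex \<times> complex \<Rightarrow> complex ^ 3 \<Rightarrow> complex" where
  "proj_v q p = p $ 2 - snd q * p $ 3"

text \<open>Forms of degree \<open>n - 1\<close>, where degree -1 admits only zero; natural
  subtraction would allow constants for \<open>n = 0\<close>.\<close>

primrec binary_forms_pred :: "nat \<Rightarrow> (complex \<Rightarrow> complex \<Rightarrow> complex) set" where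
  "binary_forms_pred 0 = {\<lambda>u v. 0}"
| "binary_forms_pred (Suc n) = binary_forms n"

definition cone_value :: "(complex \<Rightarrow> complex \<Rightarrow> complex) \<Rightarrow> (complex \<Rightarrow> complex \<Rightarrow> complex) \<Rightarrow>
    complex \<times> complex \<Rightarrow> complex ^ 3 \<Rightarrow> complex" where
  "cone_value T S q p = p $ 3 * T (proj_u q p) (proj_v q p) + S (proj_u q p) (proj_v q p)"

section \<open>Existence of a cone curve as a kernel condition\<close>

definition has_cone_curve :: "nat \<Rightarrow> (complex ^ 3) set \<Rightarrow> complex \<times> complex \<Rightarrow> bool" where
  "has_cone_curve k P q \<longleftrightarrow> (\<exists>T\<in>binary_forms_pred k. \<exists>S\<in>binary_forms k.
     (\<exists>u v. T u v \<noteq> 0 \<or> S u v \<noteq> 0) \<and> (\<forall>p\<in>P. cone_value T S q p = 0))"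

text \<open>One row of the evaluation matrix at vertex \<open>q\<close>: the first \<open>k\<close>
  entries belong to the monomials of \<open>z T\<close>, the remaining \<open>k + 1\<close> to those
  of \<open>S\<close>.\<close>

definition cone_monom :: "nat \<Rightarrow> complex \<times> complex \<Rightarrow> complex ^ 3 \<Rightarrow> nat \<Rightarrow> complex" where
  "cone_monom k q p j = (if j < k then p $ 3 * (proj_u q p ^ j * proj_v q p ^ (k - 1 - j))
     else proj_u q p ^ (j - k) * proj_v q p ^ (k - (j - k)))"

definition cone_T :: "nat \<Rightarrow> (nat \<Rightarrow> complex) \<Rightarrow> complex \<Rightarrow> complex \<Rightarrow> complex" where
  "cone_T k c u v = (\<Sum>j<k. c j * u ^ j * v ^ (k - 1 - j))"

definition cone_S :: "nat \<Rightarrow> (nat \<Rightarrow> complex) \<Rightarrow> complex \<Rightarrow> complex \<Rightarrow> complex" where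
  "cone_S k c u v = (\<Sum>i\<le>k. c (k + i) * u ^ i * v ^ (k - i))"

lemma cone_value_coeffs:
  "cone_value (cone_T k c) (cone_S k c) q p = (\<Sum>j<k + Suc k. c j * cone_monom k q p j)"
proof -
  have "p $ 3 * cone_T k c (proj_u q p) (proj_v q p) = (\<Sum>j<k. c j * cone_monom k q p j)"
    unfolding cone_T_def cone_monom_def sum_distrib_left by (intro sum.cong) (simp_all add: mult_ac)
  moreover have "cone_S k c (proj_u q p) (proj_v q p) = (\<Sum>j<Suc k. c (k + j) * cone_monom k q p (k + j))"
    unfolding cone_S_def cone_monom_def lessThan_Suc_atMost by (intro sum.cong) (simp_all add: mult_ac)
  ultimately show ?thesis
    unfolding sum_lessThan_add cone_value_def by simp
qed

lemma cone_T_in: "cone_T k c \<in> binary_forms_pred k"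
proof (cases k)
  case 0
  have "cone_T 0 c = (\<lambda>u v. 0)" by (intro ext) (simp add: cone_T_def)
  then show ?thesis by (simp add: 0)
next
  case (Suc n)
  have "cone_T k c = (\<lambda>u v. \<Sum>i\<le>n. c i * u ^ i * v ^ (n - i))"
    by (intro ext) (simp add: cone_T_def Suc lessThan_Suc_atMost)
  then show ?thesis using binary_forms_of_coeffs[of c n] by (simp add: Suc)
qed

lemma cone_S_in: "cone_S k c \<in> binary_forms k"
  unfolding cone_S_def[abs_def] by (rule binary_forms_of_coeffs)

lemma cone_coeffs:
  assumes "T \<in> binary_forms_pred k" "S \<in> binary_forms k"
  obtains c where "T = cone_T k c" "S = cone_S k c"
proof -
  obtain cS where cS: "\<forall>u v. S u v = (\<Sum>i\<le>k. cS i * u ^ i * v ^ (k - i))"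
    using binary_forms_coeffs[OF assms(2)] by blast
  obtain cT where cT: "\<forall>u v. T u v = (\<Sum>j<k. cT j * u ^ j * v ^ (k - 1 - j))"
  proof (cases k)
    case 0
    then show ?thesis using that assms(1) by simp
  next
    case (Suc n)
    then show ?thesis
      using that binary_forms_coeffs[of T n] assms(1) unfolding Suc lessThan_Suc_atMost
      by (metis binary_forms_pred.simps(2) diff_Suc_1)
  qed
  let ?c = "\<lambda>j. if j < k then cT j else cS (j - k)"
  have "T = cone_T k ?c" using cT by (intro ext) (simp add: cone_T_def)
  moreover have "S = cone_S k ?c" using cS by (intro ext) (simp add: cone_S_def)
  ultimately show thesis by (rule that)
qed

lemma coeffs_zero_if_form_zero:
  fixes c :: "nat \<Rightarrow> complex"
  assumes "\<And>u v. (\<Sum>i\<le>n. c i * u ^ i * v ^ (n - i)) = 0" "i \<le> n"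
  shows "c i = 0"
proof -
  have "(\<Sum>i\<le>n. c i * u ^ i) = 0" for u
    using assms(1)[of u 1] by simp
  then show ?thesis
    using polyfun_eq_0[of c n] assms(2) by auto
qed

lemma cone_coeffs_zero:
  assumes T: "\<And>u v. cone_T k c u v = 0" and S: "\<And>u v. cone_S k c u v = 0" and j: "j < k + Suc k"
  shows "c j = 0"
proof (cases "j < k")
  case True
  then obtain n where n: "k = Suc n" using gr0_implies_Suc by (metis not_less_zero neq0_conv)
  show ?thesis
    using T True unfolding cone_T_def n lessThan_Suc_atMost
    by (intro coeffs_zero_if_form_zero[where n = n and c = c]) auto
next
  case False
  then obtain i where i: "j = k + i" "i \<le> k" using j by (metis add_less_cancel_left le_Suc_ex less_Suc_eq_le not_le)
  show ?thesis
    using S unfolding cone_S_def i(1)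
    by (intro coeffs_zero_if_form_zero[where n = k and c = "\<lambda>i. c (k + i)"] i(2))
qed

text \<open>A cone curve through \<open>P\<close> is a nonzero kernel vector of the evaluation
  matrix, because the coefficients of a form are determined by its values.\<close>

lemma has_cone_curve_iff_coeffs:
  "has_cone_curve k P q \<longleftrightarrow>
    (\<exists>c. (\<exists>j<k + Suc k. c j \<noteq> 0) \<and> (\<forall>p\<in>P. (\<Sum>j<k + Suc k. c j * cone_monom k q p j) = 0))"
  (is "_ \<longleftrightarrow> ?R")
proof
  assume "has_cone_curve k P q"
  then obtain T S where TS: "T \<in> binary_forms_pred k" "S \<in> binary_forms k" "\<exists>u v. T u v \<noteq> 0 \<or> S u v \<noteq> 0"
    "\<forall>p\<in>P. cone_value T S q p = 0"
    unfolding has_cone_curve_def by blast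
  obtain c where c: "T = cone_T k c" "S = cone_S k c"
    by (rule cone_coeffs[OF TS(1,2)]) (rule that)
  have "\<exists>j<k + Suc k. c j \<noteq> 0"
  proof (rule ccontr)
    assume "\<not> ?thesis"
    then have "T u v = 0 \<and> S u v = 0" for u v
      by (simp add: c cone_T_def cone_S_def)
    with TS(3) show False by blast
  qed
  then show ?R using TS(4) unfolding c cone_value_coeffs by (intro exI[of _ c] conjI)
next
  assume ?R
  then obtain c where c: "\<exists>j<k + Suc k. c j \<noteq> 0" "\<forall>p\<in>P. cone_value (cone_T k c) (cone_S k c) q p = 0"
    unfolding cone_value_coeffs by blast
  have "\<exists>u v. cone_T k c u v \<noteq> 0 \<or> cone_S k c u v \<noteq> 0"
    using cone_coeffs_zero[of k c] c(1) by metis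
  then show "has_cone_curve k P q"
    unfolding has_cone_curve_def
    by (intro bexI[OF _ cone_T_in[of k c]] bexI[OF _ cone_S_in[of k c]] conjI c(2))
qed

lemma tendsto_cone_monom:
  assumes "x \<longlonglongrightarrow> q"
  shows "(\<lambda>n. cone_monom k (x n) p j) \<longlonglongrightarrow> cone_monom k q p j"
proof -
  have uv: "(\<lambda>n. proj_u (x n) p) \<longlonglongrightarrow> proj_u q p" "(\<lambda>n. proj_v (x n) p) \<longlonglongrightarrow> proj_v q p"
    unfolding proj_u_def proj_v_def
    by (intro tendsto_diff tendsto_mult tendsto_const tendsto_fst tendsto_snd assms)+
  show ?thesis
    unfolding cone_monom_def
    by (cases "j < k") (simp_all add: tendsto_mult tendsto_power uv)
qed

text \<open>Vertices with a curve form a closed set: curves at vertices tending to \<open>q\<close>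
  have normalised equations that accumulate at the equation of a curve at \<open>q\<close>.\<close>

lemma has_cone_curve_closed:
  assumes "\<not> has_cone_curve k P q"
  shows "\<forall>\<^sub>F x in nhds q. \<not> has_cone_curve k P x"
proof (rule ccontr)
  assume "\<not> ?thesis"
  then have "\<forall>n::nat. \<exists>x. dist x q < 1 / real (Suc n) \<and> has_cone_curve k P x"
    unfolding eventually_nhds_metric by (metis of_nat_0_less_iff zero_less_Suc zero_less_divide_1_iff)
  then obtain x where x: "\<And>n. dist (x n) q < 1 / real (Suc n)" "\<And>n. has_cone_curve k P (x n)"
    by metis
  have "(\<lambda>n. dist (x n) q) \<longlonglongrightarrow> 0"
    by (rule tendsto_sandwich[OF _ _ tendsto_const LIMSEQ_Suc[OF lim_1_over_n]])
       (intro always_eventually allI zero_le_dist less_imp_le[OF x(1)])+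
  then have "x \<longlonglongrightarrow> q" by (rule iffD2[OF tendsto_dist_iff])
  from kernel_limit[where m = "\<lambda>n. cone_monom k (x n)", OF tendsto_cone_monom[OF this]]
  have "has_cone_curve k P q"
    using x(2) unfolding has_cone_curve_iff_coeffs by blast
  with assms show False by simp
qed


section \<open>Splitting off lines and moving the vertex\<close>

lemma binary_forms_pred_scale:
  "f \<in> binary_forms_pred n \<Longrightarrow> (\<lambda>u v. c * f u v) \<in> binary_forms_pred n"
  by (cases n) (simp_all add: binary_forms_scale)

lemma binary_forms_pred_diff:
  assumes "f \<in> binary_forms_pred n" "g \<in> binary_forms_pred n"
  shows "(\<lambda>u v. f u v - g u v) \<in> binary_forms_pred n"
proof (cases n)
  case 0
  then show ?thesis using assms by simp
next
  case (Suc k)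
  then show ?thesis
    using assms binary_forms_add[of f k "\<lambda>u v. (-1) * g u v"] binary_forms_scale[of g k "-1"] by simp
qed

lemma binary_forms_diff:
  "f \<in> binary_forms n \<Longrightarrow> g \<in> binary_forms n \<Longrightarrow> (\<lambda>u v. f u v - g u v) \<in> binary_forms n"
  using binary_forms_pred_diff[of f "Suc n" g] by simp

text \<open>A common zero of \<open>T\<close> and \<open>S\<close> means that a line through the vertex splits off.\<close>

lemma cone_split_line:
  assumes T: "T \<in> binary_forms_pred (Suc k)" and S: "S \<in> binary_forms (Suc k)"
    and nz: "\<exists>u v. T u v \<noteq> 0 \<or> S u v \<noteq> 0"
    and van: "\<And>p. p \<in> P \<Longrightarrow> cone_value T S q p = 0"
    and a: "a1 \<noteq> 0 \<or> a2 \<noteq> 0" "T a1 a2 = 0" "S a1 a2 = 0"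
  shows "has_cone_curve k {p \<in> P. a2 * proj_u q p - a1 * proj_v q p \<noteq> 0} q"
proof -
  obtain S' where S': "S' \<in> binary_forms k" "\<And>u v. S u v = (a2 * u - a1 * v) * S' u v"
    by (rule binary_forms_divide[OF a(1) S a(3)]) (rule that)
  obtain T' where T': "T' \<in> binary_forms_pred k" "\<And>u v. T u v = (a2 * u - a1 * v) * T' u v"
  proof (cases k)
    case 0
    then obtain c where c: "T = (\<lambda>u v. c)" using T by auto
    then have "c = 0" using a(2) by simp
    then show ?thesis using 0 c by (intro that[of "\<lambda>u v. 0"]) simp_all
  next
    case (Suc n)
    have T: "T \<in> binary_forms (Suc n)" using T by (simp add: Suc)
    obtain g where "g \<in> binary_forms n" "\<And>u v. T u v = (a2 * u - a1 * v) * g u v"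
      by (rule binary_forms_divide[OF a(1) T a(2)]) (rule that)
    then show ?thesis by (intro that[of g]) (simp_all add: Suc)
  qed
  have "cone_value T S q p = (a2 * proj_u q p - a1 * proj_v q p) * cone_value T' S' q p" for p
    unfolding cone_value_def T'(2) S'(2) by (simp add: algebra_simps)
  then have "cone_value T' S' q p = 0" if "p \<in> {p \<in> P. a2 * proj_u q p - a1 * proj_v q p \<noteq> 0}" for p
    using van[of p] that by auto
  moreover have "\<exists>u v. T' u v \<noteq> 0 \<or> S' u v \<noteq> 0"
    using nz unfolding T'(2) S'(2) by auto
  ultimately show ?thesis
    unfolding has_cone_curve_def using T'(1) S'(1) by blast
qed

text \<open>If no cone equation for \<open>P\<close> has a common zero of its two forms, the
  equation is unique up to a factor, so \<open>kernel_first_order\<close> applies to the vertices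
  \<open>q + t w\<close>. It supplies the variations \<open>T'\<close> and \<open>S'\<close> of the
  coefficients that cancel the effect \<open>\<delta>\<close> of moving the vertex alone.\<close>

lemma cone_first_order:
  assumes T: "T \<in> binary_forms_pred k" and S: "S \<in> binary_forms k"
    and nz: "\<exists>u v. T u v \<noteq> 0 \<or> S u v \<noteq> 0"
    and van: "\<And>p. p \<in> P \<Longrightarrow> cone_value T S q p = 0"
    and near: "\<forall>\<^sub>F x in nhds q. has_cone_curve k P x"
    and p0: "p0 \<in> P" "proj_u q p0 \<noteq> 0 \<or> proj_v q p0 \<noteq> 0"
    and no_common: "\<And>T S a1 a2. T \<in> binary_forms_pred k \<Longrightarrow> S \<in> binary_forms k \<Longrightarrow>
          \<exists>u v. T u v \<noteq> 0 \<or> S u v \<noteq> 0 \<Longrightarrow> (\<And>p. p \<in> P \<Longrightarrow> cone_value T S q p = 0) \<Longrightarrow>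
          a1 \<noteq> 0 \<or> a2 \<noteq> 0 \<Longrightarrow> T a1 a2 = 0 \<Longrightarrow> S a1 a2 \<noteq> 0"
    and deriv: "\<And>p. p \<in> P \<Longrightarrow>
          ((\<lambda>t. cone_value T S (fst q + t * w1, snd q + t * w2) p / t) \<longlongrightarrow> \<delta> p) (at 0)"
  obtains T' S' where "T' \<in> binary_forms_pred k" "S' \<in> binary_forms k"
    "\<And>p. p \<in> P \<Longrightarrow> cone_value T' S' q p + \<delta> p = 0"
proof -
  obtain v where v: "T = cone_T k v" "S = cone_S k v"
    by (rule cone_coeffs[OF T S]) (rule that)
  let ?x = "\<lambda>t::complex. (fst q + t * w1, snd q + t * w2)"
  have "(?x \<longlongrightarrow> ?x 0) (at 0)"
    by (intro tendsto_intros)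
  then have "(?x \<longlongrightarrow> q) (at 0)" by simp
  then have "\<forall>\<^sub>F t in at 0. has_cone_curve k P (?x t)"
    by (rule eventually_compose_filterlim[OF near])
  then obtain e where e: "e > 0" "\<And>t. t \<noteq> 0 \<Longrightarrow> dist t 0 < e \<Longrightarrow> has_cone_curve k P (?x t)"
    unfolding eventually_at by blast
  \<comment> \<open>The denominator starts at 2, which keeps every \<open>t n\<close> strictly
    inside the radius \<open>e\<close>.\<close>
  define t where "t n = complex_of_real (e / real (Suc (Suc n)))" for n
  have t0: "t n \<noteq> 0" for n
  proof -
    have "e / real (Suc (Suc n)) \<noteq> 0" using e(1) by simp
    then show ?thesis unfolding t_def of_real_eq_0_iff .
  qed
  have te: "dist (t n) 0 < e" for n
    using e(1) by (simp add: t_def norm_divide field_simps del: of_nat_Suc)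
  have "(\<lambda>n. e / real (Suc (Suc n))) \<longlonglongrightarrow> 0"
    using LIMSEQ_Suc[OF LIMSEQ_Suc[OF lim_const_over_n[of e]]] .
  then have "t \<longlonglongrightarrow> complex_of_real 0"
    unfolding t_def by (rule tendsto_of_real)
  then have t: "filterlim t (at 0) sequentially"
    unfolding filterlim_at using t0 by simp
  have lim: "(\<lambda>n. ?x (t n)) \<longlonglongrightarrow> q"
    using filterlim_compose[OF \<open>(?x \<longlongrightarrow> q) (at 0)\<close> t] .
  obtain j0 where j0: "j0 < k + Suc k" "v j0 \<noteq> 0"
  proof (rule ccontr)
    assume "\<not> thesis"
    then have "\<And>j. j < k + Suc k \<Longrightarrow> v j = 0" using that by blast
    then have "T u w = 0 \<and> S u w = 0" for u w
      by (simp add: v cone_T_def cone_S_def)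
    with nz show False by blast
  qed
  define a1 a2 where "a1 = proj_u q p0" and "a2 = proj_v q p0"
  have a: "a1 \<noteq> 0 \<or> a2 \<noteq> 0" using p0(2) by (simp add: a1_def a2_def)
  have Ta: "T a1 a2 \<noteq> 0"
  proof
    assume "T a1 a2 = 0"
    moreover from this have "S a1 a2 = 0"
      using van[OF p0(1)] by (simp add: cone_value_def a1_def a2_def)
    ultimately show False using no_common[OF T S nz van a] by blast
  qed
  have unique: "\<exists>e. \<forall>j<k + Suc k. c j = e * v j"
    if c: "\<And>p. p \<in> P \<Longrightarrow> (\<Sum>j<k + Suc k. c j * cone_monom k q p j) = 0" for c
  proof -
    let ?Tc = "cone_T k c" and ?Sc = "cone_S k c"
    \<comment> \<open>This multiple makes the difference \<open>?T\<close> vanish in the direction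
      of \<open>p0\<close>. Then \<open>?S\<close> vanishes there too, and \<open>no_common\<close>
      forces the difference to be zero.\<close>
    define e where "e = ?Tc a1 a2 / T a1 a2"
    let ?T = "\<lambda>u v. ?Tc u v - e * T u v" and ?S = "\<lambda>u v. ?Sc u v - e * S u v"
    have cv: "cone_value ?Tc ?Sc q p = 0" if "p \<in> P" for p
      using c[OF that] by (simp add: cone_value_coeffs)
    have in_T: "?T \<in> binary_forms_pred k"
      by (intro binary_forms_pred_diff binary_forms_pred_scale T cone_T_in)
    have in_S: "?S \<in> binary_forms k"
      by (intro binary_forms_diff binary_forms_scale S cone_S_in)
    have van': "cone_value ?T ?S q p = 0" if "p \<in> P" for p
    proof -
      have "cone_value ?T ?S q p = cone_value ?Tc ?Sc q p - e * cone_value T S q p"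
        by (simp add: cone_value_def algebra_simps)
      then show ?thesis using cv[OF that] van[OF that] by simp
    qed
    have "?T a1 a2 = 0" using Ta by (simp add: e_def)
    moreover from this have "?S a1 a2 = 0"
      using van'[OF p0(1)] unfolding cone_value_def a1_def a2_def by simp
    ultimately have "\<not> (\<exists>u v. ?T u v \<noteq> 0 \<or> ?S u v \<noteq> 0)"
      using no_common[OF in_T in_S _ van' a] by blast
    then have zero: "\<And>u v. ?T u v = 0" "\<And>u v. ?S u v = 0" by blast+
    have "cone_T k (\<lambda>j. c j - e * v j) x y = ?T x y" "cone_S k (\<lambda>j. c j - e * v j) x y = ?S x y" for x y
      unfolding v cone_T_def cone_S_def by (simp_all add: algebra_simps sum_subtractf sum_distrib_left)
    then have "c j - e * v j = 0" if "j < k + Suc k" for j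
      using cone_coeffs_zero[of k "\<lambda>j. c j - e * v j", OF _ _ that] zero by simp
    then show ?thesis by (intro exI[of _ e]) simp
  qed
  have "\<exists>w. \<forall>p\<in>P. (\<Sum>j<k + Suc k. w j * cone_monom k q p j) + \<delta> p = 0"
  proof (rule kernel_first_order[where m = "\<lambda>n. cone_monom k (?x (t n))" and t = t and v = v and ?j0.0 = j0])
    show "(\<lambda>n. cone_monom k (?x (t n)) p j) \<longlonglongrightarrow> cone_monom k q p j" for p j
      by (rule tendsto_cone_monom[OF lim])
    show "\<exists>c. (\<exists>j<k + Suc k. c j \<noteq> 0) \<and> (\<forall>p\<in>P. (\<Sum>j<k + Suc k. c j * cone_monom k (?x (t n)) p j) = 0)" for n
      using e(2)[OF t0 te, of n] unfolding has_cone_curve_iff_coeffs .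
    show "(\<lambda>n. (\<Sum>j<k + Suc k. v j * cone_monom k (?x (t n)) p j) / t n) \<longlonglongrightarrow> \<delta> p" if "p \<in> P" for p
      using filterlim_compose[OF deriv[OF that] t] unfolding v cone_value_coeffs .
  qed (use t0 j0 unique in auto)
  then obtain w where "\<forall>p\<in>P. cone_value (cone_T k w) (cone_S k w) q p + \<delta> p = 0"
    unfolding cone_value_coeffs by blast
  then show thesis
    by (intro that[OF cone_T_in[of k w] cone_S_in[of k w]]) blast
qed

text \<open>
  On the affine line through \<open>b\<close> in direction \<open>w\<close> the forms become univariate polynomials, and moving
  the vertex in direction \<open>w\<close> amounts to moving the argument.
\<close>

lemma cone_derivative:
  fixes Tp Sp :: "complex poly"
  assumes T: "T \<in> binary_forms n" and S: "S \<in> binary_forms (Suc n)"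
    and Tp: "\<And>s. poly Tp s = T (s * w1 + b1) (s * w2 + b2)"
    and Sp: "\<And>s. poly Sp s = S (s * w1 + b1) (s * w2 + b2)"
    and p: "proj_u q p = \<tau> * (s * w1 + b1)" "proj_v q p = \<tau> * (s * w2 + b2)" and \<tau>: "\<tau> \<noteq> 0"
    and van: "cone_value T S q p = 0"
    and \<zeta>: "\<zeta> = p $ 3 / \<tau>"
  shows "((\<lambda>t. cone_value T S (fst q + t * w1, snd q + t * w2) p / t) \<longlongrightarrow>
            \<tau> ^ Suc n * - (\<zeta>\<^sup>2 * poly (pderiv Tp) s + \<zeta> * poly (pderiv Sp) s)) (at 0)"
    and "\<zeta> * poly Tp s + poly Sp s = 0"
proof -
  let ?G = "smult \<zeta> Tp + Sp"
  \<comment> \<open>Moving the vertex by \<open>t w\<close> changes \<open>(u, v)\<close> at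
    \<open>p\<close> by \<open>- t * p $ 3 * w\<close>. After division by \<open>\<tau>\<close> this
    is the shift of the argument from \<open>s\<close> to \<open>s - t * \<zeta>\<close>;
    homogeneity yields the power of \<open>\<tau>\<close>.\<close>
  have value_eq: "cone_value T S (fst q + t * w1, snd q + t * w2) p = \<tau> ^ Suc n * poly ?G (s - t * \<zeta>)" for t
  proof -
    have uv: "proj_u (fst q + t * w1, snd q + t * w2) p = \<tau> * ((s - t * \<zeta>) * w1 + b1)"
      "proj_v (fst q + t * w1, snd q + t * w2) p = \<tau> * ((s - t * \<zeta>) * w2 + b2)"
      using p \<tau> by (simp_all add: proj_u_def proj_v_def \<zeta> algebra_simps)
    show ?thesis
      unfolding cone_value_def uv binary_forms_homogeneous[OF T] binary_forms_homogeneous[OF S]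
      using \<tau> by (simp add: Tp Sp \<zeta> algebra_simps)
  qed
  have G0: "poly ?G s = 0"
    using value_eq[of 0] van \<tau> by simp
  then show "\<zeta> * poly Tp s + poly Sp s = 0" by simp
  have "((\<lambda>t. poly ?G (s - t * \<zeta>)) has_field_derivative poly (pderiv ?G) (s - 0 * \<zeta>) * (- \<zeta>)) (at 0)"
    by (rule DERIV_chain2[OF poly_DERIV]) (auto intro!: derivative_eq_intros)
  then have "((\<lambda>t. \<tau> ^ Suc n * poly ?G (s - t * \<zeta>)) has_field_derivative
      \<tau> ^ Suc n * (poly (pderiv ?G) s * (- \<zeta>))) (at 0)"
    by (intro DERIV_cmult) simp
  then have "((\<lambda>t. (\<tau> ^ Suc n * poly ?G (s - (0 + t) * \<zeta>) - \<tau> ^ Suc n * poly ?G (s - 0 * \<zeta>)) / t) \<longlongrightarrow>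
      \<tau> ^ Suc n * (poly (pderiv ?G) s * (- \<zeta>))) (at 0)"
    unfolding DERIV_def .
  then have lim: "((\<lambda>t. (\<tau> ^ Suc n * poly ?G (s - t * \<zeta>)) / t) \<longlongrightarrow>
      \<tau> ^ Suc n * (poly (pderiv ?G) s * (- \<zeta>))) (at 0)"
    using G0 by simp
  have eq: "poly (pderiv ?G) s * (- \<zeta>) = - (\<zeta>\<^sup>2 * poly (pderiv Tp) s + \<zeta> * poly (pderiv Sp) s)"
    by (simp add: pderiv_add pderiv_smult algebra_simps power2_eq_square)
  from lim show "((\<lambda>t. cone_value T S (fst q + t * w1, snd q + t * w2) p / t) \<longlongrightarrow>
            \<tau> ^ Suc n * - (\<zeta>\<^sup>2 * poly (pderiv Tp) s + \<zeta> * poly (pderiv Sp) s)) (at 0)"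
    unfolding value_eq eq .
qed


text \<open>Persistence of the curve near \<open>q\<close> gives a contact polynomial that vanishes
  in the direction of each point, and distinct points have distinct directions. The first
  alternative arises by moving along a zero of \<open>T\<close>, the second when \<open>T\<close> is
  a power of a linear form.\<close>

lemma cone_local_bound:
  fixes P :: "(complex ^ 3) set"
  assumes k: "k \<ge> 2" and ne: "P \<noteq> {}" and fin: "finite P"
    and dir: "\<And>p. p \<in> P \<Longrightarrow> proj_u q p \<noteq> 0 \<or> proj_v q p \<noteq> 0"
    and distinct: "\<And>p p'. p \<in> P \<Longrightarrow> p' \<in> P \<Longrightarrow> p \<noteq> p' \<Longrightarrow>
          proj_u q p * proj_v q p' - proj_u q p' * proj_v q p \<noteq> 0"
    and near: "\<forall>\<^sub>F x in nhds q. has_cone_curve k P x"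
    and no_common: "\<And>T S a1 a2. T \<in> binary_forms_pred k \<Longrightarrow> S \<in> binary_forms k \<Longrightarrow>
          \<exists>u v. T u v \<noteq> 0 \<or> S u v \<noteq> 0 \<Longrightarrow> (\<And>p. p \<in> P \<Longrightarrow> cone_value T S q p = 0) \<Longrightarrow>
          a1 \<noteq> 0 \<or> a2 \<noteq> 0 \<Longrightarrow> T a1 a2 = 0 \<Longrightarrow> S a1 a2 \<noteq> 0"
  shows "card P \<le> 3 * k - 3 \<or> card P \<le> 2 * k"
proof -
  obtain n where n: "k = Suc n" "n \<ge> 1" using k by (cases k) auto
  have "has_cone_curve k P q" using eventually_nhds_x_imp_x[OF near] .
  then obtain T S where T: "T \<in> binary_forms_pred k" and S: "S \<in> binary_forms k"
    and nz: "\<exists>u v. T u v \<noteq> 0 \<or> S u v \<noteq> 0" and van: "\<And>p. p \<in> P \<Longrightarrow> cone_value T S q p = 0"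
    unfolding has_cone_curve_def by blast
  have Tn: "T \<in> binary_forms n" and Sn: "S \<in> binary_forms (Suc n)" using T S n by simp_all
  note nc = no_common[OF T S nz van]
  have T_nz_at: "T (proj_u q p) (proj_v q p) \<noteq> 0" if p: "p \<in> P" for p
  proof
    assume 0: "T (proj_u q p) (proj_v q p) = 0"
    then have "S (proj_u q p) (proj_v q p) = 0" using van[OF p] by (simp add: cone_value_def)
    with nc[OF _ dir[OF p] 0] show False by blast
  qed
  \<comment> \<open>Stated for an arbitrary affine chart \<open>s * w + b\<close> of the directions,
    since the two cases below need different charts.\<close>
  have contact: "\<exists>T1 S1. degree T1 \<le> k - 1 \<and> degree S1 \<le> k \<and>
      (\<forall>p\<in>P. poly (contact_poly Tp Sp T1 S1) (\<sigma> p) = 0)"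
    if Tp: "\<And>s. poly Tp s = T (s * w1 + b1) (s * w2 + b2)"
      and Sp: "\<And>s. poly Sp s = S (s * w1 + b1) (s * w2 + b2)"
      and \<sigma>: "\<And>p. p \<in> P \<Longrightarrow> \<tau> p \<noteq> 0 \<and> proj_u q p = \<tau> p * (\<sigma> p * w1 + b1) \<and> proj_v q p = \<tau> p * (\<sigma> p * w2 + b2)"
    for Tp Sp w1 w2 b1 b2 \<tau> \<sigma>
  proof -
    define \<zeta> where "\<zeta> p = p $ 3 / \<tau> p" for p :: "complex ^ 3"
    define \<delta> where "\<delta> p = \<tau> p ^ Suc n * - ((\<zeta> p)\<^sup>2 * poly (pderiv Tp) (\<sigma> p) + \<zeta> p * poly (pderiv Sp) (\<sigma> p))" for p
    obtain p0 where p0: "p0 \<in> P" using ne by blast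
    have deriv: "((\<lambda>t. cone_value T S (fst q + t * w1, snd q + t * w2) p / t) \<longlongrightarrow> \<delta> p) (at 0)"
      and root: "\<zeta> p * poly Tp (\<sigma> p) + poly Sp (\<sigma> p) = 0" if p: "p \<in> P" for p
      unfolding \<delta>_def
      using cone_derivative[OF Tn Sn Tp Sp _ _ _ van[OF p] \<zeta>_def, where s = "\<sigma> p"] \<sigma>[OF p] by blast+
    have "\<exists>T' S'. T' \<in> binary_forms_pred k \<and> S' \<in> binary_forms k \<and> (\<forall>p\<in>P. cone_value T' S' q p + \<delta> p = 0)"
    proof (rule cone_first_order[where \<delta> = \<delta> and ?w1.0 = w1 and ?w2.0 = w2 and T = T and S = S
            and k = k and P = P and q = q and ?p0.0 = p0])
      show "S' a1 a2 \<noteq> 0"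
        if "T' \<in> binary_forms_pred k" "S' \<in> binary_forms k" "\<exists>u v. T' u v \<noteq> 0 \<or> S' u v \<noteq> 0"
          "\<And>p. p \<in> P \<Longrightarrow> cone_value T' S' q p = 0" "a1 \<noteq> 0 \<or> a2 \<noteq> 0" "T' a1 a2 = 0" for T' S' a1 a2
        by (rule no_common[OF that])
    qed (use T S nz van near p0 dir[OF p0] deriv in blast)+
    then obtain T' S' where T': "T' \<in> binary_forms_pred k" and S': "S' \<in> binary_forms k"
      and eq: "\<And>p. p \<in> P \<Longrightarrow> cone_value T' S' q p + \<delta> p = 0"
      by blast
    have T'n: "T' \<in> binary_forms n" and S'n: "S' \<in> binary_forms (Suc n)" using T' S' n by simp_all
    obtain T1 where T1: "degree T1 \<le> n" "\<And>s. poly T1 s = T' (s * w1 + b1) (s * w2 + b2)"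
      by (rule binary_forms_on_line[OF T'n, where ?a1.0 = w1 and ?a2.0 = w2 and ?b1.0 = b1 and ?b2.0 = b2]) (rule that)
    obtain S1 where S1: "degree S1 \<le> Suc n" "\<And>s. poly S1 s = S' (s * w1 + b1) (s * w2 + b2)"
      by (rule binary_forms_on_line[OF S'n, where ?a1.0 = w1 and ?a2.0 = w2 and ?b1.0 = b1 and ?b2.0 = b2]) (rule that)
    have "poly (contact_poly Tp Sp T1 S1) (\<sigma> p) = 0" if p: "p \<in> P" for p
    proof (rule contact_poly_root[OF root[OF p]])
      have \<tau>: "\<tau> p \<noteq> 0" and u: "proj_u q p = \<tau> p * (\<sigma> p * w1 + b1)" and v: "proj_v q p = \<tau> p * (\<sigma> p * w2 + b2)"
        using \<sigma>[OF p] by blast+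
      have "cone_value T' S' q p = \<tau> p ^ Suc n * (\<zeta> p * poly T1 (\<sigma> p) + poly S1 (\<sigma> p))"
        unfolding cone_value_def u v binary_forms_homogeneous[OF T'n] binary_forms_homogeneous[OF S'n]
        using \<tau> by (simp add: T1(2) S1(2) \<zeta>_def algebra_simps)
      then have "\<tau> p ^ Suc n * (\<zeta> p * poly T1 (\<sigma> p) + poly S1 (\<sigma> p) - (\<zeta> p)\<^sup>2 * poly (pderiv Tp) (\<sigma> p)
           - \<zeta> p * poly (pderiv Sp) (\<sigma> p)) = 0"
        using eq[OF p] by (simp add: \<delta>_def algebra_simps)
      then show "\<zeta> p * poly T1 (\<sigma> p) + poly S1 (\<sigma> p) - (\<zeta> p)\<^sup>2 * poly (pderiv Tp) (\<sigma> p)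
           - \<zeta> p * poly (pderiv Sp) (\<sigma> p) = 0"
        using \<tau> by simp
    qed
    then show ?thesis using T1(1) S1(1) n by (intro exI[of _ T1] exI[of _ S1]) simp
  qed
  have T_nz: "\<exists>u v. T u v \<noteq> 0" using T_nz_at ne by blast
  obtain m where m: "n = Suc m" using n(2) by (cases n) auto
  obtain a1 a2 where a: "a1 \<noteq> 0 \<or> a2 \<noteq> 0" and Ta: "T a1 a2 = 0"
    by (rule binary_forms_has_zero[OF Tn[unfolded m]]) (rule that)
  obtain b2 b1' where b': "b2 * a1 + b1' * a2 = 1"
    using ex_linear_form_eq_1[OF a] by blast
  define b1 where "b1 = - b1'"
  \<comment> \<open>\<open>(a1, a2)\<close>, \<open>(b1, b2)\<close> is a unimodular basis, with coordinates \<open>\<alpha>\<close> and \<open>\<beta>\<close>.\<close>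
  have b: "a1 * b2 - a2 * b1 = 1" using b' by (simp add: b1_def algebra_simps)
  define \<alpha> \<beta> where "\<alpha> p = b2 * proj_u q p - b1 * proj_v q p"
    and "\<beta> p = a1 * proj_v q p - a2 * proj_u q p" for p
  have coords: "proj_u q p = \<alpha> p * a1 + \<beta> p * b1" "proj_v q p = \<alpha> p * a2 + \<beta> p * b2" for p
  proof -
    have "\<alpha> p * a1 + \<beta> p * b1 = (a1 * b2 - a2 * b1) * proj_u q p"
      "\<alpha> p * a2 + \<beta> p * b2 = (a1 * b2 - a2 * b1) * proj_v q p"
      by (simp_all add: \<alpha>_def \<beta>_def algebra_simps)
    then show "proj_u q p = \<alpha> p * a1 + \<beta> p * b1" "proj_v q p = \<alpha> p * a2 + \<beta> p * b2"
      unfolding b by simp_all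
  qed
  have \<beta>: "\<beta> p \<noteq> 0" if p: "p \<in> P" for p
  proof
    assume 0: "\<beta> p = 0"
    have "T (proj_u q p) (proj_v q p) = \<alpha> p ^ n * T a1 a2"
      unfolding coords 0 using binary_forms_homogeneous[OF Tn] by simp
    with Ta T_nz_at[OF p] show False by simp
  qed
  obtain Tp where Tp: "degree Tp \<le> n" "coeff Tp n = T a1 a2" "\<And>s. poly Tp s = T (s * a1 + b1) (s * a2 + b2)"
    by (rule binary_forms_on_line[OF Tn]) (rule that)
  obtain Sp where Sp: "degree Sp \<le> Suc n" "coeff Sp (Suc n) = S a1 a2" "\<And>s. poly Sp s = S (s * a1 + b1) (s * a2 + b2)"
    by (rule binary_forms_on_line[OF Sn]) (rule that)
  show ?thesis
  proof (cases "pderiv Tp = 0")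
    case False
    define \<sigma> where "\<sigma> p = \<alpha> p / \<beta> p" for p
    have "\<beta> p \<noteq> 0 \<and> proj_u q p = \<beta> p * (\<sigma> p * a1 + b1) \<and> proj_v q p = \<beta> p * (\<sigma> p * a2 + b2)" if "p \<in> P" for p
    proof -
      have "\<alpha> p = \<beta> p * \<sigma> p" using \<beta>[OF that] by (simp add: \<sigma>_def)
      then show ?thesis using \<beta>[OF that] unfolding coords by (simp add: distrib_left mult.assoc)
    qed
    from contact[OF Tp(3) Sp(3) this]
    obtain T1 S1 where 1: "degree T1 \<le> k - 1" "degree S1 \<le> k"
      "\<forall>p\<in>P. poly (contact_poly Tp Sp T1 S1) (\<sigma> p) = 0" by blast
    \<comment> \<open>The chart runs in the direction of the zero \<open>(a1, a2)\<close> of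
      \<open>T\<close>, so the coefficient of \<open>Tp\<close> at \<open>n\<close>
      vanishes.\<close>
    have "degree Tp \<noteq> n"
    proof
      assume "degree Tp = n"
      then have "lead_coeff Tp = 0" using Tp(2) Ta by simp
      then have "Tp = 0" by simp
      with False show False by simp
    qed
    then have "degree Tp \<le> k - 2" using Tp(1) n by simp
    moreover have "poly Sp s \<noteq> 0" if "poly Tp s = 0" for s
    proof -
      have "s * a1 + b1 \<noteq> 0 \<or> s * a2 + b2 \<noteq> 0"
      proof (rule ccontr)
        assume "\<not> ?thesis"
        then have "b1 = - (s * a1)" "b2 = - (s * a2)" by (simp_all add: add_eq_0_iff)
        with b show False by (simp add: algebra_simps)
      qed
      then show ?thesis using nc[of "s * a1 + b1" "s * a2 + b2"] that unfolding Tp(3) Sp(3) by blast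
    qed
    ultimately have "card (\<sigma> ` P) \<le> 3 * k - 3"
      using 1 False Sp(1) n by (intro card_contact_le[of Tp k Sp T1 S1]) auto
    moreover have "inj_on \<sigma> P"
    proof (rule inj_onI, rule ccontr)
      fix p p' assume p: "p \<in> P" "p' \<in> P" "\<sigma> p = \<sigma> p'" "p \<noteq> p'"
      then have "\<alpha> p * \<beta> p' = \<alpha> p' * \<beta> p"
        using \<beta> by (simp add: \<sigma>_def frac_eq_eq)
      moreover have "proj_u q p * proj_v q p' - proj_u q p' * proj_v q p
          = (a1 * b2 - a2 * b1) * (\<alpha> p * \<beta> p' - \<alpha> p' * \<beta> p)"
        unfolding coords by (simp add: algebra_simps)
      ultimately show False using distinct[OF p(1,2,4)] by simp
    qed
    ultimately show ?thesis by (simp add: card_image)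
  next
    case True
    then obtain c where c: "Tp = [:c:]" by (auto simp: pderiv_eq_0_iff elim: degree_eq_zeroE)
    \<comment> \<open>By homogeneity a constant restriction means that \<open>T\<close> is
      \<open>c\<close> times the \<open>n\<close>-th power of the coordinate along
      \<open>(b1, b2)\<close>; that coordinate is nonzero for all points of
      \<open>P\<close>.\<close>
    have T_eq: "T (x * a1 + y * b1) (x * a2 + y * b2) = c * y ^ n" if "y \<noteq> 0" for x y
    proof -
      have "y * (x / y * z + z') = x * z + y * z'" for z z'
        using that by (simp add: distrib_left)
      then have "T (x * a1 + y * b1) (x * a2 + y * b2) = T (y * (x / y * a1 + b1)) (y * (x / y * a2 + b2))"
        by (simp only:)
      also have "\<dots> = y ^ n * poly Tp (x / y)"
        by (simp add: binary_forms_homogeneous[OF Tn] Tp(3))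
      finally show ?thesis by (simp add: c)
    qed
    have "c \<noteq> 0"
    proof -
      obtain p where p: "p \<in> P" using ne by blast
      have "T (proj_u q p) (proj_v q p) = c * \<beta> p ^ n"
        unfolding coords by (rule T_eq[OF \<beta>[OF p]])
      then show ?thesis using T_nz_at[OF p] by auto
    qed
    \<comment> \<open>Here \<open>T\<close> is a power of a linear form. Let the vertex move in a direction \<open>b + \<eta> a\<close> which is
      neither the zero of \<open>T\<close> nor the direction of a point of \<open>P\<close>.\<close>
    have "finite ((\<lambda>p. \<alpha> p / \<beta> p) ` P)" using fin by simp
    then obtain \<eta> where \<eta>: "\<eta> \<notin> (\<lambda>p. \<alpha> p / \<beta> p) ` P"
      using ex_new_if_finite infinite_UNIV_char_0 by blast
    define w1 w2 where "w1 = b1 + \<eta> * a1" and "w2 = b2 + \<eta> * a2"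
    define \<gamma> where "\<gamma> p = \<alpha> p - \<eta> * \<beta> p" for p
    have \<gamma>: "\<gamma> p \<noteq> 0" if "p \<in> P" for p
    proof
      assume "\<gamma> p = 0"
      then have "\<eta> = \<alpha> p / \<beta> p" using \<beta>[OF that] by (simp add: \<gamma>_def field_simps)
      with \<eta> that show False by blast
    qed
    define \<sigma> where "\<sigma> p = \<beta> p / \<gamma> p" for p
    have \<sigma>: "\<gamma> p \<noteq> 0 \<and> proj_u q p = \<gamma> p * (\<sigma> p * w1 + a1) \<and> proj_v q p = \<gamma> p * (\<sigma> p * w2 + a2)" if "p \<in> P" for p
    proof -
      have "\<beta> p = \<gamma> p * \<sigma> p" "\<alpha> p = \<gamma> p + \<eta> * \<beta> p"
        using \<gamma>[OF that] by (simp_all add: \<sigma>_def \<gamma>_def)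
      then show ?thesis
        using \<gamma>[OF that] unfolding coords w1_def w2_def by (simp add: algebra_simps)
    qed
    obtain Sq where Sq: "degree Sq \<le> Suc n" "\<And>s. poly Sq s = S (s * w1 + a1) (s * w2 + a2)"
      by (rule binary_forms_on_line[OF Sn]) (rule that)
    \<comment> \<open>With base point \<open>(a1, a2)\<close> and direction \<open>w\<close>, the
      coordinate along \<open>(b1, b2)\<close> is \<open>s\<close> itself.\<close>
    have Tq: "poly (monom c n) s = T (s * w1 + a1) (s * w2 + a2)" for s
    proof (cases "s = 0")
      case True
      then show ?thesis using Ta n(2) by (simp add: poly_monom zero_power)
    next
      case False
      have "T (s * w1 + a1) (s * w2 + a2) = T ((s * \<eta> + 1) * a1 + s * b1) ((s * \<eta> + 1) * a2 + s * b2)"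
        by (simp add: w1_def w2_def algebra_simps)
      then show ?thesis using T_eq[OF False] by (simp add: poly_monom)
    qed
    from contact[OF Tq Sq(2) \<sigma>]
    obtain T1 S1 where 1: "degree T1 \<le> k - 1" "degree S1 \<le> k"
      "\<forall>p\<in>P. poly (contact_poly (monom c n) Sq T1 S1) (\<sigma> p) = 0" by blast
    have "poly Sq 0 \<noteq> 0" unfolding Sq(2) using nc[OF _ a Ta] by simp
    then have "card (\<sigma> ` P) \<le> 2 * k"
      using 1 \<open>c \<noteq> 0\<close> Sq(1) n k \<beta> \<gamma>
      by (intro card_contact_power_le[of Sq k T1 S1 c]) (auto simp: \<sigma>_def)
    moreover have "inj_on \<sigma> P"
    proof (rule inj_onI, rule ccontr)
      fix p p' assume p: "p \<in> P" "p' \<in> P" "\<sigma> p = \<sigma> p'" "p \<noteq> p'"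
      then have "\<beta> p * \<gamma> p' = \<beta> p' * \<gamma> p"
        using \<gamma> by (simp add: \<sigma>_def frac_eq_eq)
      then have "\<alpha> p * \<beta> p' - \<alpha> p' * \<beta> p = 0"
        by (simp add: \<gamma>_def algebra_simps)
      moreover have "proj_u q p * proj_v q p' - proj_u q p' * proj_v q p
          = (a1 * b2 - a2 * b1) * (\<alpha> p * \<beta> p' - \<alpha> p' * \<beta> p)"
        unfolding coords by (simp add: algebra_simps)
      ultimately show False using distinct[OF p(1,2,4)] by simp
    qed
    ultimately show ?thesis by (simp add: card_image)
  qed
qed


text \<open>
  At a vertex \<open>q\<close> where as few pairs \<open>(k, P')\<close> as possible carry a curve, the pairs that do so still
  do nearby. For the smallest \<open>k\<close> that loses at most \<open>d - k\<close> points no line splits off, and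
  \<open>cone_local_bound\<close> leaves only \<open>k = 1\<close>.
\<close>

lemma cone_curves_line:
  fixes P :: "(complex ^ 3) set"
  assumes fin: "finite P" and V: "open V" "V \<noteq> {}" and d: "d \<ge> 3" and card: "3 * d - 2 \<le> card P"
    and general: "\<And>q p p'. q \<in> V \<Longrightarrow> p \<in> P \<Longrightarrow> p' \<in> P \<Longrightarrow> p \<noteq> p' \<Longrightarrow>
          proj_u q p * proj_v q p' - proj_u q p' * proj_v q p \<noteq> 0"
    and curve: "\<And>q. q \<in> V \<Longrightarrow> has_cone_curve d P q"
  obtains q t s1 s2 E where "q \<in> V" "t \<noteq> 0" "E \<subseteq> P" "card E \<le> d - 1"
    "\<And>p. p \<in> P - E \<Longrightarrow> t * p $ 3 + s1 * proj_u q p + s2 * proj_v q p = 0"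
proof -
  define D where "D x = {(k, P'). (k, P') \<in> {..d} \<times> Pow P \<and> has_cone_curve k P' x}" for x
  have finD: "finite (D x)" for x
    by (rule finite_subset[of _ "{..d} \<times> Pow P"]) (auto simp: D_def fin)
  obtain q where q: "q \<in> V" and least: "\<And>x. x \<in> V \<Longrightarrow> card (D q) \<le> card (D x)"
    using ex_has_least_nat[of "\<lambda>x. x \<in> V" _ "\<lambda>x. card (D x)"] V(2) by blast
  have "\<forall>\<^sub>F x in nhds q. \<forall>z\<in>{..d} \<times> Pow P - D q. \<not> has_cone_curve (fst z) (snd z) x"
    by (intro eventually_ball_finite finite_Diff finite_cartesian_product ballI has_cone_curve_closed)
       (auto simp: fin D_def)
  moreover have "\<forall>\<^sub>F x in nhds q. x \<in> V"
    using V(1) q by (rule eventually_nhds_in_open)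
  ultimately have "\<forall>\<^sub>F x in nhds q. D x = D q"
  proof eventually_elim
    case (elim x)
    \<comment> \<open>By closedness no new pair appears near \<open>q\<close>; minimality of
      \<open>card (D q)\<close> then excludes that a pair is lost.\<close>
    have "D x \<subseteq> D q"
    proof
      fix z assume z: "z \<in> D x"
      then have "z \<in> {..d} \<times> Pow P" "has_cone_curve (fst z) (snd z) x" by (auto simp: D_def)
      with elim(1) show "z \<in> D q" by blast
    qed
    then show ?case using least[OF elim(2)] finD by (simp add: card_seteq)
  qed
  then have near: "\<forall>\<^sub>F x in nhds q. has_cone_curve k P' x"
    if "has_cone_curve k P' q" "k \<le> d" "P' \<subseteq> P" for k P'
  proof eventually_elim
    case (elim x)
    have "(k, P') \<in> D q" using that by (simp add: D_def)
    then have "(k, P') \<in> D x" unfolding elim .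
    then show ?case by (simp add: D_def)
  qed
  \<comment> \<open>Passing from degree \<open>d\<close> to degree \<open>k\<close> may cost at most
    \<open>d - k\<close> points, one for each line split off.\<close>
  define Q where "Q k \<longleftrightarrow> (\<exists>P'\<subseteq>P. card P + k \<le> card P' + d \<and> has_cone_curve k P' q)" for k
  define k where "k = (LEAST k. Q k)"
  have "Q d" using curve[OF q] by (auto simp: Q_def)
  then have "Q k" and kd: "k \<le> d" and min: "\<And>j. j < k \<Longrightarrow> \<not> Q j"
    unfolding k_def by (auto intro: LeastI Least_le dest: not_less_Least)
  then obtain P' where P': "P' \<subseteq> P" "card P + k \<le> card P' + d" "has_cone_curve k P' q"
    unfolding Q_def by blast
  have fin': "finite P'" using P'(1) fin finite_subset by blast
  have no_common: "S a1 a2 \<noteq> 0"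
    if T: "T \<in> binary_forms_pred k" and S: "S \<in> binary_forms k" and nz: "\<exists>u v. T u v \<noteq> 0 \<or> S u v \<noteq> 0"
      and van: "\<And>p. p \<in> P' \<Longrightarrow> cone_value T S q p = 0"
      and a: "a1 \<noteq> 0 \<or> a2 \<noteq> 0" "T a1 a2 = 0" and k: "k \<noteq> 0" for T S a1 a2
  proof
    assume Sa: "S a1 a2 = 0"
    obtain n where n: "k = Suc n" using k by (cases k) auto
    let ?r = "\<lambda>p. a2 * proj_u q p - a1 * proj_v q p"
    let ?P = "{p \<in> P'. ?r p \<noteq> 0}"
    have has: "has_cone_curve n ?P q"
      using cone_split_line[OF T[unfolded n] S[unfolded n] nz van a Sa] .
    \<comment> \<open>Discarded points have directions proportional to \<open>(a1, a2)\<close>, so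
      the determinant of two of them vanishes. General position thus leaves at most one, and
      \<open>Q\<close> would hold one degree lower.\<close>
    have "p = p'" if p: "p \<in> P' - ?P" "p' \<in> P' - ?P" for p p'
    proof (rule ccontr)
      assume "p \<noteq> p'"
      define x where "x = proj_u q p * proj_v q p' - proj_u q p' * proj_v q p"
      have r: "a2 * proj_u q p = a1 * proj_v q p" "a2 * proj_u q p' = a1 * proj_v q p'" using p by auto
      have "a2 * x = (a2 * proj_u q p) * proj_v q p' - (a2 * proj_u q p') * proj_v q p"
        by (simp add: x_def algebra_simps)
      then have "a2 * x = 0" unfolding r by simp
      moreover have "a1 * x = proj_u q p * (a1 * proj_v q p') - proj_u q p' * (a1 * proj_v q p)"
        by (simp add: x_def algebra_simps)
      then have "a1 * x = 0" unfolding r[symmetric] by simp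
      ultimately have "x = 0" using a(1) by auto
      then show False using general[OF q _ _ \<open>p \<noteq> p'\<close>] p P'(1) by (auto simp: x_def)
    qed
    then have "card (P' - ?P) \<le> 1"
      using fin' by (auto simp: card_le_Suc0_iff_eq)
    then have "card P' \<le> card ?P + 1"
      using card_Diff_subset[of ?P P'] fin' by auto
    then have "Q n"
      unfolding Q_def using P' n has by (intro exI[of _ ?P]) auto
    then show False using min[of n] n by simp
  qed
  obtain T S where T: "T \<in> binary_forms_pred k" and S: "S \<in> binary_forms k"
    and nz: "\<exists>u v. T u v \<noteq> 0 \<or> S u v \<noteq> 0" and van: "\<And>p. p \<in> P' \<Longrightarrow> cone_value T S q p = 0"
    using P'(3) unfolding has_cone_curve_def by blast
  consider "k = 0" | "k = Suc 0" | "k \<ge> 2" by linarith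
  then show thesis
  proof cases
    case 1
    then obtain c where "T = (\<lambda>u v. 0)" "S = (\<lambda>u v. c)" using T S by auto
    then have "P' = {}" using nz van by (auto simp: cone_value_def)
    with P'(2) card d show thesis by simp
  next
    case 2
    then obtain t where t: "T = (\<lambda>u v. t)" using T by auto
    \<comment> \<open>With \<open>t = 0\<close> the linear form \<open>S\<close> has a zero, which
      is common to \<open>T\<close> and \<open>S\<close>; \<open>no_common\<close> excludes
      this.\<close>
    have "t \<noteq> 0"
    proof
      assume "t = 0"
      obtain a1 a2 where a: "a1 \<noteq> 0 \<or> a2 \<noteq> 0" "S a1 a2 = 0"
        by (rule binary_forms_has_zero[OF S[unfolded 2]]) (rule that)
      moreover have "T a1 a2 = 0" using t \<open>t = 0\<close> by simp
      ultimately show False using no_common[OF T S nz van a(1)] 2 by simp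
    qed
    obtain f g where fg: "f \<in> binary_forms 0" "g \<in> binary_forms 0" "\<And>u v. S u v = u * f u v + v * g u v"
      by (rule binary_forms_SucE[OF S[unfolded 2]]) (rule that)
    then obtain s1 s2 where "f = (\<lambda>u v. s1)" "g = (\<lambda>u v. s2)" by auto
    then have S_eq: "S u v = s1 * u + s2 * v" for u v using fg(3) by simp
    have "card (P - P') \<le> d - 1"
      using P'(1,2) fin' 2 by (simp add: card_Diff_subset)
    moreover have "t * p $ 3 + s1 * proj_u q p + s2 * proj_v q p = 0" if "p \<in> P - (P - P')" for p
      using van[of p] that by (simp add: cone_value_def t S_eq mult.commute add.assoc)
    ultimately show thesis using q \<open>t \<noteq> 0\<close> by (intro that[of q t "P - P'" s1 s2]) auto
  next
    case 3
    have card': "2 * d + k \<le> card P' + 2" using P'(2) card d by linarith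
    have "card P' \<le> 3 * k - 3 \<or> card P' \<le> 2 * k"
    proof (rule cone_local_bound[OF 3 _ fin'])
      show "P' \<noteq> {}" using card' d by auto
      show distinct: "proj_u q p * proj_v q p' - proj_u q p' * proj_v q p \<noteq> 0"
        if "p \<in> P'" "p' \<in> P'" "p \<noteq> p'" for p p'
        using general[OF q] that P'(1) by blast
      show "proj_u q p \<noteq> 0 \<or> proj_v q p \<noteq> 0" if p: "p \<in> P'" for p
      proof -
        have "\<not> P' \<subseteq> {p}" using card' d 3 card_mono[of "{p}" P'] by auto
        then obtain p' where "p' \<in> P'" "p \<noteq> p'" by blast
        then show ?thesis using distinct[OF p] by fastforce
      qed
      show "\<forall>\<^sub>F x in nhds q. has_cone_curve k P' x"
        using near[OF P'(3) kd P'(1)] .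
      show "S a1 a2 \<noteq> 0"
        if "T \<in> binary_forms_pred k" "S \<in> binary_forms k" "\<exists>u v. T u v \<noteq> 0 \<or> S u v \<noteq> 0"
          "\<And>p. p \<in> P' \<Longrightarrow> cone_value T S q p = 0" "a1 \<noteq> 0 \<or> a2 \<noteq> 0" "T a1 a2 = 0" for T S a1 a2
        by (rule no_common[OF that]) (use 3 in auto)
    qed
    \<comment> \<open>A bound of \<open>3 * k - 3\<close> gives \<open>2 * d < 2 * k\<close>,
      against \<open>k \<le> d\<close>; a bound of \<open>2 * k\<close> gives
      \<open>2 * d \<le> k + 2\<close>, against \<open>d \<ge> 3\<close>.\<close>
    with card' kd d 3 show thesis by linarith
  qed
qed


section \<open>The coordinate ring\<close>

definition monom_value :: "monom3 \<Rightarrow> complex ^ 3 \<Rightarrow> complex" where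
  "monom_value m v = (\<Prod>i\<in>UNIV. (v $ i) ^ Poly_Mapping.lookup m i)"

lemma monom_value_add: "monom_value (m + m') v = monom_value m v * monom_value m' v"
  by (simp add: monom_value_def lookup_add power_add prod.distrib)

lemma monom_degree_add: "monom_degree (m + m') = monom_degree m + monom_degree m'"
  by (simp add: monom_degree_def lookup_add sum.distrib)

lemma eval3_superset:
  assumes "finite A" "Poly_Mapping.keys f \<subseteq> A"
  shows "eval3 f v = (\<Sum>m\<in>A. Poly_Mapping.lookup f m * monom_value m v)"
  unfolding eval3_def monom_value_def
  by (rule sum.mono_neutral_left[OF assms]) (auto simp: in_keys_iff)

lemma eval3_add: "eval3 (f + g) v = eval3 f v + eval3 g v"
proof -
  let ?A = "Poly_Mapping.keys f \<union> Poly_Mapping.keys g"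
  have "finite ?A" "Poly_Mapping.keys (f + g) \<subseteq> ?A" using Poly_Mapping.keys_add[of f g] by auto
  then show ?thesis
    by (simp add: eval3_superset[of ?A] lookup_add distrib_right sum.distrib)
qed

lemma eval3_zero [simp]: "eval3 0 v = 0"
  by (simp add: eval3_def)

lemma eval3_single: "eval3 (Poly_Mapping.single m c) v = c * monom_value m v"
  by (subst eval3_superset[of "{m}"]) auto

lemma eval3_sum: "eval3 (sum f A) v = (\<Sum>i\<in>A. eval3 (f i) v)"
  by (induction A rule: infinite_finite_induct) (auto simp: eval3_add)

lemma poly_mapping_eq_sum_single:
  "f = (\<Sum>m\<in>Poly_Mapping.keys f. Poly_Mapping.single m (Poly_Mapping.lookup f m))"
proof (rule poly_mapping_eqI)
  fix k
  have "(\<Sum>m\<in>Poly_Mapping.keys f. Poly_Mapping.lookup f m when m = k) = Poly_Mapping.lookup f k"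
    by (simp add: when_def in_keys_iff)
  then show "Poly_Mapping.lookup f k =
      Poly_Mapping.lookup (\<Sum>m\<in>Poly_Mapping.keys f. Poly_Mapping.single m (Poly_Mapping.lookup f m)) k"
    by (simp add: lookup_sum lookup_single)
qed

lemma eval3_mult: "eval3 (f * g) v = eval3 f v * eval3 g v"
proof -
  have "f * g = (\<Sum>m\<in>Poly_Mapping.keys f. \<Sum>m'\<in>Poly_Mapping.keys g.
      Poly_Mapping.single (m + m') (Poly_Mapping.lookup f m * Poly_Mapping.lookup g m'))"
    by (subst poly_mapping_eq_sum_single[of f], subst poly_mapping_eq_sum_single[of g])
       (simp add: sum_product mult_single)
  then have "eval3 (f * g) v = (\<Sum>m\<in>Poly_Mapping.keys f. \<Sum>m'\<in>Poly_Mapping.keys g.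
      (Poly_Mapping.lookup f m * monom_value m v) * (Poly_Mapping.lookup g m' * monom_value m' v))"
    by (simp add: eval3_sum eval3_single monom_value_add mult_ac)
  also have "\<dots> = eval3 f v * eval3 g v"
    by (simp add: eval3_superset[of "Poly_Mapping.keys f" f] eval3_superset[of "Poly_Mapping.keys g" g] sum_product)
  finally show ?thesis .
qed

lemma eval3_const_scale: "eval3 (const_scale c f) v = c * eval3 f v"
  by (simp add: const_scale_def eval3_mult eval3_single monom_value_def)

lemma eval3_diff: "eval3 (f - g) v = eval3 f v - eval3 g v"
  using eval3_add[of "f - g" g v] by simp

lemma forms_add: "f \<in> forms d \<Longrightarrow> g \<in> forms d \<Longrightarrow> f + g \<in> forms d"
  unfolding forms_def using Poly_Mapping.keys_add[of f g] by blast

lemma forms_mult: "f \<in> forms a \<Longrightarrow> g \<in> forms b \<Longrightarrow> f * g \<in> forms (a + b)"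
  unfolding forms_def using keys_mult[of f g] by (auto simp: monom_degree_add)

lemma forms_zero: "0 \<in> forms d"
  by (simp add: forms_def)

lemma forms_const: "Poly_Mapping.single 0 c \<in> forms 0"
  by (simp add: forms_def monom_degree_def)

lemma forms_const_scale: "f \<in> forms d \<Longrightarrow> const_scale c f \<in> forms d"
  unfolding const_scale_def using forms_mult[OF forms_const] by fastforce

lemma forms_subspace: "poly3_vs.subspace (forms d)"
  by (simp add: poly3_vs.subspace_def forms_add forms_zero forms_const_scale)

lemma forms_diff: "f \<in> forms d \<Longrightarrow> g \<in> forms d \<Longrightarrow> f - g \<in> forms d"
  using poly3_vs.subspace_diff[OF forms_subspace] .

lemma eval3_homogeneous:
  assumes "f \<in> forms d" shows "eval3 f (c *s v) = c ^ d * eval3 f v"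
proof -
  have "monom_value m (c *s v) = c ^ d * monom_value m v" if "m \<in> Poly_Mapping.keys f" for m
  proof -
    have "monom_value m (c *s v) = c ^ monom_degree m * monom_value m v"
      by (simp add: monom_value_def monom_degree_def power_mult_distrib prod.distrib power_sum)
    then show ?thesis using assms that by (simp add: forms_def)
  qed
  then show ?thesis
    by (simp add: eval3_superset[of "Poly_Mapping.keys f" f] sum_distrib_left mult_ac)
qed

lemma eval3_on_line:
  assumes "\<And>m. m \<in> Poly_Mapping.keys f \<Longrightarrow> monom_degree m \<le> d"
  obtains P where "degree P \<le> d" "\<And>t. eval3 f (a + t *s b) = poly P t"
proof -
  define M where "M m = (\<Prod>i\<in>UNIV. [:a $ i, b $ i:] ^ Poly_Mapping.lookup m i)" for m :: monom3
  define P where "P = (\<Sum>m\<in>Poly_Mapping.keys f. smult (Poly_Mapping.lookup f m) (M m))"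
  have "degree (smult (Poly_Mapping.lookup f m) (M m)) \<le> d" if "m \<in> Poly_Mapping.keys f" for m
  proof -
    have "degree (M m) \<le> (\<Sum>i\<in>UNIV. degree ([:a $ i, b $ i:] ^ Poly_Mapping.lookup m i))"
      unfolding M_def using degree_prod_sum_le[OF finite] by (simp add: o_def)
    also have "\<dots> \<le> (\<Sum>i\<in>UNIV. Poly_Mapping.lookup m i)"
    proof (rule sum_mono)
      fix i
      have "degree ([:a $ i, b $ i:] ^ Poly_Mapping.lookup m i) \<le> degree [:a $ i, b $ i:] * Poly_Mapping.lookup m i"
        by (rule degree_power_le)
      also have "\<dots> \<le> 1 * Poly_Mapping.lookup m i" by (rule mult_right_mono) auto
      finally show "degree ([:a $ i, b $ i:] ^ Poly_Mapping.lookup m i) \<le> Poly_Mapping.lookup m i" by simp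
    qed
    also have "\<dots> \<le> d" using assms[OF that] by (simp add: monom_degree_def)
    finally show ?thesis using degree_smult_le le_trans by blast
  qed
  then have "degree P \<le> d" unfolding P_def by (intro degree_sum_le) auto
  moreover have "eval3 f (a + t *s b) = poly P t" for t
    by (simp add: eval3_superset[of "Poly_Mapping.keys f" f] P_def poly_sum M_def poly_prod monom_value_def)
  ultimately show thesis by (rule that)
qed

text \<open>Kronecker substitution: the monomials of degree \<open>d\<close> take distinct values at \<open>(1, t, t\<^bsup>d+1\<^esup>)\<close>.\<close>

lemma eval3_eq_zero_imp:
  assumes f: "f \<in> forms d" and zero: "\<And>v. eval3 f v = 0"
  shows "f = 0"
proof (rule poly_mapping_eqI)
  fix m0
  define e where "e m = Poly_Mapping.lookup m 2 + Suc d * Poly_Mapping.lookup m 3" for m :: monom3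
  define P where "P = (\<Sum>m\<in>Poly_Mapping.keys f. monom (Poly_Mapping.lookup f m) (e m))"
  have "poly P t = eval3 f (vector [1, t, t ^ Suc d])" for t
    unfolding P_def eval3_superset[OF finite_keys subset_refl] monom_value_def UNIV_3
    by (simp add: poly_sum poly_monom e_def power_add vector_3 power_mult_distrib flip: power_mult)
  then have "\<forall>t. poly P t = 0" unfolding zero by simp
  then have "P = 0" using poly_all_0_iff_0[of P] by blast
  have inj: "m = m'" if "m \<in> Poly_Mapping.keys f" "m' \<in> Poly_Mapping.keys f" "e m = e m'" for m m'
  proof -
    have sum: "Poly_Mapping.lookup k 1 + Poly_Mapping.lookup k 2 + Poly_Mapping.lookup k 3 = d"
      if "k \<in> Poly_Mapping.keys f" for k
    proof -
      have "monom_degree k = d" using f that by (simp add: forms_def)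
      then show ?thesis unfolding monom_degree_def sum_3 .
    qed
    \<comment> \<open>So the exponents at 2 and 3 are remainder and quotient of \<open>e m\<close>
      by \<open>Suc d\<close>; the total degree gives the exponent at 1.\<close>
    have "Poly_Mapping.lookup m 2 < Suc d" "Poly_Mapping.lookup m' 2 < Suc d"
      using sum[OF that(1)] sum[OF that(2)] by linarith+
    then have "Poly_Mapping.lookup m 2 = Poly_Mapping.lookup m' 2" "Poly_Mapping.lookup m 3 = Poly_Mapping.lookup m' 3"
      using arg_cong[OF that(3), of "\<lambda>x. x mod Suc d"] arg_cong[OF that(3), of "\<lambda>x. x div Suc d"]
      unfolding e_def by (simp_all del: mult_Suc)
    moreover from this have "Poly_Mapping.lookup m 1 = Poly_Mapping.lookup m' 1"
      using sum[OF that(1)] sum[OF that(2)] by linarith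
    ultimately have "Poly_Mapping.lookup m i = Poly_Mapping.lookup m' i" for i
      using exhaust_3[of i] by metis
    then show ?thesis by (rule poly_mapping_eqI)
  qed
  show "Poly_Mapping.lookup f m0 = Poly_Mapping.lookup 0 m0"
  proof (cases "m0 \<in> Poly_Mapping.keys f")
    case True
    have "coeff P (e m0) = (\<Sum>m\<in>Poly_Mapping.keys f. if m = m0 then Poly_Mapping.lookup f m else 0)"
      unfolding P_def coeff_sum coeff_monom using inj True by (intro sum.cong) auto
    also have "\<dots> = Poly_Mapping.lookup f m0" using True by simp
    finally show ?thesis using \<open>P = 0\<close> by simp
  qed (simp add: in_keys_iff)
qed

section \<open>Coordinate forms\<close>

definition coord :: "3 \<Rightarrow> poly3" where
  "coord i = Poly_Mapping.single (Poly_Mapping.single i 1) 1"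

lemma monom_degree_single: "monom_degree (Poly_Mapping.single i n) = n"
  by (simp add: monom_degree_def lookup_single when_def)

lemma coord_forms: "coord i \<in> forms 1"
  by (simp add: coord_def forms_def monom_degree_single)

lemma eval3_coord: "eval3 (coord i) v = v $ i"
proof -
  have "(v $ j) ^ (1 when i = j) = (if j = i then v $ i else 1)" for j
    by (simp add: when_def)
  then show ?thesis
    by (simp add: coord_def eval3_single monom_value_def lookup_single)
qed

text \<open>A monomial of positive degree is divisible by some coordinate, and such sums are closed
  under addition.\<close>

lemma forms_Suc_decompose:
  assumes "f \<in> forms (Suc n)"
  obtains f1 f2 f3 where "f1 \<in> forms n" "f2 \<in> forms n" "f3 \<in> forms n"
    "f = coord 1 * f1 + coord 2 * f2 + coord 3 * f3"
proof -
  define S where "S = {coord 1 * f1 + coord 2 * f2 + coord 3 * f3 | f1 f2 f3.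
      f1 \<in> forms n \<and> f2 \<in> forms n \<and> f3 \<in> forms n}"
  have S_add: "a + b \<in> S" if ab: "a \<in> S" "b \<in> S" for a b
  proof -
    obtain a1 a2 a3 b1 b2 b3 where h: "a1 \<in> forms n" "a2 \<in> forms n" "a3 \<in> forms n"
      "b1 \<in> forms n" "b2 \<in> forms n" "b3 \<in> forms n"
      "a = coord 1 * a1 + coord 2 * a2 + coord 3 * a3" "b = coord 1 * b1 + coord 2 * b2 + coord 3 * b3"
      using ab unfolding S_def by blast
    have "a + b = coord 1 * (a1 + b1) + coord 2 * (a2 + b2) + coord 3 * (a3 + b3)"
      unfolding h by (simp add: algebra_simps)
    then show ?thesis unfolding S_def using h(1-6) forms_add by blast
  qed
  have S0: "0 \<in> S"
    unfolding S_def using forms_zero by (intro CollectI exI[of _ 0]) auto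
  have coord_S: "coord i * g \<in> S" if "g \<in> forms n" for i g
  proof -
    have "coord 1 * g = coord 1 * g + coord 2 * 0 + coord 3 * 0" "coord 2 * g = coord 1 * 0 + coord 2 * g + coord 3 * 0"
      "coord 3 * g = coord 1 * 0 + coord 2 * 0 + coord 3 * g" by simp_all
    then have "coord 1 * g \<in> S" "coord 2 * g \<in> S" "coord 3 * g \<in> S"
      unfolding S_def using that forms_zero by blast+
    then show ?thesis using exhaust_3[of i] by auto
  qed
  have single: "Poly_Mapping.single m c \<in> S" if m: "monom_degree m = Suc n" for m c
  proof -
    obtain i where i: "Poly_Mapping.lookup m i \<noteq> 0"
      using m unfolding monom_degree_def by (metis nat.distinct(1) sum.neutral)
    define m' where "m' = m - Poly_Mapping.single i 1"
    have mm: "m = Poly_Mapping.single i 1 + m'"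
      using i by (intro poly_mapping_eqI) (auto simp: m'_def lookup_add lookup_minus lookup_single when_def)
    then have "Poly_Mapping.single m c = coord i * Poly_Mapping.single m' c"
      by (simp add: coord_def mult_single)
    moreover have "monom_degree m' = n"
      using m monom_degree_add[of "Poly_Mapping.single i 1" m'] unfolding mm[symmetric] monom_degree_single by simp
    then have "Poly_Mapping.single m' c \<in> forms n" by (simp add: forms_def)
    ultimately show ?thesis using coord_S by simp
  qed
  have sum_S: "sum h A \<in> S" if "\<And>m. m \<in> A \<Longrightarrow> h m \<in> S" for h and A :: "monom3 set"
    using that by (induction A rule: infinite_finite_induct) (auto simp: S0 S_add)
  have "f \<in> S"
    by (subst poly_mapping_eq_sum_single) (intro sum_S single, use assms in \<open>auto simp: forms_def\<close>)
  then show thesis unfolding S_def using that by blast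
qed


section \<open>Dimensions\<close>

lemma finite_monomials: "finite {m :: monom3. monom_degree m = d}"
proof (rule finite_imageD)
  let ?h = "\<lambda>m :: monom3. (Poly_Mapping.lookup m 1, Poly_Mapping.lookup m 2, Poly_Mapping.lookup m 3)"
  have "?h m \<in> {..d} \<times> {..d} \<times> {..d}" if "monom_degree m = d" for m
    using that by (auto simp: monom_degree_def sum_3)
  then have "?h ` {m. monom_degree m = d} \<subseteq> {..d} \<times> {..d} \<times> {..d}" by blast
  then show "finite (?h ` {m. monom_degree m = d})"
    by (rule finite_subset) simp
  show "inj_on ?h {m. monom_degree m = d}"
  proof (rule inj_onI)
    fix m m' assume "?h m = ?h m'"
    then have "Poly_Mapping.lookup m i = Poly_Mapping.lookup m' i" for i
      using exhaust_3[of i] by auto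
    then show "m = m'" by (rule poly_mapping_eqI)
  qed
qed

text \<open>The finitely many monomials of degree \<open>d\<close> span
  \<open>forms d\<close>.\<close>

lemma independent_forms_finite:
  assumes "poly3_vs.independent B" "B \<subseteq> forms d"
  shows "finite B"
proof -
  let ?M = "(\<lambda>m. Poly_Mapping.single m (1::complex)) ` {m. monom_degree m = d}"
  have "forms d \<subseteq> poly3_vs.span ?M"
  proof
    fix f assume f: "f \<in> forms d"
    have "Poly_Mapping.single m c \<in> poly3_vs.span ?M" if "m \<in> Poly_Mapping.keys f" for m c
    proof -
      have "Poly_Mapping.single m c = const_scale c (Poly_Mapping.single m 1)"
        by (simp add: const_scale_def mult_single)
      moreover have "Poly_Mapping.single m 1 \<in> ?M" using that f by (auto simp: forms_def)
      ultimately show ?thesis using poly3_vs.span_base poly3_vs.span_scale by metis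
    qed
    then show "f \<in> poly3_vs.span ?M"
      by (subst poly_mapping_eq_sum_single) (intro poly3_vs.span_sum)
  qed
  then show ?thesis
    using poly3_vs.independent_span_bound[of ?M B] assms finite_monomials by auto
qed

lemma graded_dim_eq_card:
  assumes "poly3_vs.independent B" "B \<subseteq> I \<inter> forms d" "I \<inter> forms d \<subseteq> poly3_vs.span B"
  shows "graded_dim I d = card B"
  unfolding graded_dim_def using poly3_vs.dim_unique[OF assms(2,3,1)] by simp

lemma graded_dim_pos:
  assumes "graded_dim I d > 0"
  obtains f where "f \<in> I" "f \<in> forms d" "f \<noteq> 0"
proof -
  obtain B where B: "B \<subseteq> I \<inter> forms d" "poly3_vs.independent B" "I \<inter> forms d \<subseteq> poly3_vs.span B"
    "card B = poly3_vs.dim (I \<inter> forms d)"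
    by (rule poly3_vs.basis_exists) (rule that)
  then have "card B \<noteq> 0" using assms by (simp add: graded_dim_def)
  then obtain f where "f \<in> B" by fastforce
  moreover have "f \<noteq> 0" using poly3_vs.dependent_zero B(2) \<open>f \<in> B\<close> by blast
  ultimately show thesis using that B(1) by blast
qed

section \<open>Bases of graded quotients\<close>

lemma residue_class_eq_iff:
  assumes "poly3_vs.subspace J"
  shows "residue_class J f = residue_class J g \<longleftrightarrow> f - g \<in> J"
proof
  assume "residue_class J f = residue_class J g"
  moreover have "f \<in> residue_class J f"
    using poly3_vs.subspace_0[OF assms] by (simp add: residue_class_def)
  ultimately show "f - g \<in> J" by (simp add: residue_class_def)
next
  assume J: "f - g \<in> J"
  have "h - f \<in> J \<longleftrightarrow> h - g \<in> J" for h
  proof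
    assume "h - f \<in> J"
    from poly3_vs.subspace_add[OF assms this J] show "h - g \<in> J" by simp
  next
    assume "h - g \<in> J"
    from poly3_vs.subspace_diff[OF assms this J] show "h - f \<in> J" by simp
  qed
  then show "residue_class J f = residue_class J g" by (simp add: residue_class_def)
qed

lemma quotient_basis_sum_forms:
  assumes "quotient_basis J d n b"
  shows "(\<Sum>i<n. const_scale (c i) (b i)) \<in> forms d"
  using assms unfolding quotient_basis_def
  by (intro poly3_vs.subspace_sum[OF forms_subspace] forms_const_scale) auto

lemma quotient_basis_span:
  assumes J: "poly3_vs.subspace J" and b: "quotient_basis J d n b"
    and G: "J \<inter> forms d \<subseteq> poly3_vs.span G"
  shows "forms d \<subseteq> poly3_vs.span (b ` {..<n} \<union> G)"
proof
  fix f assume f: "f \<in> forms d"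
  then obtain c where "residue_class J f = residue_class J (\<Sum>i<n. const_scale (c i) (b i))"
    using b unfolding quotient_basis_def by blast
  then have "f - (\<Sum>i<n. const_scale (c i) (b i)) \<in> J \<inter> forms d"
    using quotient_basis_sum_forms[OF b] f forms_diff by (simp add: residue_class_eq_iff[OF J])
  then have "f - (\<Sum>i<n. const_scale (c i) (b i)) \<in> poly3_vs.span (b ` {..<n} \<union> G)"
    using G poly3_vs.span_mono[of G "b ` {..<n} \<union> G"] by blast
  moreover have "(\<Sum>i<n. const_scale (c i) (b i)) \<in> poly3_vs.span (b ` {..<n} \<union> G)"
    by (intro poly3_vs.span_sum poly3_vs.span_scale poly3_vs.span_base) auto
  ultimately show "f \<in> poly3_vs.span (b ` {..<n} \<union> G)"
    using poly3_vs.span_add by fastforce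
qed

lemma ex1_implies_unique: "\<exists>!x. P x \<Longrightarrow> P a \<Longrightarrow> P b \<Longrightarrow> a = b"
  by blast

text \<open>The class of zero has a unique coefficient vector. Coefficients are cut off at
  \<open>n\<close> to meet the normalisation in \<open>quotient_basis\<close>.\<close>

lemma quotient_basis_coeff_zero:
  assumes J: "poly3_vs.subspace J" and b: "quotient_basis J d n b"
    and sum: "(\<Sum>i<n. const_scale (c i) (b i)) \<in> J" and i: "i < n"
  shows "c i = 0"
proof -
  let ?Q = "\<lambda>c. (\<forall>i\<ge>n. c i = 0) \<and> residue_class J 0 = residue_class J (\<Sum>i<n. const_scale (c i) (b i))"
  have ex1: "\<exists>!c. ?Q c"
    using b[unfolded quotient_basis_def, THEN conjunct2] forms_zero[of d] by (rule bspec)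
  have minus: "0 - x \<in> J \<longleftrightarrow> x \<in> J" for x
    using poly3_vs.subspace_neg[OF J, of x] poly3_vs.subspace_neg[OF J, of "- x"] by auto
  have "?Q (\<lambda>i. if i < n then c i else 0)"
    unfolding residue_class_eq_iff[OF J] minus using sum by (simp cong: sum.cong_simp)
  moreover have "?Q (\<lambda>i. 0)"
    unfolding residue_class_eq_iff[OF J] using poly3_vs.subspace_0[OF J] by simp
  ultimately have "(\<lambda>i. if i < n then c i else 0) = (\<lambda>i. 0)"
    by (rule ex1_implies_unique[OF ex1])
  from fun_cong[OF this, of i] show ?thesis using i by simp
qed

text \<open>Let \<open>G\<close> be a basis of the degree \<open>d\<close> part of \<open>J\<close>.
  The family \<open>b\<close> together with \<open>G\<close> is independent, while \<open>b'\<close>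
  together with \<open>G\<close> spans \<open>forms d\<close>; comparing cardinalities cancels
  \<open>card G\<close>.\<close>

lemma quotient_basis_le:
  assumes J: "poly3_vs.subspace J" and b: "quotient_basis J d n b" and b': "quotient_basis J d n' b'"
  shows "n \<le> n'"
proof -
  obtain G where G: "G \<subseteq> J \<inter> forms d" "poly3_vs.independent G" "J \<inter> forms d \<subseteq> poly3_vs.span G"
    "card G = poly3_vs.dim (J \<inter> forms d)"
    by (rule poly3_vs.basis_exists) (rule that)
  have finG: "finite G" using independent_forms_finite[OF G(2)] G(1) by blast
  note zero = quotient_basis_coeff_zero[OF J b]
  have b_eq: "(\<Sum>l<n. const_scale (if l = i then x else 0) (b l)) = const_scale x (b i)" if "i < n" for i x
  proof -
    have "(\<Sum>l<n. const_scale (if l = i then x else 0) (b l)) = (\<Sum>l<n. if l = i then const_scale x (b i) else 0)"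
      by (intro sum.cong) auto
    then show ?thesis using that by simp
  qed
  have notJ: "b i \<notin> J" if i: "i < n" for i
    using zero[of "\<lambda>l. if l = i then 1 else 0" i] b_eq[OF i, of 1] i by auto
  have inj: "inj_on b {..<n}"
  proof (rule inj_onI, rule ccontr)
    fix i j assume ij: "i \<in> {..<n}" "j \<in> {..<n}" "b i = b j" "i \<noteq> j"
    let ?c = "\<lambda>l. (if l = i then 1 else 0) + (if l = j then - 1 else 0)"
    have "(\<Sum>l<n. const_scale (?c l) (b l)) = const_scale 1 (b i) + const_scale (- 1) (b j)"
      using b_eq[of i 1] b_eq[of j "- 1"] ij by (simp only: poly3_vs.scale_left_distrib sum.distrib lessThan_iff)
    also have "\<dots> = 0" using ij by simp
    finally have "(\<Sum>l<n. const_scale (?c l) (b l)) \<in> J" using poly3_vs.subspace_0[OF J] by simp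
    from zero[OF this, of i] ij show False by simp
  qed
  have disj: "b ` {..<n} \<inter> G = {}" using notJ G(1) by blast
  have indep: "poly3_vs.independent (b ` {..<n} \<union> G)"
  proof
    assume "poly3_vs.dependent (b ` {..<n} \<union> G)"
    then obtain u where u: "\<exists>v\<in>b ` {..<n} \<union> G. u v \<noteq> 0"
      and sum: "(\<Sum>v\<in>b ` {..<n} \<union> G. const_scale (u v) v) = 0"
      using poly3_vs.dependent_finite[of "b ` {..<n} \<union> G"] finG by auto
    have split: "(\<Sum>i<n. const_scale (u (b i)) (b i)) + (\<Sum>v\<in>G. const_scale (u v) v) = 0"
      using sum finG disj by (simp add: sum.union_disjoint sum.reindex[OF inj])
    have "(\<Sum>v\<in>G. const_scale (u v) v) \<in> J"
      using G(1) by (intro poly3_vs.subspace_sum[OF J] poly3_vs.subspace_scale[OF J]) auto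
    moreover have "(\<Sum>i<n. const_scale (u (b i)) (b i)) = - (\<Sum>v\<in>G. const_scale (u v) v)"
      using split unfolding eq_neg_iff_add_eq_0 .
    ultimately have "(\<Sum>i<n. const_scale (u (b i)) (b i)) \<in> J"
      using poly3_vs.subspace_neg[OF J] by simp
    then have ub: "u (b i) = 0" if "i < n" for i
      using that by (rule zero[of "\<lambda>i. u (b i)"])
    then have "(\<Sum>v\<in>G. const_scale (u v) v) = 0"
      using split by simp
    then have "\<forall>v\<in>G. u v = 0"
      using G(2) poly3_vs.dependent_finite[OF finG] by blast
    with ub u show False by auto
  qed
  have "b ` {..<n} \<union> G \<subseteq> forms d"
    using b G(1) unfolding quotient_basis_def by auto
  then have "b ` {..<n} \<union> G \<subseteq> poly3_vs.span (b' ` {..<n'} \<union> G)"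
    using quotient_basis_span[OF J b' G(3)] by blast
  then have "card (b ` {..<n} \<union> G) \<le> card (b' ` {..<n'} \<union> G)"
    using poly3_vs.independent_span_bound[OF _ indep, of "b' ` {..<n'} \<union> G"] finG by simp
  also have "\<dots> \<le> n' + card G"
    using card_Un_le[of "b' ` {..<n'}" G] card_image_le[of "{..<n'}" b'] by simp
  finally show ?thesis
    using finG disj by (simp add: card_Un_disjoint card_image[OF inj])
qed

text \<open>Two quotient bases have equal length, so the definite description denotes that
  length.\<close>

lemma quotient_graded_dim_eqI:
  assumes "poly3_vs.subspace J" "quotient_basis J d n b"
  shows "quotient_graded_dim J d = n"
  unfolding quotient_graded_dim_def
proof (rule the_equality)
  show "\<exists>b. quotient_basis J d n b" using assms(2) by blast
  fix n' assume "\<exists>b. quotient_basis J d n' b"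
  then obtain b' where b': "quotient_basis J d n' b'" by blast
  show "n' = n"
    using quotient_basis_le[OF assms(1) b' assms(2)] quotient_basis_le[OF assms b'] by (rule le_antisym)
qed

text \<open>The second isomorphism theorem in degree \<open>d\<close>: if \<open>A\<close> and
  \<open>J\<close> together give all forms, a basis \<open>E\<close> of the intersection extends to
  a basis \<open>B\<close> of \<open>A\<close>, and \<open>B - E\<close> represents a basis of the
  quotient. Such a sum rules out an unexpected curve.\<close>

lemma graded_dim_Int_if_sum:
  assumes A: "poly3_vs.subspace A" and J: "poly3_vs.subspace J"
    and sum: "\<And>f. f \<in> forms d \<Longrightarrow> \<exists>a\<in>A \<inter> forms d. f - a \<in> J"
  shows "graded_dim A d = graded_dim (A \<inter> J) d + quotient_graded_dim J d"
proof -
  obtain E where E: "E \<subseteq> (A \<inter> J) \<inter> forms d" "poly3_vs.independent E" "(A \<inter> J) \<inter> forms d \<subseteq> poly3_vs.span E"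
    "card E = poly3_vs.dim ((A \<inter> J) \<inter> forms d)"
    by (rule poly3_vs.basis_exists) (rule that)
  have "E \<subseteq> A \<inter> forms d" using E(1) by blast
  obtain B where B: "E \<subseteq> B" "B \<subseteq> A \<inter> forms d" "poly3_vs.independent B" "A \<inter> forms d \<subseteq> poly3_vs.span B"
    by (rule poly3_vs.maximal_independent_subset_extend[OF \<open>E \<subseteq> A \<inter> forms d\<close> E(2)]) (rule that)
  have finB: "finite B" using independent_forms_finite[OF B(3)] B(2) by blast
  have finE: "finite E" using B(1) finB finite_subset by blast
  define n where "n = card (B - E)"
  obtain b where b: "bij_betw b {..<n} (B - E)"
    using ex_bij_betw_nat_finite[of "B - E"] finB unfolding n_def atLeast0LessThan by auto
  have b_in: "b i \<in> B - E" if "i < n" for i using b that by (auto simp: bij_betw_def)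
  have sum_b: "(\<Sum>i<n. const_scale (u (b i)) (b i)) = (\<Sum>v\<in>B - E. const_scale (u v) v)" for u
    using sum.reindex_bij_betw[OF b, of "\<lambda>v. const_scale (u v) v"] .
  have inj: "inj_on b {..<n}" using b by (simp add: bij_betw_def)
  have "quotient_basis J d n b"
    unfolding quotient_basis_def
  proof (intro conjI allI impI ballI)
    show "b i \<in> forms d" if "i < n" for i using b_in[OF that] B(2) by blast
  next
    fix f assume "f \<in> forms d"
    then obtain a where a: "a \<in> A \<inter> forms d" "f - a \<in> J" using sum by blast
    then have "a \<in> poly3_vs.span B" using B(4) by blast
    then obtain u where u: "a = (\<Sum>v\<in>B. const_scale (u v) v)"
      using poly3_vs.span_finite[OF finB] by auto
    define c where "c i = (if i < n then u (b i) else 0)" for i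
    have "a = (\<Sum>v\<in>B - E. const_scale (u v) v) + (\<Sum>v\<in>E. const_scale (u v) v)"
      unfolding u by (rule sum.subset_diff[OF B(1) finB])
    moreover have "(\<Sum>i<n. const_scale (c i) (b i)) = (\<Sum>v\<in>B - E. const_scale (u v) v)"
      unfolding sum_b[symmetric] by (intro sum.cong) (auto simp: c_def)
    moreover have "(\<Sum>v\<in>E. const_scale (u v) v) \<in> J"
      using E(1) by (intro poly3_vs.subspace_sum[OF J] poly3_vs.subspace_scale[OF J]) auto
    ultimately have "a - (\<Sum>i<n. const_scale (c i) (b i)) \<in> J" by simp
    from poly3_vs.subspace_add[OF J a(2) this]
    have fc: "f - (\<Sum>i<n. const_scale (c i) (b i)) \<in> J" by simp
    show "\<exists>!c. (\<forall>i\<ge>n. c i = 0) \<and> residue_class J f = residue_class J (\<Sum>i<n. const_scale (c i) (b i))"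
    proof (rule ex1I[of _ c], unfold residue_class_eq_iff[OF J])
      show "(\<forall>i\<ge>n. c i = 0) \<and> f - (\<Sum>i<n. const_scale (c i) (b i)) \<in> J"
        using fc by (simp add: c_def)
    next
      fix c' assume c': "(\<forall>i\<ge>n. c' i = 0) \<and> f - (\<Sum>i<n. const_scale (c' i) (b i)) \<in> J"
      define e where "e i = c' i - c i" for i
      define w where "w = (\<Sum>i<n. const_scale (e i) (b i))"
      have "w = (\<Sum>i<n. const_scale (c' i) (b i)) - (\<Sum>i<n. const_scale (c i) (b i))"
        by (simp add: w_def e_def poly3_vs.scale_left_diff_distrib sum_subtractf)
      then have w: "w = (f - (\<Sum>i<n. const_scale (c i) (b i))) - (f - (\<Sum>i<n. const_scale (c' i) (b i)))"
        by simp
      have "w \<in> J" unfolding w using c' by (intro poly3_vs.subspace_diff[OF J fc]) blast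
      moreover have "w \<in> A"
        unfolding w_def using b_in B(2)
        by (intro poly3_vs.subspace_sum[OF A] poly3_vs.subspace_scale[OF A]) auto
      moreover have "w \<in> forms d"
        unfolding w_def using b_in B(2)
        by (intro poly3_vs.subspace_sum[OF forms_subspace] forms_const_scale) auto
      ultimately have "w \<in> poly3_vs.span E" using E(3) by blast
      then obtain x where x: "w = (\<Sum>v\<in>E. const_scale (x v) v)"
        using poly3_vs.span_finite[OF finE] by auto
      \<comment> \<open>The element \<open>w\<close> has one expansion in \<open>B - E\<close> and
        another in \<open>E\<close>; their difference is a relation on the independent set
        \<open>B\<close>.\<close>
      define y where "y v = (if v \<in> E then - x v else e (the_inv_into {..<n} b v))" for v
      have "(\<Sum>v\<in>B. const_scale (y v) v) = (\<Sum>v\<in>B - E. const_scale (y v) v) + (\<Sum>v\<in>E. const_scale (y v) v)"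
        by (rule sum.subset_diff[OF B(1) finB])
      also have "(\<Sum>v\<in>E. const_scale (y v) v) = - w"
        unfolding x by (simp add: y_def sum_negf)
      also have "(\<Sum>v\<in>B - E. const_scale (y v) v) = w"
        unfolding sum_b[symmetric] w_def
      proof (intro sum.cong refl)
        fix i assume "i \<in> {..<n}"
        then show "const_scale (y (b i)) (b i) = const_scale (e i) (b i)"
          using b_in[of i] the_inv_into_f_f[OF inj] by (simp add: y_def)
      qed
      finally have "(\<Sum>v\<in>B. const_scale (y v) v) = 0" by simp
      then have y0: "y v = 0" if "v \<in> B" for v
        using B(3) poly3_vs.dependent_finite[OF finB] that by blast
      have "e i = 0" if "i < n" for i
        using y0[of "b i"] b_in[OF that] that the_inv_into_f_f[OF inj] by (simp add: y_def)
      moreover have "e i = 0" if "\<not> i < n" for i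
        using c' that by (simp add: e_def c_def)
      ultimately have "e i = 0" for i by blast
      then show "c' = c" by (auto simp: e_def)
    qed
  qed
  from quotient_graded_dim_eqI[OF J this]
  have "quotient_graded_dim J d = card B - card E"
    using B(1) finE by (simp add: n_def card_Diff_subset)
  moreover have "card E \<le> card B" using B(1) finB by (rule card_mono[rotated])
  ultimately show ?thesis
    using graded_dim_eq_card[OF E(2,1,3)] graded_dim_eq_card[OF B(3,2,4)] by simp
qed


section \<open>Powers of the ideal of a point\<close>

definition vertex :: "complex \<times> complex \<Rightarrow> complex ^ 3" where
  "vertex q = vector [fst q, snd q, 1]"

definition form_u :: "complex \<times> complex \<Rightarrow> poly3" where
  "form_u q = coord 1 - const_scale (fst q) (coord 3)"

definition form_v :: "complex \<times> complex \<Rightarrow> poly3" where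
  "form_v q = coord 2 - const_scale (snd q) (coord 3)"

lemma eval3_form_u: "eval3 (form_u q) p = proj_u q p"
  and eval3_form_v: "eval3 (form_v q) p = proj_v q p"
  by (simp_all add: form_u_def form_v_def eval3_diff eval3_const_scale eval3_coord proj_u_def proj_v_def)

lemma form_u_forms: "form_u q \<in> forms 1" and form_v_forms: "form_v q \<in> forms 1"
  unfolding form_u_def form_v_def by (intro forms_diff forms_const_scale coord_forms)+

lemma proj_vertex_line:
  "proj_u q (vertex q + t *s p) = t * proj_u q p" "proj_v q (vertex q + t *s p) = t * proj_v q p"
  by (simp_all add: proj_u_def proj_v_def vertex_def algebra_simps)

text \<open>The elements of the ring obtained from binary forms by substituting
  \<open>form_u q\<close> and \<open>form_v q\<close>.\<close>

primrec vertex_forms :: "complex \<times> complex \<Rightarrow> nat \<Rightarrow> poly3 set" where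
  "vertex_forms q 0 = range (Poly_Mapping.single 0)"
| "vertex_forms q (Suc n) = {form_u q * f + form_v q * g | f g. f \<in> vertex_forms q n \<and> g \<in> vertex_forms q n}"

lemma vertex_forms_SucE:
  assumes "f \<in> vertex_forms q (Suc n)"
  obtains g h where "g \<in> vertex_forms q n" "h \<in> vertex_forms q n" "f = form_u q * g + form_v q * h"
  using assms by auto

lemma vertex_forms_SucI:
  "g \<in> vertex_forms q n \<Longrightarrow> h \<in> vertex_forms q n \<Longrightarrow> form_u q * g + form_v q * h \<in> vertex_forms q (Suc n)"
  by auto

lemma vertex_forms_forms: "f \<in> vertex_forms q n \<Longrightarrow> f \<in> forms n"
proof (induction n arbitrary: f)
  case 0
  then show ?case by (auto simp: forms_const)
next
  case (Suc n)
  obtain g h where gh: "g \<in> vertex_forms q n" "h \<in> vertex_forms q n" "f = form_u q * g + form_v q * h"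
    by (rule vertex_forms_SucE[OF Suc.prems]) (rule that)
  have "form_u q * g \<in> forms (1 + n)" "form_v q * h \<in> forms (1 + n)"
    using gh(1,2) Suc.IH by (intro forms_mult form_u_forms form_v_forms; simp)+
  then show ?case unfolding gh(3) using forms_add by simp
qed

lemma vertex_forms_eval:
  "f \<in> vertex_forms q n \<Longrightarrow> \<exists>F\<in>binary_forms n. \<forall>p. eval3 f p = F (proj_u q p) (proj_v q p)"
proof (induction n arbitrary: f)
  case 0
  then obtain c where "f = Poly_Mapping.single 0 c" by auto
  then have "eval3 f p = c" for p by (simp add: eval3_single monom_value_def)
  then show ?case by (intro bexI[of _ "\<lambda>u v. c"]) auto
next
  case (Suc n)
  obtain g h where gh: "g \<in> vertex_forms q n" "h \<in> vertex_forms q n" "f = form_u q * g + form_v q * h"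
    by (rule vertex_forms_SucE[OF Suc.prems]) (rule that)
  obtain G H where GH: "G \<in> binary_forms n" "H \<in> binary_forms n"
    "\<forall>p. eval3 g p = G (proj_u q p) (proj_v q p)" "\<forall>p. eval3 h p = H (proj_u q p) (proj_v q p)"
    using Suc.IH[OF gh(1)] Suc.IH[OF gh(2)] by blast
  have "(\<lambda>u v. u * G u v + v * H u v) \<in> binary_forms (Suc n)"
    by (rule binary_forms_SucI[OF GH(1,2)]) simp
  moreover have "eval3 f p = proj_u q p * G (proj_u q p) (proj_v q p) + proj_v q p * H (proj_u q p) (proj_v q p)" for p
    using GH(3,4) by (simp add: gh(3) eval3_add eval3_mult eval3_form_u eval3_form_v)
  ultimately show ?case by (intro bexI[of _ "\<lambda>u v. u * G u v + v * H u v"] allI)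
qed

lemma vertex_forms_of_binary:
  "F \<in> binary_forms n \<Longrightarrow> \<exists>f\<in>vertex_forms q n. \<forall>p. eval3 f p = F (proj_u q p) (proj_v q p)"
proof (induction n arbitrary: F)
  case 0
  then obtain c where c: "F = (\<lambda>u v. c)" by auto
  have "eval3 (Poly_Mapping.single 0 c) p = c" for p by (simp add: eval3_single monom_value_def)
  then show ?case unfolding c by (intro bexI[of _ "Poly_Mapping.single 0 c"]) auto
next
  case (Suc n)
  obtain G H where GH: "G \<in> binary_forms n" "H \<in> binary_forms n" "\<And>u v. F u v = u * G u v + v * H u v"
    by (rule binary_forms_SucE[OF Suc.prems]) (rule that)
  obtain g h where gh: "g \<in> vertex_forms q n" "h \<in> vertex_forms q n"
    "\<forall>p. eval3 g p = G (proj_u q p) (proj_v q p)" "\<forall>p. eval3 h p = H (proj_u q p) (proj_v q p)"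
    using Suc.IH[OF GH(1)] Suc.IH[OF GH(2)] by blast
  have "eval3 (form_u q * g + form_v q * h) p = F (proj_u q p) (proj_v q p)" for p
    using gh(3,4) by (simp add: GH(3) eval3_add eval3_mult eval3_form_u eval3_form_v)
  then show ?case using vertex_forms_SucI[OF gh(1,2)] by blast
qed

section \<open>Powers of an ideal and order of vanishing\<close>

lemma ideal_power_subspace: "poly3_ideal.subspace (ideal_power I n)"
proof (cases n)
  case 0
  then show ?thesis using poly3_ideal.subspace_UNIV by simp
next
  case (Suc k)
  then show ?thesis using poly3_ideal.subspace_span by (simp add: ideal_prod_def)
qed

lemma ideal_power_vs_subspace: "poly3_vs.subspace (ideal_power I n)"
  using ideal_power_subspace[of I n]
  unfolding poly3_ideal.subspace_def poly3_vs.subspace_def const_scale_def by blast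

lemma ideal_power_SucI: "f \<in> I \<Longrightarrow> g \<in> ideal_power I n \<Longrightarrow> f * g \<in> ideal_power I (Suc n)"
  unfolding ideal_power.simps ideal_prod_def by (intro poly3_ideal.span_base) blast

lemma vertex_forms_ideal_power:
  assumes I: "form_u q \<in> I" "form_v q \<in> I"
  shows "f \<in> vertex_forms q n \<Longrightarrow> f \<in> ideal_power I n"
proof (induction n arbitrary: f)
  case (Suc n)
  obtain g h where gh: "g \<in> vertex_forms q n" "h \<in> vertex_forms q n" "f = form_u q * g + form_v q * h"
    by (rule vertex_forms_SucE[OF Suc.prems]) (rule that)
  show ?case unfolding gh(3)
    by (intro poly3_ideal.subspace_add[OF ideal_power_subspace] ideal_power_SucI I Suc.IH gh)
qed simp

lemma eval3_poly_on_line: "\<exists>P. \<forall>t. eval3 f (a + t *s b) = poly P t"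
proof -
  have "monom_degree m \<le> (\<Sum>m\<in>Poly_Mapping.keys f. monom_degree m)" if "m \<in> Poly_Mapping.keys f" for m
    using that by (intro member_le_sum) auto
  from eval3_on_line[OF this] show ?thesis by metis
qed

text \<open>On each line through \<open>w\<close> an element of the \<open>n\<close>-th power
  vanishes to order \<open>n\<close> at \<open>w\<close>. For the induction, the polynomials with
  order at least \<open>Suc n\<close> form an ideal that contains the generating products.\<close>

lemma ideal_power_order:
  assumes I: "\<And>f. f \<in> I \<Longrightarrow> eval3 f w = 0"
  shows "f \<in> ideal_power I n \<Longrightarrow> \<exists>G. \<forall>t. eval3 f (w + t *s p) = t ^ n * poly G t"
proof (induction n arbitrary: f)
  case 0
  then show ?case using eval3_poly_on_line by simp
next
  case (Suc n)
  let ?S = "{f. \<exists>G. \<forall>t. eval3 f (w + t *s p) = t ^ Suc n * poly G t}"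
  have S0: "0 \<in> ?S" by (auto intro!: exI[of _ 0])
  have S_add: "x + y \<in> ?S" if xy: "x \<in> ?S" "y \<in> ?S" for x y
  proof -
    obtain X Y where "\<forall>t. eval3 x (w + t *s p) = t ^ Suc n * poly X t" "\<forall>t. eval3 y (w + t *s p) = t ^ Suc n * poly Y t"
      using xy by blast
    then have "\<forall>t. eval3 (x + y) (w + t *s p) = t ^ Suc n * poly (X + Y) t"
      by (simp add: eval3_add distrib_left)
    then show ?thesis by blast
  qed
  have S_mult: "c * x \<in> ?S" if x: "x \<in> ?S" for c x
  proof -
    obtain X where X: "\<forall>t. eval3 x (w + t *s p) = t ^ Suc n * poly X t" using x by blast
    obtain C where C: "\<forall>t. eval3 c (w + t *s p) = poly C t" using eval3_poly_on_line by blast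
    have "\<forall>t. eval3 (c * x) (w + t *s p) = t ^ Suc n * poly (C * X) t"
      using X C by (simp add: eval3_mult mult_ac)
    then show ?thesis by blast
  qed
  have S: "poly3_ideal.subspace ?S"
    using S0 S_add S_mult by (rule poly3_ideal.subspaceI)
  have base: "{f * g | f g. f \<in> I \<and> g \<in> ideal_power I n} \<subseteq> ?S"
  proof clarify
    fix f g assume fg: "f \<in> I" "g \<in> ideal_power I n"
    obtain G where G: "\<forall>t. eval3 g (w + t *s p) = t ^ n * poly G t" using Suc.IH[OF fg(2)] by blast
    obtain C where C: "\<forall>t. eval3 f (w + t *s p) = poly C t" using eval3_poly_on_line by blast
    have "poly C 0 = 0" using C[rule_format, of 0] I[OF fg(1)] by simp
    then obtain D where D: "C = [:- 0, 1:] * D" unfolding poly_eq_0_iff_dvd by (elim dvdE)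
    have "eval3 (f * g) (w + t *s p) = t ^ Suc n * poly (D * G) t" for t
      unfolding eval3_mult C[rule_format] G[rule_format] D by (simp add: mult_ac)
    then show "\<exists>G. \<forall>t. eval3 (f * g) (w + t *s p) = t ^ Suc n * poly G t" by blast
  qed
  have "ideal_power I (Suc n) \<subseteq> ?S"
    unfolding ideal_power.simps ideal_prod_def by (rule poly3_ideal.span_minimal[OF base S])
  then show ?case using Suc.prems by blast
qed

text \<open>Together with \<open>u\<close> and \<open>v\<close>, a linear form \<open>L\<close> not vanishing at the vertex gives linear coordinates.\<close>

lemma forms_vertex_decompose:
  assumes L: "L = const_scale t (coord 3) + const_scale s1 (form_u q) + const_scale s2 (form_v q)" and t: "t \<noteq> 0"
  shows "f \<in> forms n \<Longrightarrow> \<exists>f0\<in>vertex_forms q n. \<exists>g\<in>forms (n - 1). (n = 0 \<longrightarrow> g = 0) \<and> f = f0 + L * g"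
proof (induction n arbitrary: f)
  case 0
  have "f \<in> vertex_forms q 0"
  proof -
    have "m = 0" if "m \<in> Poly_Mapping.keys f" for m
    proof (rule poly_mapping_eqI)
      fix i
      have "monom_degree m = 0" using 0 that by (simp add: forms_def)
      then show "Poly_Mapping.lookup m i = Poly_Mapping.lookup 0 i" by (simp add: monom_degree_def)
    qed
    then have "f = Poly_Mapping.single 0 (Poly_Mapping.lookup f 0)"
      by (intro poly_mapping_eqI) (auto simp: lookup_single when_def in_keys_iff)
    then show ?thesis by auto
  qed
  then show ?case using forms_zero[of 0] by (intro bexI[of _ f] bexI[of _ 0]) auto
next
  case (Suc n)
  let ?C = "Poly_Mapping.single (0 :: monom3) :: complex \<Rightarrow> poly3"
  have C_mult: "?C a * (?C b * x) = ?C (a * b) * x" for a b x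
    by (simp add: mult_single flip: mult.assoc)
  \<comment> \<open>As \<open>t\<close> is nonzero, \<open>coord 3\<close> can be recovered from
    \<open>L\<close>, \<open>form_u q\<close> and \<open>form_v q\<close>; the other two coordinates
    follow.\<close>
  have c3: "coord 3 = ?C (- s1 / t) * form_u q + ?C (- s2 / t) * form_v q + ?C (1 / t) * L"
  proof -
    have "?C (1 / t) * L = coord 3 + ?C (s1 / t) * form_u q + ?C (s2 / t) * form_v q"
      unfolding L const_scale_def distrib_left C_mult using t by (simp flip: single_one)
    then show ?thesis by (simp add: single_uminus)
  qed
  have "\<exists>a b c. coord i = ?C a * form_u q + ?C b * form_v q + ?C c * L" for i
  proof -
    have "coord 1 = form_u q + ?C (fst q) * coord 3"
      by (simp add: form_u_def const_scale_def)
    also have "\<dots> = ?C (1 + fst q * (- s1 / t)) * form_u q + ?C (fst q * (- s2 / t)) * form_v q + ?C (fst q * (1 / t)) * L"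
      by (subst c3) (simp only: distrib_left distrib_right C_mult single_add single_one mult_1 add.assoc)
    finally have 1: "\<exists>a b c. coord 1 = ?C a * form_u q + ?C b * form_v q + ?C c * L" by blast
    have "coord 2 = form_v q + ?C (snd q) * coord 3"
      by (simp add: form_v_def const_scale_def)
    also have "\<dots> = ?C (snd q * (- s1 / t)) * form_u q + ?C (1 + snd q * (- s2 / t)) * form_v q + ?C (snd q * (1 / t)) * L"
      by (subst c3) (simp only: distrib_left distrib_right C_mult single_add single_one mult_1 add.assoc add.commute add.left_commute)
    finally have 2: "\<exists>a b c. coord 2 = ?C a * form_u q + ?C b * form_v q + ?C c * L" by blast
    show ?thesis using exhaust_3[of i] 1 2 c3 by blast
  qed
  then obtain \<alpha> \<beta> \<gamma> where coord_eq: "\<And>i. coord i = ?C (\<alpha> i) * form_u q + ?C (\<beta> i) * form_v q + ?C (\<gamma> i) * L"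
    by metis
  obtain f1 f2 f3 where f123: "f1 \<in> forms n" "f2 \<in> forms n" "f3 \<in> forms n"
    and f: "f = coord 1 * f1 + coord 2 * f2 + coord 3 * f3"
    by (rule forms_Suc_decompose[OF Suc.prems]) (rule that)
  have comb: "?C a1 * f1 + ?C a2 * f2 + ?C a3 * f3 \<in> forms n" for a1 a2 a3
    using f123 forms_const_scale[unfolded const_scale_def] by (intro forms_add) auto
  define a b c where "a = ?C (\<alpha> 1) * f1 + ?C (\<alpha> 2) * f2 + ?C (\<alpha> 3) * f3"
    and "b = ?C (\<beta> 1) * f1 + ?C (\<beta> 2) * f2 + ?C (\<beta> 3) * f3"
    and "c = ?C (\<gamma> 1) * f1 + ?C (\<gamma> 2) * f2 + ?C (\<gamma> 3) * f3"
  have abc: "a \<in> forms n" "b \<in> forms n" "c \<in> forms n" unfolding a_def b_def c_def by (rule comb)+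
  have f_eq: "f = form_u q * a + form_v q * b + L * c"
    unfolding f coord_eq a_def b_def c_def by (simp only: algebra_simps)
  obtain a0 a' b0 b' where a': "a0 \<in> vertex_forms q n" "a' \<in> forms (n - 1)" "n = 0 \<longrightarrow> a' = 0" "a = a0 + L * a'"
    and b': "b0 \<in> vertex_forms q n" "b' \<in> forms (n - 1)" "n = 0 \<longrightarrow> b' = 0" "b = b0 + L * b'"
    using Suc.IH[OF abc(1)] Suc.IH[OF abc(2)] by blast
  define g where "g = c + (form_u q * a' + form_v q * b')"
  \<comment> \<open>For \<open>n = 0\<close> the set \<open>forms (n - 1)\<close> contains the
    constants; the clause on \<open>n = 0\<close> makes both cofactors zero.\<close>
  have "form_u q * a' + form_v q * b' \<in> forms n"
  proof (cases n)
    case 0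
    then show ?thesis using a'(3) b'(3) forms_zero by simp
  next
    case (Suc m)
    then show ?thesis
      using a'(2) b'(2) forms_mult[OF form_u_forms, of a' m q] forms_mult[OF form_v_forms, of b' m q]
      by (intro forms_add) auto
  qed
  then have "g \<in> forms n" unfolding g_def using abc(3) forms_add by blast
  moreover have "f = (form_u q * a0 + form_v q * b0) + L * g"
    unfolding f_eq a'(4) b'(4) g_def by (simp only: algebra_simps)
  ultimately show ?case
    using vertex_forms_SucI[OF a'(1) b'(1)] by (intro bexI[of _ "form_u q * a0 + form_v q * b0"] bexI[of _ g]) auto
qed

text \<open>Splitting off \<open>z = coord 3\<close> twice gives \<open>f = S + z T + z^2 h\<close>
  with \<open>S\<close> and \<open>T\<close> forms in \<open>u, v\<close>. In the chart
  \<open>z = 1\<close>, multiplicity \<open>Suc m\<close> at the vertex forces \<open>h\<close>, of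
  degree \<open>m\<close>, to vanish.\<close>

lemma has_cone_curve_if_form:
  assumes f: "f \<in> forms (Suc (Suc m))" "f \<noteq> 0" and fI: "f \<in> ideal_power I (Suc m)"
    and I: "\<And>f. f \<in> I \<Longrightarrow> eval3 f (vertex q) = 0"
    and P: "\<And>p. p \<in> P \<Longrightarrow> eval3 f p = 0"
  shows "has_cone_curve (Suc (Suc m)) P q"
proof -
  have L: "coord 3 = const_scale 1 (coord 3) + const_scale 0 (form_u q) + const_scale 0 (form_v q)"
    by simp
  note decompose = forms_vertex_decompose[OF L one_neq_zero]
  obtain f0 g where f0: "f0 \<in> vertex_forms q (Suc (Suc m))" "g \<in> forms (Suc m)" "f = f0 + coord 3 * g"
    using decompose[OF f(1), unfolded diff_Suc_1] by blast
  obtain g0 h where g0: "g0 \<in> vertex_forms q (Suc m)" "h \<in> forms m" "g = g0 + coord 3 * h"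
    using decompose[OF f0(2), unfolded diff_Suc_1] by blast
  obtain S where S: "S \<in> binary_forms (Suc (Suc m))" "\<And>p. eval3 f0 p = S (proj_u q p) (proj_v q p)"
    using vertex_forms_eval[OF f0(1)] by blast
  obtain T where T: "T \<in> binary_forms (Suc m)" "\<And>p. eval3 g0 p = T (proj_u q p) (proj_v q p)"
    using vertex_forms_eval[OF g0(1)] by blast
  have ev: "eval3 f p = S (proj_u q p) (proj_v q p) + p $ 3 * (T (proj_u q p) (proj_v q p) + p $ 3 * eval3 h p)" for p
    by (simp add: f0(3) g0(3) eval3_add eval3_mult eval3_coord S(2) T(2))
  have h0: "eval3 h (vertex q + p) = 0" if p: "p $ 3 = 0" for p
  proof -
    obtain G where G: "\<And>t. eval3 f (vertex q + t *s p) = t ^ Suc m * poly G t"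
      using ideal_power_order[OF I fI, where p = p] by blast
    have "monom_degree x \<le> m" if "x \<in> Poly_Mapping.keys h" for x
      using g0(2) that by (simp add: forms_def)
    then obtain H where H: "degree H \<le> m" "\<And>t. eval3 h (vertex q + t *s p) = poly H t"
      by (rule eval3_on_line) (assumption | rule that)+
    define s \<tau> where "s = S (proj_u q p) (proj_v q p)" and "\<tau> = T (proj_u q p) (proj_v q p)"
    have "poly H t = poly (monom 1 (Suc m) * (G - monom s 1 - [:\<tau>:])) t" for t
    proof -
      have "(vertex q + t *s p) $ 3 = 1" using p by (simp add: vertex_def)
      then have "t ^ Suc m * poly G t = t ^ Suc (Suc m) * s + (t ^ Suc m * \<tau> + poly H t)"
        using ev[of "vertex q + t *s p"]
        unfolding G H(2) proj_vertex_line binary_forms_homogeneous[OF S(1)] binary_forms_homogeneous[OF T(1)] s_def \<tau>_def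
        by simp
      then show ?thesis by (simp add: poly_monom algebra_simps)
    qed
    then have H_eq: "H = monom 1 (Suc m) * (G - monom s 1 - [:\<tau>:])" by (intro poly_ext)
    \<comment> \<open>\<open>H\<close> is divisible by \<open>t^(m+1)\<close> but has degree at most
      \<open>m\<close>.\<close>
    have "H = 0"
    proof (rule ccontr)
      assume "H \<noteq> 0"
      then have "G - monom s 1 - [:\<tau>:] \<noteq> 0" using H_eq by auto
      then have "degree H = Suc m + degree (G - monom s 1 - [:\<tau>:])"
        unfolding H_eq by (subst degree_mult_eq) (auto simp: degree_monom_eq)
      with H(1) show False by simp
    qed
    then show ?thesis using H(2)[of 1] by simp
  qed
  \<comment> \<open>Homogeneity carries the vanishing from the chart to all vectors with nonzero
    third coordinate; the factor \<open>x $ 3\<close> covers the others.\<close>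
  have h: "x $ 3 * eval3 h x = 0" for x
  proof (cases "x $ 3 = 0")
    case False
    define p where "p = (1 / x $ 3) *s x - vertex q"
    have "p $ 3 = 0" using False by (simp add: p_def vertex_def)
    from h0[OF this] have "eval3 h ((1 / x $ 3) *s x) = 0" by (simp add: p_def)
    then show ?thesis using False eval3_homogeneous[OF g0(2)] by simp
  qed simp
  have cone: "eval3 f p = cone_value T S q p" for p
    unfolding ev cone_value_def h by simp
  have "\<exists>u v. T u v \<noteq> 0 \<or> S u v \<noteq> 0"
  proof (rule ccontr)
    assume "\<not> ?thesis"
    then have "eval3 f p = 0" for p by (simp add: cone cone_value_def)
    with eval3_eq_zero_imp[OF f(1)] f(2) show False by blast
  qed
  moreover have "T \<in> binary_forms_pred (Suc (Suc m))"
    using T(1) by (simp only: binary_forms_pred.simps)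
  moreover have "\<forall>p\<in>P. cone_value T S q p = 0"
    using P cone by simp
  ultimately show ?thesis
    unfolding has_cone_curve_def using S(1) by blast
qed

text \<open>Newton interpolation at distinct directions: the value at \<open>p\<close> is attained
  by a power of a linear form that is 1 there, and the other values are corrected by a multiple of
  the linear form \<open>r\<close> vanishing at \<open>p\<close>.\<close>

lemma binary_forms_interpolate:
  assumes "finite E" "card E \<le> n"
    and "\<And>p. p \<in> E \<Longrightarrow> proj_u q p \<noteq> 0 \<or> proj_v q p \<noteq> 0"
    and "\<And>p p'. p \<in> E \<Longrightarrow> p' \<in> E \<Longrightarrow> p \<noteq> p' \<Longrightarrow>
          proj_u q p * proj_v q p' - proj_u q p' * proj_v q p \<noteq> 0"
  shows "\<exists>F\<in>binary_forms n. \<forall>p\<in>E. F (proj_u q p) (proj_v q p) = y p"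
  using assms
proof (induction E arbitrary: n y rule: finite_induct)
  case empty
  then show ?case using binary_forms_zero by blast
next
  case (insert p E)
  obtain m where m: "n = Suc m" "card E \<le> m" using insert.prems(1) insert.hyps by (cases n) auto
  obtain l1 l2 where l: "l1 * proj_u q p + l2 * proj_v q p = 1"
    by (rule ex_linear_form_eq_1[OF insert.prems(2)[of p]]) (use that in auto)
  define r where "r u v = proj_v q p * u - proj_u q p * v" for u v
  have r: "r (proj_u q p') (proj_v q p') \<noteq> 0" if "p' \<in> E" for p'
    using insert.prems(3)[of p' p] that insert.hyps(2) by (auto simp: r_def algebra_simps)
  obtain F where F: "F \<in> binary_forms m"
    "\<forall>p'\<in>E. F (proj_u q p') (proj_v q p')
       = (y p' - y p * (l1 * proj_u q p' + l2 * proj_v q p') ^ n) / r (proj_u q p') (proj_v q p')"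
    using insert.IH[OF m(2), of "\<lambda>p'. (y p' - y p * (l1 * proj_u q p' + l2 * proj_v q p') ^ n) / r (proj_u q p') (proj_v q p')"]
      insert.prems(2,3) by auto
  define F' where "F' u v = y p * (l1 * u + l2 * v) ^ n + (proj_v q p * u + (- proj_u q p) * v) * F u v" for u v
  have "F' \<in> binary_forms n"
    unfolding F'_def[abs_def]
    by (intro binary_forms_add binary_forms_scale binary_forms_linear_power)
       (unfold m(1), rule binary_forms_linear_mult[OF F(1)])
  moreover have "F' (proj_u q p) (proj_v q p) = y p"
    by (simp add: F'_def l)
  moreover have "F' (proj_u q p') (proj_v q p') = y p'" if "p' \<in> E" for p'
    using r[OF that] F(2) that by (simp add: F'_def r_def)
  ultimately show ?case by blast
qed

text \<open>Write \<open>f = f0 + L g\<close> and interpolate \<open>g\<close> on \<open>E\<close>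
  by a form \<open>b\<close> in \<open>u, v\<close>. Then \<open>L (g - b)\<close> vanishes on
  \<open>P\<close>: the factor \<open>L\<close> off \<open>E\<close>, the other on \<open>E\<close>.
  The rest \<open>f0 + L b\<close> lies in the \<open>n\<close>-th power.\<close>

lemma form_in_sum_if_line:
  assumes L: "L = const_scale t (coord 3) + const_scale s1 (form_u q) + const_scale s2 (form_v q)" and t: "t \<noteq> 0"
    and I: "form_u q \<in> I" "form_v q \<in> I"
    and E: "finite E" "card E \<le> n"
    and dir: "\<And>p. p \<in> E \<Longrightarrow> proj_u q p \<noteq> 0 \<or> proj_v q p \<noteq> 0"
    and distinct: "\<And>p p'. p \<in> E \<Longrightarrow> p' \<in> E \<Longrightarrow> p \<noteq> p' \<Longrightarrow>
          proj_u q p * proj_v q p' - proj_u q p' * proj_v q p \<noteq> 0"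
    and P: "\<And>p. p \<in> P - E \<Longrightarrow> eval3 L p = 0"
    and f: "f \<in> forms (Suc n)"
  shows "\<exists>a\<in>forms (Suc n). (\<forall>p\<in>P. eval3 a p = 0) \<and> f - a \<in> ideal_power I n"
proof -
  obtain f0 g where f0: "f0 \<in> vertex_forms q (Suc n)" and g: "g \<in> forms n" and f_eq: "f = f0 + L * g"
    using forms_vertex_decompose[OF L t f, unfolded diff_Suc_1] by blast
  obtain F where F: "F \<in> binary_forms n" "\<forall>p\<in>E. F (proj_u q p) (proj_v q p) = eval3 g p"
    using binary_forms_interpolate[OF E dir distinct] by blast
  obtain b where b: "b \<in> vertex_forms q n" "\<forall>p. eval3 b p = F (proj_u q p) (proj_v q p)"
    using vertex_forms_of_binary[OF F(1)] by blast
  obtain x y where xy: "x \<in> vertex_forms q n" "y \<in> vertex_forms q n" "f0 = form_u q * x + form_v q * y"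
    by (rule vertex_forms_SucE[OF f0]) (rule that)
  have "L \<in> forms 1"
    unfolding L by (intro forms_add forms_const_scale coord_forms form_u_forms form_v_forms)
  then have "L * (g - b) \<in> forms (1 + n)"
    using forms_diff[OF g vertex_forms_forms[OF b(1)]] by (rule forms_mult)
  moreover have "eval3 (L * (g - b)) p = 0" if "p \<in> P" for p
    using P[of p] that F(2) b(2) by (cases "p \<in> E") (auto simp: eval3_mult eval3_diff)
  moreover have "f - L * (g - b) \<in> ideal_power I n"
  proof -
    have "f - L * (g - b) = form_u q * x + form_v q * y + L * b"
      unfolding f_eq xy(3) by (simp add: algebra_simps)
    then show ?thesis
      using vertex_forms_ideal_power[OF I] xy(1,2) b(1)
      by (auto intro!: poly3_ideal.subspace_add[OF ideal_power_subspace] poly3_ideal.subspace_scale[OF ideal_power_subspace])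
  qed
  ultimately show ?thesis by (intro bexI[of _ "L * (g - b)"]) auto
qed


section \<open>Unexpected curves\<close>

lemma line_of_span:
  obtains v where "v \<noteq> 0" "line_of z = range (\<lambda>c. c *s v)"
proof -
  have L: "vec.subspace (line_of z)" "vec.dim (line_of z) = 1"
    using line_of[of z] by auto
  obtain B where B: "B \<subseteq> line_of z" "vec.independent B" "line_of z \<subseteq> vec.span B" "card B = vec.dim (line_of z)"
    by (rule vec.basis_exists) (rule that)
  then obtain v where v: "B = {v}" using L(2) by (metis card_1_singletonE)
  have "line_of z = vec.span {v}"
    using B v vec.span_minimal[OF _ L(1)] by blast
  moreover have "v \<noteq> 0" using B(2) v by auto
  ultimately show thesis using that vec.span_singleton by metis
qed

text \<open>A chosen vector of homogeneous coordinates; for forms, vanishing at the point is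
  vanishing at this vector.\<close>

definition rep :: "proj_plane \<Rightarrow> complex ^ 3" where
  "rep z = (SOME v. v \<noteq> 0 \<and> line_of z = range (\<lambda>c. c *s v))"

lemma rep_nonzero: "rep z \<noteq> 0" and line_of_rep: "line_of z = range (\<lambda>c. c *s rep z)"
proof -
  have "\<exists>v. v \<noteq> 0 \<and> line_of z = range (\<lambda>c. c *s v)" using line_of_span by metis
  from someI_ex[OF this] show "rep z \<noteq> 0" "line_of z = range (\<lambda>c. c *s rep z)"
    unfolding rep_def by blast+
qed

lemma line_of_minus_zero:
  assumes "v \<noteq> 0" "line_of z = range (\<lambda>c. c *s v)"
  shows "line_of z - {0} = {c *s v | c. c \<noteq> 0}"
  using assms by (auto simp: vec.scale_eq_0_iff)

lemma vanishes_at_form_iff: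
  assumes f: "f \<in> forms d" and v: "v \<noteq> 0" "line_of z = range (\<lambda>c. c *s v)"
  shows "vanishes_at f z \<longleftrightarrow> eval3 f v = 0"
  unfolding vanishes_at_def line_of_minus_zero[OF v]
proof
  assume "\<forall>w\<in>{c *s v |c. c \<noteq> 0}. eval3 f w = 0"
  moreover have "v = 1 *s v" by simp
  ultimately show "eval3 f v = 0" by (metis (mono_tags, lifting) mem_Collect_eq one_neq_zero)
qed (auto simp: eval3_homogeneous[OF f])

lemma vanishing_ideal_form_iff:
  "f \<in> forms d \<Longrightarrow> f \<in> vanishing_ideal Z \<longleftrightarrow> (\<forall>p\<in>rep ` Z. eval3 f p = 0)"
  by (simp add: vanishing_ideal_def vanishes_at_form_iff[OF _ rep_nonzero line_of_rep])

lemma vanishing_ideal_subspace: "poly3_vs.subspace (vanishing_ideal Z)"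
  by (simp add: poly3_vs.subspace_def vanishing_ideal_def vanishes_at_def eval3_add eval3_const_scale)

lemma rep_inj:
  assumes "rep z = c *s rep z'" shows "z = z'"
proof -
  have "c \<noteq> 0" using assms rep_nonzero[of z] by auto
  have "line_of z = line_of z'"
    unfolding line_of_rep assms
  proof (intro equalityI subsetI; clarify)
    fix e
    show "e *s (c *s rep z') \<in> range (\<lambda>c. c *s rep z')"
      unfolding vec.scale_scale by (rule rangeI)
    have "e *s rep z' = (e / c) *s (c *s rep z')" using \<open>c \<noteq> 0\<close> by (simp add: vec.scale_scale)
    then show "e *s rep z' \<in> range (\<lambda>e. e *s (c *s rep z'))" by (rule range_eqI)
  qed
  then show ?thesis by (simp add: line_of_inject)
qed

lemma ex_point_of_vector:
  assumes "v \<noteq> (0 :: complex ^ 3)"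
  obtains z where "line_of z = range (\<lambda>c. c *s v)"
proof -
  have "vec.dim (vec.span {v}) = 1"
    using assms by (simp add: vec.dim_span_eq_card_independent vec.independent_insert)
  then have "line_of (Abs_proj_plane (vec.span {v})) = vec.span {v}"
    by (intro Abs_proj_plane_inverse) (simp add: vec.subspace_span)
  then show thesis using that vec.span_singleton by metis
qed

text \<open>The linear form sending \<open>x\<close> to the determinant of \<open>p\<close>,
  \<open>p'\<close>, \<open>x\<close>: the equation of the line joining the two points.\<close>

definition cross :: "complex ^ 3 \<Rightarrow> complex ^ 3 \<Rightarrow> poly3" where
  "cross p p' = const_scale (p $ 2 * p' $ 3 - p $ 3 * p' $ 2) (coord 1)
    + const_scale (p $ 3 * p' $ 1 - p $ 1 * p' $ 3) (coord 2)
    + const_scale (p $ 1 * p' $ 2 - p $ 2 * p' $ 1) (coord 3)"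

lemma cross_forms: "cross p p' \<in> forms 1"
  unfolding cross_def by (intro forms_add forms_const_scale coord_forms)

lemma eval3_cross_vertex:
  "eval3 (cross p p') (vertex q) = proj_u q p * proj_v q p' - proj_u q p' * proj_v q p"
  unfolding cross_def eval3_add eval3_const_scale eval3_coord
  by (simp add: vertex_def proj_u_def proj_v_def algebra_simps)

text \<open>The coefficients are the minors of the two coordinate vectors; if all vanish, the
  vectors are proportional.\<close>

lemma ex_cross_nonzero:
  assumes "z \<noteq> z'" shows "\<exists>x. eval3 (cross (rep z) (rep z')) x \<noteq> 0"
proof (rule ccontr)
  assume "\<not> ?thesis"
  then have 0: "eval3 (cross (rep z) (rep z')) x = 0" for x by blast
  let ?p = "rep z" and ?p' = "rep z'"
  have 1: "?p $ 2 * ?p' $ 3 = ?p $ 3 * ?p' $ 2"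
    using 0[of "axis 1 1"] by (simp add: cross_def eval3_add eval3_const_scale eval3_coord axis_def)
  have 2: "?p $ 3 * ?p' $ 1 = ?p $ 1 * ?p' $ 3"
    using 0[of "axis 2 1"] by (simp add: cross_def eval3_add eval3_const_scale eval3_coord axis_def)
  have 3: "?p $ 1 * ?p' $ 2 = ?p $ 2 * ?p' $ 1"
    using 0[of "axis 3 1"] by (simp add: cross_def eval3_add eval3_const_scale eval3_coord axis_def)
  have minors: "?p $ i * ?p' $ j = ?p $ j * ?p' $ i" for i j
    using exhaust_3[of i] exhaust_3[of j] 1 2 3 by auto
  obtain j where j: "?p' $ j \<noteq> 0"
    using rep_nonzero[of z'] by (metis vec_eq_iff zero_index)
  have "?p = (?p $ j / ?p' $ j) *s ?p'"
    using j minors by (simp add: vec_eq_iff field_simps)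
  with rep_inj assms show False by blast
qed

text \<open>On the line joining a good point for \<open>H\<close> to one for \<open>h\<close>, the
  product of the restrictions is a nonzero polynomial and has a non-root.\<close>

lemma ex_common_nonzero:
  assumes "finite H" "\<And>h. h \<in> H \<Longrightarrow> \<exists>x. eval3 h x \<noteq> 0"
  shows "\<exists>x. \<forall>h\<in>H. eval3 h x \<noteq> 0"
  using assms
proof (induction H rule: finite_induct)
  case (insert h H)
  obtain a where a: "\<forall>h\<in>H. eval3 h a \<noteq> 0" using insert by blast
  obtain b where b: "eval3 h b \<noteq> 0" using insert.prems by blast
  obtain P where P: "\<And>g t. eval3 g (a + t *s (b - a)) = poly (P g) t"
    using eval3_poly_on_line[of _ a "b - a"] by metis
  have "P g \<noteq> 0" if "g \<in> H" for g
    using P[of g 0] a that by auto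
  moreover have "P h \<noteq> 0"
    using P[of h 1] b by auto
  ultimately have "(\<Prod>g\<in>insert h H. P g) \<noteq> 0"
    using insert.hyps by auto
  then obtain t where "poly (\<Prod>g\<in>insert h H. P g) t \<noteq> 0"
    using poly_all_0_iff_0 by blast
  then have "\<forall>g\<in>insert h H. eval3 g (a + t *s (b - a)) \<noteq> 0"
    using insert.hyps unfolding P poly_prod by auto
  then show ?case by blast
qed simp

section \<open>Vertices in general position\<close>

lemma continuous_eval3_vertex: "continuous_on UNIV (\<lambda>q. eval3 f (vertex q))"
proof -
  have "continuous_on UNIV (\<lambda>q. vertex q $ i)" for i
    using exhaust_3[of i]
    by (elim disjE) (simp_all add: vertex_def continuous_on_fst continuous_on_snd continuous_on_id continuous_on_const)
  then show ?thesis
    unfolding eval3_def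
    by (intro continuous_on_sum continuous_on_mult continuous_on_const continuous_on_prod continuous_on_power)
qed

text \<open>Homogeneity moves a point where no form of \<open>H\<close> vanishes to the affine chart.\<close>

lemma generic_vertices:
  assumes H: "finite H" "\<And>h. h \<in> H \<Longrightarrow> \<exists>n. h \<in> forms n" "\<And>h. h \<in> H \<Longrightarrow> \<exists>x. eval3 h x \<noteq> 0"
  shows "open {q. \<forall>h\<in>H. eval3 h (vertex q) \<noteq> 0}" "{q. \<forall>h\<in>H. eval3 h (vertex q) \<noteq> 0} \<noteq> {}"
proof -
  have "{q. \<forall>h\<in>H. eval3 h (vertex q) \<noteq> 0} = (\<Inter>h\<in>H. {q. eval3 h (vertex q) \<noteq> 0})" by blast
  also have "open \<dots>"
    using H(1) by (intro open_INT ballI open_Collect_neq continuous_eval3_vertex continuous_on_const)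
  finally show "open {q. \<forall>h\<in>H. eval3 h (vertex q) \<noteq> 0}" .
  have "\<exists>x. eval3 (coord 3) x \<noteq> 0"
    by (intro exI[of _ "axis 3 1"]) (simp add: eval3_coord axis_def)
  \<comment> \<open>Adding \<open>coord 3\<close> to \<open>H\<close> ensures that the point found
    can be scaled into the affine chart.\<close>
  then obtain x where x: "\<forall>h\<in>insert (coord 3) H. eval3 h x \<noteq> 0"
    using ex_common_nonzero[of "insert (coord 3) H"] H(1,3) by auto
  then have x3: "x $ 3 \<noteq> 0" by (simp add: eval3_coord)
  define q where "q = (x $ 1 / x $ 3, x $ 2 / x $ 3)"
  have "x $ i = (x $ 3 *s vertex q) $ i" for i
    using exhaust_3[of i] x3 by (auto simp: vertex_def q_def)
  then have x_eq: "x = x $ 3 *s vertex q" by (intro iffD2[OF vec_eq_iff] allI)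
  have "eval3 h (vertex q) \<noteq> 0" if h: "h \<in> H" for h
  proof -
    obtain n where "h \<in> forms n" using H(2)[OF h] by blast
    from arg_cong[OF x_eq, of "eval3 h"] have "eval3 h x = (x $ 3) ^ n * eval3 h (vertex q)"
      unfolding eval3_homogeneous[OF \<open>h \<in> forms n\<close>] .
    then show ?thesis using x h by auto
  qed
  then show "{q. \<forall>h\<in>H. eval3 h (vertex q) \<noteq> 0} \<noteq> {}" by blast
qed

lemma vertex_nonzero: "vertex q \<noteq> 0"
proof
  assume "vertex q = 0"
  then have "vertex q $ 3 = 0" by simp
  then show False by (simp add: vertex_def)
qed

text \<open>One equation \<open>\<phi>\<close> of the closed complement is nonzero at some point of
  the open set, and every vertex off \<open>\<phi> = 0\<close> is a general point; \<open>I\<close>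
  is its ideal. Comparison with 0 gives the nonzero form, and by
  \<open>graded_dim_Int_if_sum\<close> a full sum would turn the other strict inequality into an
  equality.\<close>

lemma unexpected_at_vertex:
  assumes "admits_unexpected_curve Z (Suc n)"
  obtains e \<phi> where "\<phi> \<in> forms e" "\<exists>x. eval3 \<phi> x \<noteq> 0"
    "\<And>q. eval3 \<phi> (vertex q) \<noteq> 0 \<Longrightarrow> \<exists>I. (\<forall>f\<in>I. eval3 f (vertex q) = 0) \<and>
       (\<forall>d. \<forall>f\<in>forms (Suc d). eval3 f (vertex q) = 0 \<longrightarrow> f \<in> I) \<and>
       (\<exists>f\<in>forms (Suc n). f \<noteq> 0 \<and> (\<forall>p\<in>rep ` Z. eval3 f p = 0) \<and> f \<in> ideal_power I n) \<and>
       \<not> (\<forall>f\<in>forms (Suc n). \<exists>a\<in>forms (Suc n). (\<forall>p\<in>rep ` Z. eval3 a p = 0) \<and> f - a \<in> ideal_power I n)"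
proof -
  let ?A = "vanishing_ideal Z"
  let ?J = "\<lambda>Q. ideal_power (vanishing_ideal {Q}) n"
  obtain U where U: "zariski_closed (- U)" "U \<noteq> {}"
    and gt: "\<And>Q. Q \<in> U \<Longrightarrow> max 0 (int (graded_dim ?A (Suc n)) - int (quotient_graded_dim (?J Q) (Suc n)))
        < int (graded_dim (?A \<inter> ?J Q) (Suc n))"
    using assms unfolding admits_unexpected_curve_def for_general_point_def by auto
  obtain F where F: "F \<subseteq> (\<Union>d. forms d)" "- U = {P. \<forall>f\<in>F. vanishes_at f P}"
    using U(1) unfolding zariski_closed_def by blast
  obtain P0 where "P0 \<in> U" using U(2) by blast
  then have "P0 \<notin> {P. \<forall>f\<in>F. vanishes_at f P}" unfolding F(2)[symmetric] by simp
  then obtain \<phi> where \<phi>: "\<phi> \<in> F" "\<not> vanishes_at \<phi> P0" by blast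
  then obtain e where e: "\<phi> \<in> forms e" using F(1) by blast
  have ex: "\<exists>x. eval3 \<phi> x \<noteq> 0" using \<phi>(2) unfolding vanishes_at_def by blast
  show thesis
  proof (rule that[OF e ex])
    fix q assume q: "eval3 \<phi> (vertex q) \<noteq> 0"
    obtain Q where Q: "line_of Q = range (\<lambda>c. c *s vertex q)"
      by (rule ex_point_of_vector[OF vertex_nonzero]) (rule that)
    have "\<not> vanishes_at \<phi> Q" using q vanishes_at_form_iff[OF e vertex_nonzero Q] by simp
    then have "Q \<notin> - U" unfolding F(2) using \<phi>(1) by blast
    then have "Q \<in> U" by simp
    note gt = gt[OF this]
    let ?I = "vanishing_ideal {Q}"
    have 1: "\<forall>f\<in>?I. eval3 f (vertex q) = 0"
    proof
      fix f assume "f \<in> ?I"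
      moreover have "vertex q = 1 *s vertex q" by simp
      then have "vertex q \<in> line_of Q - {0}" unfolding Q using vertex_nonzero by blast
      ultimately show "eval3 f (vertex q) = 0" by (simp add: vanishing_ideal_def vanishes_at_def)
    qed
    have 2: "f \<in> ?I" if "f \<in> forms (Suc d)" "eval3 f (vertex q) = 0" for f d
      using that vanishes_at_form_iff[OF that(1) vertex_nonzero Q] by (simp add: vanishing_ideal_def)
    have "graded_dim (?A \<inter> ?J Q) (Suc n) > 0" using gt by linarith
    then obtain f where f: "f \<in> ?A \<inter> ?J Q" "f \<in> forms (Suc n)" "f \<noteq> 0" by (rule graded_dim_pos)
    have 3: "\<exists>f\<in>forms (Suc n). f \<noteq> 0 \<and> (\<forall>p\<in>rep ` Z. eval3 f p = 0) \<and> f \<in> ?J Q"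
      using f vanishing_ideal_form_iff[OF f(2), of Z] by (intro bexI[of _ f]) auto
    have 4: "\<not> (\<forall>f\<in>forms (Suc n). \<exists>a\<in>forms (Suc n). (\<forall>p\<in>rep ` Z. eval3 a p = 0) \<and> f - a \<in> ?J Q)"
    proof
      assume *: "\<forall>f\<in>forms (Suc n). \<exists>a\<in>forms (Suc n). (\<forall>p\<in>rep ` Z. eval3 a p = 0) \<and> f - a \<in> ?J Q"
      have "graded_dim ?A (Suc n) = graded_dim (?A \<inter> ?J Q) (Suc n) + quotient_graded_dim (?J Q) (Suc n)"
      proof (rule graded_dim_Int_if_sum[OF vanishing_ideal_subspace ideal_power_vs_subspace])
        fix f assume "f \<in> forms (Suc n)"
        then obtain a where "a \<in> forms (Suc n)" "\<forall>p\<in>rep ` Z. eval3 a p = 0" "f - a \<in> ?J Q" using * by blast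
        then show "\<exists>a\<in>?A \<inter> forms (Suc n). f - a \<in> ?J Q"
          using vanishing_ideal_form_iff[of a "Suc n" Z] by blast
      qed
      with gt show False by simp
    qed
    show "\<exists>I. (\<forall>f\<in>I. eval3 f (vertex q) = 0) \<and>
       (\<forall>d. \<forall>f\<in>forms (Suc d). eval3 f (vertex q) = 0 \<longrightarrow> f \<in> I) \<and>
       (\<exists>f\<in>forms (Suc n). f \<noteq> 0 \<and> (\<forall>p\<in>rep ` Z. eval3 f p = 0) \<and> f \<in> ideal_power I n) \<and>
       \<not> (\<forall>f\<in>forms (Suc n). \<exists>a\<in>forms (Suc n). (\<forall>p\<in>rep ` Z. eval3 a p = 0) \<and> f - a \<in> ideal_power I n)"
      using 1 2 3 4 by (intro exI[of _ ?I] conjI) auto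
  qed
qed

theorem theorem7p6:
  fixes Z :: "proj_plane set" and d :: nat
  assumes "finite Z"
    and "d \<ge> 1"
    and "admits_unexpected_curve Z d"
  shows "card Z \<le> 3 * d - 3"
proof (rule ccontr)
  assume not_le: "\<not> ?thesis"
  obtain n where n: "d = Suc n" using assms(2) by (cases d) auto
  let ?P = "rep ` Z"
  let ?sum = "\<lambda>I. \<forall>f\<in>forms (Suc n). \<exists>a\<in>forms (Suc n). (\<forall>p\<in>?P. eval3 a p = 0) \<and> f - a \<in> ideal_power I n"
  let ?nz = "\<lambda>I. \<exists>f\<in>forms (Suc n). f \<noteq> 0 \<and> (\<forall>p\<in>?P. eval3 f p = 0) \<and> f \<in> ideal_power I n"
  obtain e \<phi> where \<phi>: "\<phi> \<in> forms e" "\<exists>x. eval3 \<phi> x \<noteq> 0"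
    and un: "\<And>q. eval3 \<phi> (vertex q) \<noteq> 0 \<Longrightarrow> \<exists>I. (\<forall>f\<in>I. eval3 f (vertex q) = 0) \<and>
       (\<forall>d. \<forall>f\<in>forms (Suc d). eval3 f (vertex q) = 0 \<longrightarrow> f \<in> I) \<and> ?nz I \<and> \<not> ?sum I"
    by (rule unexpected_at_vertex[OF assms(3)[unfolded n]]) (rule that)
  have inj: "inj_on rep Z" using rep_inj[of _ 1] by (intro inj_onI) simp
  then have cardP: "card ?P = card Z" by (rule card_image)
  consider "n = 0" | "n = 1" | "n \<ge> 2" by linarith
  then show False
  proof cases
    case 1
    have "open {q. \<forall>h\<in>{\<phi>}. eval3 h (vertex q) \<noteq> 0}" "{q. \<forall>h\<in>{\<phi>}. eval3 h (vertex q) \<noteq> 0} \<noteq> {}"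
      using \<phi> by (intro generic_vertices; blast)+
    then obtain q where "eval3 \<phi> (vertex q) \<noteq> 0" by blast
    from un[OF this] obtain I where "\<not> ?sum I" by blast
    \<comment> \<open>The zeroth power is the whole ring, so \<open>a = 0\<close> serves for every
      form.\<close>
    moreover have "?sum I" using 1 forms_zero by (auto intro!: bexI[of _ 0])
    ultimately show False by contradiction
  next
    case 2
    have "{q. \<forall>h\<in>{\<phi>}. eval3 h (vertex q) \<noteq> 0} \<noteq> {}"
      using \<phi> by (intro generic_vertices(2); blast)
    then obtain q0 where "eval3 \<phi> (vertex q0) \<noteq> 0" by blast
    from un[OF this] obtain f where f: "f \<in> forms (Suc n)" "f \<noteq> 0" "\<forall>p\<in>?P. eval3 f p = 0" by blast
    have "\<exists>x. eval3 f x \<noteq> 0" using eval3_eq_zero_imp[OF f(1)] f(2) by blast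
    \<comment> \<open>The conic \<open>f\<close> found at the first vertex misses a general second
      vertex. There subtracting a multiple of \<open>f\<close> puts any form into \<open>I\<close>,
      which is the power in question.\<close>
    then have "{q. \<forall>h\<in>{\<phi>, f}. eval3 h (vertex q) \<noteq> 0} \<noteq> {}"
      using \<phi> f(1) by (intro generic_vertices(2)) auto
    then obtain q where q: "eval3 \<phi> (vertex q) \<noteq> 0" "eval3 f (vertex q) \<noteq> 0" by blast
    from un[OF q(1)] obtain I where I: "\<forall>d. \<forall>f\<in>forms (Suc d). eval3 f (vertex q) = 0 \<longrightarrow> f \<in> I"
      and not_sum: "\<not> ?sum I"
      by blast
    have "?sum I"
    proof
      fix g assume g: "g \<in> forms (Suc n)"
      let ?a = "const_scale (eval3 g (vertex q) / eval3 f (vertex q)) f"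
      have a: "?a \<in> forms (Suc n)" using f(1) by (rule forms_const_scale)
      have "eval3 (g - ?a) (vertex q) = 0" using q(2) by (simp add: eval3_diff eval3_const_scale)
      then have "g - ?a \<in> I" using I forms_diff[OF g a] by blast
      then have "(g - ?a) * 1 \<in> ideal_power I (Suc 0)" by (rule ideal_power_SucI) simp
      then have "g - ?a \<in> ideal_power I n" using 2 by simp
      moreover have "\<forall>p\<in>?P. eval3 ?a p = 0" using f(3) by (simp add: eval3_const_scale)
      ultimately show "\<exists>a\<in>forms (Suc n). (\<forall>p\<in>?P. eval3 a p = 0) \<and> g - a \<in> ideal_power I n"
        using a by blast
    qed
    with not_sum show False by contradiction
  next
    case 3
    obtain m where m: "n = Suc m" using 3 by (cases n) auto
    \<comment> \<open>The vertex has to avoid \<open>\<phi> = 0\<close> and all lines joining two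
      points of \<open>Z\<close>, so that the points have distinct directions from it.\<close>
    define H where "H = insert \<phi> ((\<lambda>(z, z'). cross (rep z) (rep z')) ` {(z, z') \<in> Z \<times> Z. z \<noteq> z'})"
    define V where "V = {q. \<forall>h\<in>H. eval3 h (vertex q) \<noteq> 0}"
    have "finite {(z, z') \<in> Z \<times> Z. z \<noteq> z'}"
      by (rule finite_subset[of _ "Z \<times> Z"]) (use assms(1) in auto)
    then have finH: "finite H" by (simp add: H_def)
    have "\<exists>k. h \<in> forms k" "\<exists>x. eval3 h x \<noteq> 0" if "h \<in> H" for h
      using that \<phi> cross_forms ex_cross_nonzero unfolding H_def by auto
    note V = generic_vertices[OF finH this, folded V_def]
    have general: "proj_u q p * proj_v q p' - proj_u q p' * proj_v q p \<noteq> 0"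
      if q: "q \<in> V" and p: "p \<in> ?P" "p' \<in> ?P" "p \<noteq> p'" for q p p'
    proof -
      obtain z z' where z: "z \<in> Z" "z' \<in> Z" "p = rep z" "p' = rep z'" using p(1,2) by blast
      then have "cross p p' \<in> H"
        using p(3) unfolding H_def by (intro insertI2 image_eqI[of _ _ "(z, z')"]) auto
      then have "eval3 (cross p p') (vertex q) \<noteq> 0" using q unfolding V_def by blast
      then show ?thesis unfolding eval3_cross_vertex .
    qed
    have unV: "\<exists>I. (\<forall>f\<in>I. eval3 f (vertex q) = 0) \<and>
       (\<forall>d. \<forall>f\<in>forms (Suc d). eval3 f (vertex q) = 0 \<longrightarrow> f \<in> I) \<and> ?nz I \<and> \<not> ?sum I" if "q \<in> V" for q
      using that by (intro un) (simp add: V_def H_def)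
    have curve: "has_cone_curve (Suc n) ?P q" if q: "q \<in> V" for q
    proof -
      obtain I f where "\<forall>f\<in>I. eval3 f (vertex q) = 0"
        "f \<in> forms (Suc n)" "f \<noteq> 0" "\<forall>p\<in>?P. eval3 f p = 0" "f \<in> ideal_power I n"
        using unV[OF q] by blast
      then show ?thesis unfolding m by (intro has_cone_curve_if_form[of f m I]) auto
    qed
    have big: "3 * Suc n - 2 \<le> card ?P" using not_le unfolding n cardP by simp
    have n3: "3 \<le> Suc n" using 3 by simp
    obtain q t s1 s2 E where q: "q \<in> V" and t: "t \<noteq> 0" and E: "E \<subseteq> ?P" "card E \<le> Suc n - 1"
      and line: "\<And>p. p \<in> ?P - E \<Longrightarrow> t * p $ 3 + s1 * proj_u q p + s2 * proj_v q p = 0"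
      by (rule cone_curves_line[OF finite_imageI[OF assms(1)] V n3 big general curve]) (assumption | rule that)+
    obtain I where I: "\<forall>d. \<forall>f\<in>forms (Suc d). eval3 f (vertex q) = 0 \<longrightarrow> f \<in> I" and not_sum: "\<not> ?sum I"
      using unV[OF q] by blast
    have uv: "form_u q \<in> I" "form_v q \<in> I"
      using I[rule_format, of _ 0] form_u_forms form_v_forms
      by (simp_all add: eval3_form_u eval3_form_v proj_u_def proj_v_def vertex_def)
    define L where "L = const_scale t (coord 3) + const_scale s1 (form_u q) + const_scale s2 (form_v q)"
    \<comment> \<open>All but at most \<open>n\<close> points lie on \<open>L = 0\<close>, a line
      missing the vertex since \<open>t\<close> is nonzero; this contradicts
      \<open>not_sum\<close>.\<close>
    have "?sum I"
    proof
      fix f assume f: "f \<in> forms (Suc n)"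
      show "\<exists>a\<in>forms (Suc n). (\<forall>p\<in>?P. eval3 a p = 0) \<and> f - a \<in> ideal_power I n"
      proof (rule form_in_sum_if_line[OF L_def t uv _ _ _ _ _ f])
        show "finite E" using E(1) assms(1) finite_subset by blast
        show "card E \<le> n" using E(2) by simp
        show "proj_u q p * proj_v q p' - proj_u q p' * proj_v q p \<noteq> 0"
          if "p \<in> E" "p' \<in> E" "p \<noteq> p'" for p p'
          using general[OF q] that E(1) by blast
        show "proj_u q p \<noteq> 0 \<or> proj_v q p \<noteq> 0" if p: "p \<in> E" for p
        proof -
          have "\<not> ?P \<subseteq> {p}" using big 3 card_mono[of "{p}" ?P] by auto
          then obtain p' where "p' \<in> ?P" "p \<noteq> p'" by blast
          then show ?thesis using general[OF q, of p p'] p E(1) by fastforce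
        qed
        show "eval3 L p = 0" if "p \<in> ?P - E" for p
          using line[OF that] by (simp add: L_def eval3_add eval3_const_scale eval3_coord eval3_form_u eval3_form_v)
      qed
    qed
    with not_sum show False by contradiction
  qed
qed

end
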